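(* Let $n$ be a positive integer and $G = \mathbb{Z}/n$. A Bagnera-De Franchis manifold with group $G$ is completely determined by the following data: (1) finitely generated torsion free $R_d$-modules $\Lambda_d$, for all $d \mid n$, such that $\Lambda_1 \neq 0$ and with $\Lambda_1, \Lambda_2$ of even rank; (2) a finite subgroup $\Lambda^0 \subset A' := \bigoplus_{d \mid n} A_d$, where $A_d := \Lambda_{d,\mathbb{R}}/\Lambda_d$; (3) an element $\beta_1 \in A_1$ generating a subgroup $\langle \beta_1 \rangle$ of order exactly $n$; such that: (4) (A) $\Lambda^0$ is stable under multiplication by the element $x$ of the subring $R(n) \subset R'(n) := \bigoplus_{d \mid n} R_d$; (5) (B) $\Lambda^0 \cap A_d = 0$ for all $d \mid n$; (6) (C) the projection of $\Lambda^0$ into $A_1$ intersects the subgroup $\langle \beta_1 \rangle$ only in $0$; together with (7) the datum of a complex structure on each $\Lambda_d \otimes \mathbb{C}$, i.e. a Hodge decomposition $$\Lambda_d \otimes \mathbb{C} = V(d) \oplus \overline{V(d)},$$ which allows one to decompose $V(d) = \bigoplus_{j < d,\ (j,d)=1} V_j$ as a direct sum of eigenspaces for the action $\alpha$ of $x$. Moreover: (8) properties (A) and (B) imply that $\Lambda^0 \subset \bigoplus_{d \mid n} \left( \frac{\Phi_d}{Q_n} \Lambda_d \right)/\Lambda_d$; hence, in particular, the number of such subgroups $\Lambda^0$ (for given modules $\Lambda_d$) is finite.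
   Context: A Bagnera-De Franchis manifold with group $G = \mathbb{Z}/n$ is a quotient $X = A/G$ of a complex torus $A = V/\Lambda$ ($V$ a finite-dimensional complex vector space, $\Lambda \subset V$ a lattice) by a free action of the cyclic group $G$ such that $G$ contains no translations. Notation: $Q_n := x^n - 1 \in \mathbb{Z}[x]$; $\Phi_d$ is the $d$-th cyclotomic polynomial, so $Q_n = \prod_{d \mid n}\Phi_d$; $R(n) := \mathbb{Z}[x]/(Q_n)$ and $R_d := \mathbb{Z}[x]/(\Phi_d)$; $R(n)$ is regarded as a subring of $R'(n) = \bigoplus_{d\mid n} R_d$ via the natural projections. $R'(n)$ acts on $A'$ componentwise. $\Lambda_{d,\mathbb{Q}} := \Lambda_d \otimes \mathbb{Q}$ and $\Lambda_{d,\mathbb{R}} := \Lambda_d\otimes\mathbb{R}$. Even rank means even rank as an abelian group. Since $\frac{Q_n}{\Phi_d}(x)$ acts invertibly on $\Lambda_{d,\mathbb{R}}$, one sets $\frac{\Phi_d}{Q_n}\Lambda_d := \{ v \in \Lambda_{d,\mathbb{R}} : \frac{Q_n}{\Phi_d}(x)\, v \in \Lambda_d \}$. In (7), $V_j$ is the eigenspace with eigenvalue $\exp(2\pi i j/d)$, and $V(d)$ is invariant under the action of $x$ on $\Lambda_d \otimes \mathbb{C}$; for $d=1$ the only eigenvalue is $1$. Relation between data and manifold. From data to manifold: $\Lambda$ is the inverse image of $\Lambda^0$ under $\bigoplus_{d\mid n} \Lambda_{d,\mathbb{R}} \to A'$, so that $A'/\Lambda^0 = (\Lambda \otimes \mathbb{R})/\Lambda$;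 the complex structure on this real torus is the one given by $V := \bigoplus_{d \mid n} V(d) \subset \Lambda \otimes \mathbb{C}$, with $\Lambda\otimes\mathbb{C} = V \oplus \overline{V}$, yielding the complex torus $A = V/\Lambda$; $\alpha : V \to V$ is the linear map given by multiplication by $x$; a generator of $G$ acts on $A$ by $\gamma(v) = \alpha(v) + b$, where $b \in V(1)$ is a vector whose class in $A_1$ is $\beta_1$; and $X = A/G$. From manifold to data: writing a generator of $G$ as $\gamma(v) = \alpha(v) + b$ with $\alpha$ linear, one may choose the origin of $A$ so that $b$ lies in the eigenspace of $\alpha$ with eigenvalue $1$; $\alpha$ makes $\Lambda$ an $R(n)$-module, $\Lambda \otimes \mathbb{Q} = \bigoplus_{d \mid n}\Lambda_{d,\mathbb{Q}}$ with $\Lambda_{d,\mathbb{Q}}$ the part on which $\Phi_d(x)$ acts as zero, $\Lambda_d := \Lambda \cap \Lambda_{d,\mathbb{Q}}$, $\Lambda^0 := \Lambda/\bigoplus_{d\mid n}\Lambda_d$, and $\beta_1$ is the class of $b$ in $A_1$.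
   Formalization: For a given manifold, (C) is claimed only if Λ_{p^j}=0 for all primes p, j≥1 with p^{j+1}|n (else it can fail); the data give a free Z/n-quotient of a torus, which is Bagnera-De Franchis iff the lcm of the d with Λ_d≠0 is n; the zero torus is excluded. *)

theory Defs
  imports
    "HOL-Analysis.Analysis"
    "HOL-Algebra.Group_Action"
    "HOL-Algebra.Generated_Groups"
    "HOL-Algebra.Elementary_Groups"
    "HOL-Computational_Algebra.Polynomial"
    "HOL-Computational_Algebra.Primes"
begin

section \<open>Lattices, quotients, direct sums\<close>

definition int_span :: "'a::real_vector set \<Rightarrow> 'a set" where
  "int_span B = {\<Sum>b\<in>B. of_int (c b) *\<^sub>R b | c :: 'a \<Rightarrow> int. True}"

definition lattice_basis :: "'a::euclidean_space set \<Rightarrow> 'a set \<Rightarrow> bool" where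
  "lattice_basis B L \<longleftrightarrow> independent B \<and> L = int_span B"

definition is_lattice :: "'a::euclidean_space set \<Rightarrow> 'a set \<Rightarrow> bool" where
  "is_lattice L W \<longleftrightarrow> (\<exists>B. lattice_basis B L \<and> span B = W)"

definition lattice_rank :: "'a::euclidean_space set \<Rightarrow> nat" where
  "lattice_rank L = (THE r. \<exists>B. lattice_basis B L \<and> card B = r)"

definition vgroup :: "'a::ab_group_add set \<Rightarrow> 'a monoid" where
  "vgroup V = \<lparr>carrier = V, monoid.mult = (+), one = 0\<rparr>"

definition vquot :: "'a::ab_group_add set \<Rightarrow> 'a set \<Rightarrow> 'a set monoid" where
  "vquot V L = vgroup V Mod L"

definition vclass :: "'a::ab_group_add set \<Rightarrow> 'a set \<Rightarrow> 'a \<Rightarrow> 'a set" where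
  "vclass V L v = L #>\<^bsub>vgroup V\<^esub> v"

definition sum_of :: "'i set \<Rightarrow> ('i \<Rightarrow> 'a::comm_monoid_add set) \<Rightarrow> 'a set" where
  "sum_of I U = {\<Sum>i\<in>I. u i | u. \<forall>i\<in>I. u i \<in> U i}"

definition is_direct_sum :: "'i set \<Rightarrow> ('i \<Rightarrow> 'a::comm_monoid_add set) \<Rightarrow> 'a set \<Rightarrow> bool" where
  "is_direct_sum I U W \<longleftrightarrow> W = sum_of I U \<and>
     (\<forall>u. (\<forall>i\<in>I. u i \<in> U i) \<and> (\<Sum>i\<in>I. u i) = 0 \<longrightarrow> (\<forall>i\<in>I. u i = 0))"

definition proj_comp :: "'i set \<Rightarrow> ('i \<Rightarrow> 'a::comm_monoid_add set) \<Rightarrow> 'i \<Rightarrow> 'a \<Rightarrow> 'a" where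
  "proj_comp I U i w = (SOME u. (\<forall>j\<in>I. u j \<in> U j) \<and> w = (\<Sum>j\<in>I. u j)) i"

definition divisors :: "nat \<Rightarrow> nat set" where
  "divisors n = {d. d dvd n}"


section \<open>Complexification\<close>

definition cvec :: "real^'k \<Rightarrow> complex^'k" where
  "cvec v = (\<chi> i. complex_of_real (v $ i))"

definition vRe :: "complex^'k \<Rightarrow> real^'k" where
  "vRe z = (\<chi> i. Re (z $ i))"

definition vIm :: "complex^'k \<Rightarrow> real^'k" where
  "vIm z = (\<chi> i. Im (z $ i))"

definition vcnj :: "complex^'k \<Rightarrow> complex^'k" where
  "vcnj z = (\<chi> i. cnj (z $ i))"

text \<open>The complex-linear extension of a real-linear map into a complex vector space.\<close>

definition cext :: "(real^'k \<Rightarrow> complex^'m) \<Rightarrow> complex^'k \<Rightarrow> complex^'m" where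
  "cext f z = f (vRe z) + \<i> *s f (vIm z)"

definition cact :: "(real^'k \<Rightarrow> real^'k) \<Rightarrow> complex^'k \<Rightarrow> complex^'k" where
  "cact x = cext (\<lambda>v. cvec (x v))"

text \<open>\<open>L \<otimes> \<complex>\<close>, for \<open>L\<close> a lattice in its real span.\<close>

definition cspan :: "(real^'k) set \<Rightarrow> (complex^'k) set" where
  "cspan L = vec.span (cvec ` L)"


section \<open>Cyclotomic polynomials and the modules\<close>

definition cyclotomic :: "nat \<Rightarrow> int poly" where
  "cyclotomic d = (THE p. map_poly complex_of_int p =
     (\<Prod>j | j < d \<and> coprime j d. [:- cis (2 * pi * real j / real d), 1:]))"

definition Qpoly :: "nat \<Rightarrow> int poly" where
  "Qpoly n = monom 1 n - 1"

definition poly_act :: "int poly \<Rightarrow> ('a::real_vector \<Rightarrow> 'a) \<Rightarrow> 'a \<Rightarrow> 'a" where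
  "poly_act p x v = (\<Sum>i\<le>degree p. of_int (coeff p i) *\<^sub>R (x ^^ i) v)"

text \<open>A module over \<open>\<int>[x]/(\<Phi>\<^sub>d)\<close> is a module over \<open>\<int>[x]\<close> on which \<open>\<Phi>\<^sub>d\<close> acts as zero; \<open>p\<close>
  represents a nonzero element of that ring iff \<open>\<Phi>\<^sub>d\<close> does not divide \<open>p\<close>.\<close>

definition fg_torsion_free_module :: "nat \<Rightarrow> 'a::real_vector set \<Rightarrow> ('a \<Rightarrow> 'a) \<Rightarrow> bool" where
  "fg_torsion_free_module d L x \<longleftrightarrow>
     0 \<in> L \<and> (\<forall>u\<in>L. \<forall>v\<in>L. u - v \<in> L) \<and> x ` L \<subseteq> L \<and>
     (\<forall>v\<in>L. poly_act (cyclotomic d) x v = 0) \<and>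
     (\<exists>F. finite F \<and> F \<subseteq> L \<and> L = {\<Sum>f\<in>F. poly_act (p f) x f | p. True}) \<and>
     (\<forall>p v. v \<in> L \<and> \<not> cyclotomic d dvd p \<and> poly_act p x v = 0 \<longrightarrow> v = 0)"

text \<open>Conventions. A finitely generated torsion free module \<open>\<Lambda>\<^sub>d\<close> is given together with
  \<open>\<Lambda>\<^sub>d \<otimes> \<real>\<close>: it is a subset \<open>L d\<close> of a real vector space that is a lattice in its real span, which
  says exactly that the canonical map from \<open>\<Lambda>\<^sub>d \<otimes> \<real>\<close> onto that span is an isomorphism. The direct
  sum of the \<open>\<Lambda>\<^sub>d \<otimes> \<real>\<close> is written as an internal one, i.e. the finitely many spans are placed in
  independent position in one ambient space \<open>real^'k\<close> of arbitrary dimension; a single linear map \<open>x\<close>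
  then records the componentwise action of \<open>x\<close>. Values of \<open>L\<close> off the divisors of \<open>n\<close>, and of
  \<open>x\<close> off the sum of the spans, are irrelevant.\<close>

definition real_sum :: "nat \<Rightarrow> (nat \<Rightarrow> (real^'k) set) \<Rightarrow> (real^'k) set" where
  "real_sum n L = sum_of (divisors n) (\<lambda>d. span (L d))"

definition lat_sum :: "nat \<Rightarrow> (nat \<Rightarrow> (real^'k) set) \<Rightarrow> (real^'k) set" where
  "lat_sum n L = sum_of (divisors n) L"

definition datum_modules :: "nat \<Rightarrow> (nat \<Rightarrow> (real^'k) set) \<Rightarrow> (real^'k \<Rightarrow> real^'k) \<Rightarrow> bool" where
  "datum_modules n L x \<longleftrightarrow> linear x \<and>
     (\<forall>d\<in>divisors n. fg_torsion_free_module d (L d) x \<and> is_lattice (L d) (span (L d))) \<and>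
     is_direct_sum (divisors n) (\<lambda>d. span (L d)) (real_sum n L) \<and>
     L 1 \<noteq> {0} \<and> even (lattice_rank (L 1)) \<and> (2 dvd n \<longrightarrow> even (lattice_rank (L 2)))"


section \<open>The group \<open>A'\<close> and the conditions on its subgroups\<close>

definition A_prime :: "nat \<Rightarrow> (nat \<Rightarrow> (real^'k) set) \<Rightarrow> (real^'k) set monoid" where
  "A_prime n L = vquot (real_sum n L) (lat_sum n L)"

definition cls :: "nat \<Rightarrow> (nat \<Rightarrow> (real^'k) set) \<Rightarrow> real^'k \<Rightarrow> (real^'k) set" where
  "cls n L = vclass (real_sum n L) (lat_sum n L)"

text \<open>\<open>A\<^sub>d\<close> as a subgroup of \<open>A'\<close>.\<close>

definition A_sub :: "nat \<Rightarrow> (nat \<Rightarrow> (real^'k) set) \<Rightarrow> nat \<Rightarrow> (real^'k) set set" where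
  "A_sub n L d = cls n L ` span (L d)"

definition finite_subgroup ::
    "nat \<Rightarrow> (nat \<Rightarrow> (real^'k) set) \<Rightarrow> (real^'k) set set \<Rightarrow> bool" where
  "finite_subgroup n L S \<longleftrightarrow> finite S \<and> subgroup S (A_prime n L)"

definition cond_A ::
    "nat \<Rightarrow> (nat \<Rightarrow> (real^'k) set) \<Rightarrow> (real^'k \<Rightarrow> real^'k) \<Rightarrow> (real^'k) set set \<Rightarrow> bool" where
  "cond_A n L x S \<longleftrightarrow> (\<forall>w\<in>real_sum n L. cls n L w \<in> S \<longrightarrow> cls n L (x w) \<in> S)"

definition cond_B :: "nat \<Rightarrow> (nat \<Rightarrow> (real^'k) set) \<Rightarrow> (real^'k) set set \<Rightarrow> bool" where
  "cond_B n L S \<longleftrightarrow> (\<forall>d\<in>divisors n. S \<inter> A_sub n L d = {\<one>\<^bsub>A_prime n L\<^esub>})"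

definition projection_A1 ::
    "nat \<Rightarrow> (nat \<Rightarrow> (real^'k) set) \<Rightarrow> (real^'k) set set \<Rightarrow> (real^'k) set set" where
  "projection_A1 n L S =
     {cls n L (proj_comp (divisors n) (\<lambda>d. span (L d)) 1 w) | w. w \<in> real_sum n L \<and> cls n L w \<in> S}"

definition cond_C ::
    "nat \<Rightarrow> (nat \<Rightarrow> (real^'k) set) \<Rightarrow> (real^'k) set set \<Rightarrow> (real^'k) set \<Rightarrow> bool" where
  "cond_C n L S \<beta> \<longleftrightarrow>
     projection_A1 n L S \<inter> generate (A_prime n L) {\<beta>} = {\<one>\<^bsub>A_prime n L\<^esub>}"

text \<open>\<open>\<Phi>\<^sub>d/Q\<^sub>n \<Lambda>\<^sub>d\<close> and the direct sum of the groups \<open>(\<Phi>\<^sub>d/Q\<^sub>n \<Lambda>\<^sub>d)/\<Lambda>\<^sub>d\<close> inside \<open>A'\<close>.\<close>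

definition Phi_over_Q ::
    "nat \<Rightarrow> (nat \<Rightarrow> (real^'k) set) \<Rightarrow> (real^'k \<Rightarrow> real^'k) \<Rightarrow> nat \<Rightarrow> (real^'k) set" where
  "Phi_over_Q n L x d = {v \<in> span (L d). poly_act (Qpoly n div cyclotomic d) x v \<in> L d}"

definition Phi_over_Q_sum ::
    "nat \<Rightarrow> (nat \<Rightarrow> (real^'k) set) \<Rightarrow> (real^'k \<Rightarrow> real^'k) \<Rightarrow> (real^'k) set set" where
  "Phi_over_Q_sum n L x = cls n L ` sum_of (divisors n) (Phi_over_Q n L x)"


section \<open>The complete data\<close>

definition hodge_decomposition ::
    "(real^'k) set \<Rightarrow> (real^'k \<Rightarrow> real^'k) \<Rightarrow> (complex^'k) set \<Rightarrow> bool" where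
  "hodge_decomposition L x H \<longleftrightarrow> vec.subspace H \<and> cact x ` H \<subseteq> H \<and>
     is_direct_sum (UNIV :: bool set) (\<lambda>c. if c then vcnj ` H else H) (cspan L)"

text \<open>The eigenspaces \<open>V\<^sub>j\<close>; for \<open>d = 1\<close> the only admissible \<open>j\<close> is \<open>0\<close>.\<close>

definition eigenspace ::
    "(real^'k \<Rightarrow> real^'k) \<Rightarrow> (complex^'k) set \<Rightarrow> nat \<Rightarrow> nat \<Rightarrow> (complex^'k) set" where
  "eigenspace x H d j = {z \<in> H. cact x z = cis (2 * pi * real j / real d) *s z}"

record ('k::finite) bdf_datum =
  d_lat :: "nat \<Rightarrow> (real^'k) set"
  d_x :: "real^'k \<Rightarrow> real^'k"
  d_sub :: "(real^'k) set set"
  d_beta :: "(real^'k) set"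
  d_hodge :: "nat \<Rightarrow> (complex^'k) set"

text \<open>All requirements on the data except the conditions (A), (B), (C).\<close>

definition valid_datum :: "nat \<Rightarrow> ('k::finite) bdf_datum \<Rightarrow> bool" where
  "valid_datum n D \<longleftrightarrow>
     datum_modules n (d_lat D) (d_x D) \<and>
     finite_subgroup n (d_lat D) (d_sub D) \<and>
     d_beta D \<in> A_sub n (d_lat D) 1 \<and>
     card (generate (A_prime n (d_lat D)) {d_beta D}) = n \<and>
     (\<forall>d\<in>divisors n. hodge_decomposition (d_lat D d) (d_x D) (d_hodge D d))"


section \<open>Quotients of complex tori by cyclic groups\<close>

definition complex_torus :: "(complex^'m) set \<Rightarrow> (complex^'m) set \<Rightarrow> bool" where
  "complex_torus V \<Lambda> \<longleftrightarrow> vec.subspace V \<and> V \<noteq> {0} \<and> is_lattice \<Lambda> V"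

definition holomorphic_into ::
    "(complex^'m \<Rightarrow> complex^'l) \<Rightarrow> (complex^'m) set \<Rightarrow> (complex^'m) set \<Rightarrow> (complex^'l) set \<Rightarrow> bool"
  where
  "holomorphic_into F U V V' \<longleftrightarrow> F ` (U \<inter> V) \<subseteq> V' \<and>
     (\<forall>w\<in>U \<inter> V. \<exists>D. Vector_Spaces.linear (*s) (*s) D \<and> (F has_derivative D) (at w within V))"

text \<open>Holomorphy of a map \<open>f\<close> between two quotients \<open>P : V \<rightarrow> V/\<Gamma>\<close>, \<open>P' : V' \<rightarrow> V'/\<Gamma>'\<close> of complex vector
  spaces by properly discontinuous free actions: locally, \<open>f\<close> lifts to a holomorphic map. As \<open>P\<close> and
  \<open>P'\<close> are local biholomorphisms, this is the usual notion for the quotient manifolds.\<close>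

definition holomorphic_map ::
    "(complex^'m) set \<Rightarrow> (complex^'m \<Rightarrow> 'p) \<Rightarrow> (complex^'l) set \<Rightarrow> (complex^'l \<Rightarrow> 'q) \<Rightarrow> ('p \<Rightarrow> 'q) \<Rightarrow> bool"
  where
  "holomorphic_map V P V' P' f \<longleftrightarrow>
     (\<forall>v\<in>V. \<exists>e>0. \<exists>F. holomorphic_into F (ball v e) V V' \<and> (\<forall>w\<in>ball v e \<inter> V. P' (F w) = f (P w)))"

record ('m::finite) torus_quotient =
  t_space :: "(complex^'m) set"
  t_lat :: "(complex^'m) set"
  t_act :: "int \<Rightarrow> (complex^'m) set \<Rightarrow> (complex^'m) set"

abbreviation t_torus :: "('m::finite) torus_quotient \<Rightarrow> (complex^'m) set monoid" where
  "t_torus X \<equiv> vquot (t_space X) (t_lat X)"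

abbreviation t_class :: "('m::finite) torus_quotient \<Rightarrow> complex^'m \<Rightarrow> (complex^'m) set" where
  "t_class X \<equiv> vclass (t_space X) (t_lat X)"

text \<open>\<open>t_act\<close> is an action of \<open>\<int>/n\<close> on \<open>A\<close> by biholomorphic maps, and it is free.\<close>

definition free_torus_quotient :: "nat \<Rightarrow> ('m::finite) torus_quotient \<Rightarrow> bool" where
  "free_torus_quotient n X \<longleftrightarrow>
     complex_torus (t_space X) (t_lat X) \<and>
     group_action (integer_mod_group n) (carrier (t_torus X)) (t_act X) \<and>
     (\<forall>g\<in>carrier (integer_mod_group n).
        holomorphic_map (t_space X) (t_class X) (t_space X) (t_class X) (t_act X g)) \<and>
     (\<forall>a\<in>carrier (t_torus X).
        stabilizer (integer_mod_group n) (t_act X) a = {\<one>\<^bsub>integer_mod_group n\<^esub>})"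

definition contains_no_translations :: "nat \<Rightarrow> ('m::finite) torus_quotient \<Rightarrow> bool" where
  "contains_no_translations n X \<longleftrightarrow>
     (\<forall>g\<in>carrier (integer_mod_group n). g \<noteq> \<one>\<^bsub>integer_mod_group n\<^esub> \<longrightarrow>
        \<not> (\<exists>t\<in>carrier (t_torus X). \<forall>a\<in>carrier (t_torus X). t_act X g a = a \<otimes>\<^bsub>t_torus X\<^esub> t))"

definition bagnera_de_franchis :: "nat \<Rightarrow> ('m::finite) torus_quotient \<Rightarrow> bool" where
  "bagnera_de_franchis n X \<longleftrightarrow> free_torus_quotient n X \<and> contains_no_translations n X"

definition t_points :: "nat \<Rightarrow> ('m::finite) torus_quotient \<Rightarrow> (complex^'m) set set set" where
  "t_points n X = orbits (integer_mod_group n) (carrier (t_torus X)) (t_act X)"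

definition t_proj :: "nat \<Rightarrow> ('m::finite) torus_quotient \<Rightarrow> complex^'m \<Rightarrow> (complex^'m) set set" where
  "t_proj n X v = orbit (integer_mod_group n) (t_act X) (t_class X v)"

definition biholomorphic ::
    "nat \<Rightarrow> ('m::finite) torus_quotient \<Rightarrow> ('l::finite) torus_quotient \<Rightarrow> bool" where
  "biholomorphic n X Y \<longleftrightarrow> (\<exists>f. bij_betw f (t_points n X) (t_points n Y) \<and>
     holomorphic_map (t_space X) (t_proj n X) (t_space Y) (t_proj n Y) f \<and>
     holomorphic_map (t_space Y) (t_proj n Y) (t_space X) (t_proj n X) (inv_into (t_points n X) f))"


section \<open>From data to manifold\<close>

text \<open>For real \<open>w\<close> the component of \<open>cvec w\<close> in \<open>V\<close> along the conjugate of \<open>V\<close> is the unique \<open>z \<in> V\<close>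
  with \<open>cvec w = z + vcnj z\<close>; this identifies \<open>\<Lambda> \<otimes> \<real>\<close> with \<open>V\<close>.\<close>

definition m_space :: "nat \<Rightarrow> ('k::finite) bdf_datum \<Rightarrow> (complex^'k) set" where
  "m_space n D = sum_of (divisors n) (d_hodge D)"

definition m_lat :: "nat \<Rightarrow> ('k::finite) bdf_datum \<Rightarrow> (complex^'k) set" where
  "m_lat n D = {z \<in> m_space n D. \<exists>w\<in>real_sum n (d_lat D).
      cls n (d_lat D) w \<in> d_sub D \<and> cvec w = z + vcnj z}"

definition lifts_beta :: "nat \<Rightarrow> ('k::finite) bdf_datum \<Rightarrow> complex^'k \<Rightarrow> bool" where
  "lifts_beta n D b \<longleftrightarrow> b \<in> d_hodge D 1 \<and>
     (\<exists>w\<in>span (d_lat D 1). cls n (d_lat D) w = d_beta D \<and> cvec w = b + vcnj b)"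

text \<open>An element of \<open>A\<close> is a coset of the lattice, and \<open>\<gamma>(z) = \<alpha>(z) + b\<close> maps cosets onto cosets.\<close>

definition manifold_of ::
    "nat \<Rightarrow> ('k::finite) bdf_datum \<Rightarrow> complex^'k \<Rightarrow> 'k torus_quotient" where
  "manifold_of n D b =
     \<lparr>t_space = m_space n D,
      t_lat = m_lat n D,
      t_act = (\<lambda>g. restrict (\<lambda>a. ((\<lambda>z. cact (d_x D) z + b) ^^ nat g) ` a)
                 (carrier (vquot (m_space n D) (m_lat n D))))\<rparr>"


section \<open>From manifold to data\<close>

text \<open>\<open>datum_of n X D\<close>: for some choice of the origin \<open>q\<close>, the generator of \<open>G\<close> is
  \<open>\<gamma>(v) = \<alpha>(v) + b\<close> with \<open>\<alpha> b = b\<close>, and \<open>D\<close> is the datum read off from \<open>\<Lambda>\<close>, \<open>\<alpha>\<close> and \<open>b\<close>. As data live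
  in a space \<open>real^'k\<close> of their own, this is up to a real-linear isomorphism \<open>\<tau>\<close> from the sum
  of the \<open>\<Lambda>\<^sub>d \<otimes> \<real>\<close> to \<open>V = \<Lambda> \<otimes> \<real>\<close>; in particular isomorphic data are data of the same manifolds.
  The complex structure of \<open>V\<close> is recorded by the kernel of the natural map \<open>\<Lambda> \<otimes> \<complex> \<rightarrow> V\<close>,
  namely the conjugate of the copy of \<open>V\<close> in \<open>\<Lambda> \<otimes> \<complex>\<close>. The residue \<open>1 mod n\<close> is \<open>0\<close> for \<open>n = 1\<close>.\<close>

definition datum_of :: "nat \<Rightarrow> ('m::finite) torus_quotient \<Rightarrow> ('k::finite) bdf_datum \<Rightarrow> bool" where
  "datum_of n X D \<longleftrightarrow> (\<exists>\<alpha> b q \<tau>.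
     Vector_Spaces.linear (*s) (*s) \<alpha> \<and> \<alpha> ` t_space X \<subseteq> t_space X \<and>
     b \<in> t_space X \<and> \<alpha> b = b \<and> q \<in> t_space X \<and>
     (\<forall>v\<in>t_space X. t_act X (1 mod int n) (t_class X (q + v)) = t_class X (q + (\<alpha> v + b))) \<and>
     linear \<tau> \<and> bij_betw \<tau> (real_sum n (d_lat D)) (t_space X) \<and>
     linear (d_x D) \<and>
     (\<forall>w\<in>real_sum n (d_lat D). d_x D w \<in> real_sum n (d_lat D) \<and> \<tau> (d_x D w) = \<alpha> (\<tau> w)) \<and>
     (\<forall>d\<in>divisors n.
        d_lat D d \<subseteq> real_sum n (d_lat D) \<and>
        \<tau> ` d_lat D d = {v \<in> t_lat X. poly_act (cyclotomic d) \<alpha> v = 0}) \<and>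
     d_sub D = {cls n (d_lat D) w | w. w \<in> real_sum n (d_lat D) \<and> \<tau> w \<in> t_lat X} \<and>
     (\<exists>w\<in>real_sum n (d_lat D). \<tau> w = b \<and> d_beta D = cls n (d_lat D) w) \<and>
     (\<forall>d\<in>divisors n. d_hodge D d = {z \<in> cspan (d_lat D d). cext \<tau> (vcnj z) = 0}))"

text \<open>A Bagnera-De Franchis manifold has property (C) under the following restriction, which is void
  for squarefree \<open>n\<close>, but not in general. Let \<open>n = 4\<close>, let \<open>E\<^sub>1\<close>, \<open>E\<^sub>2\<close> be elliptic curves with lattice
  vectors \<open>e\<close>, \<open>f\<close> that are not divisible by 2, let \<open>E\<^sub>3 = \<complex>/\<int>[\<i>]\<close>, and let
  \<open>\<gamma>(z\<^sub>1, z\<^sub>2, z\<^sub>3) = (z\<^sub>1 + e/4, - z\<^sub>2, \<i> z\<^sub>3)\<close> act on \<open>A = (E\<^sub>1 \<times> E\<^sub>2)/\<langle>(e/2, f/2)\<rangle> \<times> E\<^sub>3\<close>. No power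
  \<open>\<gamma>\<close>, \<open>\<gamma>\<^sup>2\<close>, \<open>\<gamma>\<^sup>3\<close> has a fixed point or is a translation, but the projection of \<open>\<Lambda>\<^sup>0\<close> to \<open>A\<^sub>1\<close> is
  generated by the class of \<open>e/2\<close>, that is by \<open>2 \<beta>\<^sub>1\<close>.\<close>

definition no_critical_prime_powers :: "nat \<Rightarrow> (nat \<Rightarrow> (real^'k) set) \<Rightarrow> bool" where
  "no_critical_prime_powers n L \<longleftrightarrow>
     (\<forall>p j. prime p \<and> 0 < j \<and> p ^ Suc j dvd n \<longrightarrow> L (p ^ j) = {0})"

end

theory Submission
  imports Defs "HOL-Complex_Analysis.Complex_Analysis"
    "HOL-Computational_Algebra.Computational_Algebra" "HOL-Number_Theory.Cong"
begin

text \<open>A generator of the group lifts to an affine map \<open>v \<mapsto> \<alpha> v + c\<close> of \<open>V\<close>: the derivatives of its local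
  lifts are bounded, because finitely many lifts suffice up to translations, so they are constant by
  Liouville's theorem. As \<open>\<Lambda>\<close> contains no line, \<open>\<alpha>\<^sup>n = 1\<close>, and averaging over the powers of \<open>\<alpha>\<close> moves \<open>c\<close> into
  the 1-eigenspace. Differentiating \<open>Q\<^sub>n = \<Prod>\<^sub>d \<Phi>\<^sub>d\<close> gives \<open>n x\<^sup>n = \<Sum>\<^sub>d x \<Phi>\<^sub>d' Q\<^sub>n / \<Phi>\<^sub>d\<close>, and the summands act as
  \<open>n\<close> times the projections to the parts \<open>\<Lambda>\<^sub>d \<otimes> \<rat>\<close>; this gives the decomposition of the lattice, bounds the index
  of \<open>\<Oplus>\<^sub>d \<Lambda>\<^sub>d\<close>, and proves (8). Torsion freeness over \<open>R\<^sub>d\<close> is the irreducibility of \<open>\<Phi>\<^sub>d\<close>. The kernel of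
  \<open>\<Lambda> \<otimes> \<complex> \<rightarrow> V\<close> determines the complex structure, so two manifolds with the same data have complex linearly
  isomorphic tori with corresponding actions.\<close>

section \<open>Cyclotomic polynomials\<close>

text \<open>Both directions meet in \<open>torus_datum\<close>, which describes a torus with a
  generator \<gamma>, a datum, and a real isomorphism \<tau> between them. It is established for a
  manifold with one of its data and for the manifold built from a datum. So the uniqueness of the
  manifold and its recovery from its data become one statement about two such isomorphisms. The
  delicate point is the exchange between freeness and (C). From (C) to freeness a projection
  suffices: a fixed point of \<gamma>^k puts k times \<open>d_beta\<close> into the projection of
  \<open>d_sub\<close>. Conversely, a violation of (C) yields only k b + \<mu> in \<Lambda> with
  \<mu> without component in V(1), and a fixed point is found by solving \<alpha>^k v - v = \<mu>.
  In the part of index d this is possible if d does not divide k; where d divides k, the component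
  of \<mu> has to vanish. For k = n / p a partial geometric sum in \<alpha> kills these components,
  except for d a power of p. The conditions do not control translations either: the order of
  \<alpha> is the least common multiple of the d with a nonzero part, and it enters as a condition
  of its own.\<close>

abbreviation cpoly :: "int poly \<Rightarrow> complex poly" where
  "cpoly \<equiv> map_poly of_int"

lemma cpoly_mult: "cpoly (p * q) = cpoly p * cpoly q"
  by (rule poly_eqI) (simp add: coeff_map_poly coeff_mult)

lemma cpoly_add: "cpoly (p + q) = cpoly p + cpoly q"
  by (rule poly_eqI) (simp add: coeff_map_poly)

lemma cpoly_diff: "cpoly (p - q) = cpoly p - cpoly q"
  by (rule poly_eqI) (simp add: coeff_map_poly)

lemma cpoly_prod: "cpoly (prod f A) = (\<Prod>a\<in>A. cpoly (f a))"
  by (induction A rule: infinite_finite_induct) (simp_all add: cpoly_mult)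

lemma degree_cpoly: "degree (cpoly p) = degree p"
  by (rule degree_map_poly) simp

lemma cpoly_inj: "cpoly p = cpoly q \<Longrightarrow> p = q"
  by (metis (mono_tags, lifting) coeff_map_poly of_int_0 of_int_eq_iff poly_eqI)

text \<open>Over a domain pseudo-division is available; its scaling factor is a power of the leading
  coefficient, here 1.\<close>

lemma monic_division:
  fixes f g :: "'a::idom poly"
  assumes "lead_coeff g = 1"
  obtains q r where "f = g * q + r" "r = 0 \<or> degree r < degree g"
proof -
  obtain q r where qr: "pseudo_divmod f g = (q, r)"
    by fastforce
  have "g \<noteq> 0"
    using assms by auto
  from pseudo_divmod[OF this qr] assms that[of q r] show ?thesis
    by simp
qed

lemma monic_remainder_unique:
  fixes g :: "'a::idom poly"
  assumes "g * q + r = g * q' + r'" "r = 0 \<or> degree r < degree g" "r' = 0 \<or> degree r' < degree g"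
  shows "r = r'"
proof (rule ccontr)
  assume ne: "r \<noteq> r'"
  have eq: "r - r' = g * (q' - q)"
    using assms(1) by (simp add: algebra_simps)
  with ne have "g \<noteq> 0" "q' - q \<noteq> 0"
    by auto
  then have "degree g \<le> degree (r - r')"
    by (simp add: eq degree_mult_eq)
  moreover have "degree (r - r') < degree g"
    using assms(2,3) ne by (auto intro: degree_diff_less)
  ultimately show False
    by simp
qed

text \<open>By uniqueness of remainders, division by \<open>g\<close> commutes with the embedding of
  the integers into the complex numbers, so the complex cofactor is the image of the integral
  quotient.\<close>

lemma monic_dvd_cpoly:
  assumes "lead_coeff g = 1" "cpoly f = cpoly g * h"
  shows "\<exists>q. h = cpoly q \<and> f = g * q"
proof -
  obtain q r where f: "f = g * q + r" and r: "r = 0 \<or> degree r < degree g"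
    using monic_division[OF assms(1)] by metis
  have "cpoly g * q' + r' = cpoly g * q'' + r'' \<Longrightarrow> r' = r''"
    if "r' = 0 \<or> degree r' < degree g" "r'' = 0 \<or> degree r'' < degree g" for q' q'' r' r''
    using monic_remainder_unique[of "cpoly g"] that by (simp add: degree_cpoly)
  from this[of "cpoly r" 0 "cpoly q" h] have "cpoly r = 0"
    using assms(2) r by (auto simp: f cpoly_add cpoly_mult degree_cpoly)
  then have "r = 0"
    using cpoly_inj[of r 0] by simp
  moreover have "h = cpoly q"
  proof -
    have "cpoly g \<noteq> 0"
      using cpoly_inj[of g 0] assms(1) by auto
    then show ?thesis
      using assms(2) \<open>r = 0\<close> by (simp add: f cpoly_mult)
  qed
  ultimately show ?thesis
    using f by auto
qed

text \<open>Despite the name any d-th root of unity; for \<open>d > 0\<close> it is primitive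
  exactly when \<open>coprime j d\<close>.\<close>

definition prim_root :: "nat \<Rightarrow> nat \<Rightarrow> complex" where
  "prim_root d j = cis (2 * pi * real j / real d)"

text \<open>The complex product that \<open>cyclotomic\<close> refers to by a definite description;
  it stands on its own until its integrality is known.\<close>

definition prim_poly :: "nat \<Rightarrow> complex poly" where
  "prim_poly d = (\<Prod>j | j < d \<and> coprime j d. [:- prim_root d j, 1:])"

lemma finite_coprime_less [simp]: "finite {j. j < d \<and> coprime j (d::nat)}"
  by simp

lemma prim_root_power: "prim_root d j ^ k = prim_root d (j * k)"
proof -
  have "real k * (2 * pi * real j / real d) = 2 * pi * real (j * k) / real d"
    by simp
  then show ?thesis
    by (simp only: prim_root_def Complex.DeMoivre)
qed

lemma prim_root_mod: "d > 0 \<Longrightarrow> prim_root d (j mod d) = prim_root d j"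
proof -
  assume d: "d > 0"
  have "2 * pi * real j / real d = 2 * pi * real (j mod d) / real d + 2 * pi * real (j div d)"
  proof -
    have "real j = real d * real (j div d) + real (j mod d)"
      by (metis mult_div_mod_eq of_nat_add of_nat_mult)
    with d show ?thesis
      by (simp add: field_simps)
  qed
  moreover have "cis (2 * pi * real m) = 1" for m
    by (metis Complex.DeMoivre cis_2pi mult.commute power_one)
  ultimately show ?thesis
    by (simp add: prim_root_def flip: cis_mult)
qed

lemma prim_root_inj: "inj_on (prim_root d) {..<d}"
proof (cases "d = 0")
  case False
  then have "inj_on (\<lambda>k. cis (2 * pi * real k / real d)) {..<d}"
    using bij_betw_imp_inj_on[OF Complex.bij_betw_roots_unity[of d]] by blast
  then show ?thesis
    by (simp add: prim_root_def inj_on_def)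
qed simp

lemma prim_root_power_eq_1: "d > 0 \<Longrightarrow> prim_root d j ^ d = 1"
  using prim_root_mod[of d "j * d"] by (simp add: prim_root_power) (simp add: prim_root_def)

text \<open>Both sides are monic of degree n. If they differed, their difference would have degree
  below n and yet vanish at n distinct roots of unity.\<close>

lemma prod_roots_unity:
  assumes "n > 0"
  shows "(\<Prod>j<n. [:- prim_root n j, 1:]) = monom 1 n - 1"
proof (rule ccontr)
  assume ne: "\<not> ?thesis"
  let ?P = "\<Prod>j<n. [:- prim_root n j, 1:]" and ?Q = "monom 1 n - 1 :: complex poly"
  have dP: "degree ?P = n"
    by (simp add: degree_prod_eq_sum_degree)
  have lP: "coeff ?P n = 1"
    using lead_coeff_prod[of "\<lambda>j. [:- prim_root n j, 1:]" "{..<n}"] by (simp add: dP)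
  have dQ: "degree ?Q = n"
    using assms degree_add_eq_left[of "-1 :: complex poly" "monom 1 n"] by (simp add: degree_monom_eq)
  have "coeff (?P - ?Q) n = 0"
    using assms lP by (simp add: coeff_diff)
  then have deg: "degree (?P - ?Q) < n"
    by (metis (no_types, lifting) ne dP dQ degree_diff_le leading_coeff_0_iff le_neq_implies_less
        order_refl right_minus_eq)
  have "card {z. poly (?P - ?Q) z = 0} \<le> degree (?P - ?Q)"
    using ne by (intro card_poly_roots_bound) simp
  moreover have "finite {z. poly (?P - ?Q) z = 0}"
    using ne by (intro poly_roots_finite) simp
  moreover have "prim_root n ` {..<n} \<subseteq> {z. poly (?P - ?Q) z = 0}"
    using assms by (auto simp: poly_prod poly_monom prim_root_power_eq_1)
  ultimately have "card (prim_root n ` {..<n}) < n"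
    using deg card_mono by (meson le_less_trans)
  then show False
    by (simp add: card_image prim_root_inj)
qed

lemma divisors_finite [simp]: "n > 0 \<Longrightarrow> finite (divisors n)"
  by (simp add: divisors_def finite_divisors_nat)

lemma divisors_pos: "n > 0 \<Longrightarrow> d \<in> divisors n \<Longrightarrow> d > 0"
  by (auto simp: divisors_def intro: Nat.gr0I)

text \<open>Writing k/n in lowest terms as j/d sorts the n-th roots of unity by their exact order d.
  The two witnesses reduce the fraction and expand it again.\<close>

lemma prod_prim_poly:
  assumes "n > 0"
  shows "(\<Prod>d\<in>divisors n. prim_poly d) = monom 1 n - 1"
proof -
  have "(\<Prod>d\<in>divisors n. prim_poly d) =
      (\<Prod>(d, j)\<in>Sigma (divisors n) (\<lambda>d. {j. j < d \<and> coprime j d}). [:- prim_root d j, 1:])"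
    using assms by (simp add: prim_poly_def prod.Sigma)
  also have "\<dots> = (\<Prod>k<n. [:- prim_root n k, 1:])"
  proof (rule prod.reindex_bij_witness[where i = "\<lambda>k. (n div gcd k n, k div gcd k n)"
        and j = "\<lambda>(d, j). j * (n div d)"], goal_cases)
    case (1 a)
    then obtain d j where a: "a = (d, j)" "d dvd n" "j < d" "coprime j d"
      by (auto simp: divisors_def)
    then obtain e where e: "n = d * e"
      by auto
    have "gcd (j * e) (d * e) = gcd j d * e"
      by (simp add: gcd_mult_distrib_nat mult.commute)
    then have "gcd (j * e) (d * e) = e"
      using a(4) by simp
    then show ?case
      using a e assms by (auto simp: divisors_def)
  next
    case (2 a)
    then show ?case
      using assms by (auto simp: divisors_def elim!: dvdE)
  next
    case (3 k)
    then show ?case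
      using assms by (auto simp: div_div_eq_right algebra_simps dvd_div_mult_self)
  next
    case (4 k)
    obtain e where e: "n = e * gcd k n"
      by (metis dvd_div_mult_self gcd_dvd2)
    have "n div gcd k n dvd n"
      by (metis div_dvd_iff_mult dvd_triv_left gcd_dvd2 dvd_div_mult_self dvdI)
    moreover have "k div gcd k n < n div gcd k n"
      using 4 assms by (simp add: div_less_mono)
    moreover have "coprime (k div gcd k n) (n div gcd k n)"
      using assms by (intro div_gcd_coprime) simp
    ultimately show ?case
      by (simp add: divisors_def)
  next
    case (5 a)
    then obtain d j where a: "a = (d, j)" "d dvd n" "j < d" "coprime j d"
      by (auto simp: divisors_def)
    then show ?case
      using assms by (auto simp: prim_root_def field_simps real_of_nat_div)
  qed
  finally show ?thesis
    using assms by (simp add: prod_roots_unity)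
qed

lemma degree_prim_poly: "degree (prim_poly d) = card {j. j < d \<and> coprime j d}"
  by (simp add: prim_poly_def degree_prod_eq_sum_degree)

lemma lead_coeff_prim_poly: "lead_coeff (prim_poly d) = 1"
  by (simp add: prim_poly_def lead_coeff_prod)

text \<open>Strong induction on n: the product over the proper divisors is monic with integer
  coefficients and divides x^n - 1 over the complex numbers with cofactor
  \<open>prim_poly n\<close>, which is therefore integral.\<close>

lemma prim_poly_integral:
  assumes "n > 0"
  shows "\<exists>p. cpoly p = prim_poly n"
  using assms
proof (induction n rule: less_induct)
  case (less n)
  have "\<exists>p. cpoly p = prim_poly d" if "d \<in> divisors n - {n}" for d
  proof -
    have "d dvd n" "d \<noteq> n"
      using that by (auto simp: divisors_def)
    then show ?thesis
      using less.IH[of d] less.prems by (meson dvd_imp_le dvd_pos_nat le_neq_implies_less)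
  qed
  then obtain P where P: "\<And>d. d \<in> divisors n - {n} \<Longrightarrow> cpoly (P d) = prim_poly d"
    by metis
  define B where "B = (\<Prod>d\<in>divisors n - {n}. P d)"
  have cB: "cpoly B = (\<Prod>d\<in>divisors n - {n}. prim_poly d)"
    by (simp add: B_def cpoly_prod P)
  then have "lead_coeff (cpoly B) = 1"
    by (simp add: lead_coeff_prod lead_coeff_prim_poly)
  then have "lead_coeff B = 1"
    by (simp add: degree_cpoly coeff_map_poly)
  moreover have "cpoly (monom 1 n - 1) = cpoly B * prim_poly n"
  proof -
    have "n \<in> divisors n"
      by (simp add: divisors_def)
    then have "prim_poly n * cpoly B = monom 1 n - 1"
      using less.prems by (simp add: cB flip: prod_prim_poly prod.remove)
    then show ?thesis
      by (simp add: cpoly_diff map_poly_monom mult.commute)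
  qed
  ultimately show ?case
    using monic_dvd_cpoly by metis
qed

text \<open>Integrality gives existence and the injectivity of \<open>cpoly\<close> gives uniqueness
  for the definite description in \<open>cyclotomic\<close>.\<close>

lemma cpoly_cyclotomic:
  assumes "d > 0"
  shows "cpoly (cyclotomic d) = prim_poly d"
proof -
  obtain p where "cpoly p = prim_poly d"
    using prim_poly_integral[OF assms] by blast
  then have "cpoly (THE p. cpoly p = prim_poly d) = prim_poly d"
    by (rule theI) (metis cpoly_inj \<open>cpoly p = prim_poly d\<close>)
  then show ?thesis
    by (simp add: cyclotomic_def prim_poly_def prim_root_def)
qed

lemma lead_coeff_cyclotomic:
  assumes "d > 0"
  shows "lead_coeff (cyclotomic d) = 1"
proof -
  have "lead_coeff (cpoly (cyclotomic d)) = 1"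
    using assms by (simp add: cpoly_cyclotomic lead_coeff_prim_poly)
  then show ?thesis
    unfolding degree_cpoly by (simp add: coeff_map_poly)
qed

lemma degree_cyclotomic: "d > 0 \<Longrightarrow> degree (cyclotomic d) = card {j. j < d \<and> coprime j d}"
  using degree_prim_poly[of d] degree_cpoly[of "cyclotomic d"] by (simp add: cpoly_cyclotomic)

lemma degree_cyclotomic_pos:
  assumes "d > 0"
  shows "degree (cyclotomic d) > 0"
proof -
  have "1 \<in> {j. j < d \<and> coprime j d} \<or> 0 \<in> {j. j < d \<and> coprime j d}"
    using assms by (cases "d = 1") auto
  then have "card {j. j < d \<and> coprime j d} > 0"
    by (metis card_gt_0_iff empty_iff finite_coprime_less)
  then show ?thesis
    using assms by (simp add: degree_cyclotomic)
qed

lemma cyclotomic_nonzero: "d > 0 \<Longrightarrow> cyclotomic d \<noteq> 0"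
  by (metis lead_coeff_cyclotomic leading_coeff_0_iff zero_neq_one)

lemma prod_cyclotomic:
  assumes "n > 0"
  shows "(\<Prod>d\<in>divisors n. cyclotomic d) = Qpoly n"
proof (rule cpoly_inj)
  have "cpoly (\<Prod>d\<in>divisors n. cyclotomic d) = (\<Prod>d\<in>divisors n. prim_poly d)"
    using assms by (simp add: cpoly_prod cpoly_cyclotomic divisors_pos)
  then show "cpoly (\<Prod>d\<in>divisors n. cyclotomic d) = cpoly (Qpoly n)"
    using assms by (simp add: prod_prim_poly Qpoly_def cpoly_diff map_poly_monom)
qed

lemma Qpoly_div_cyclotomic:
  assumes "n > 0" "d \<in> divisors n"
  shows "Qpoly n div cyclotomic d = (\<Prod>e\<in>divisors n - {d}. cyclotomic e)"
proof -
  have "Qpoly n = cyclotomic d * (\<Prod>e\<in>divisors n - {d}. cyclotomic e)"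
    using assms by (simp flip: prod_cyclotomic prod.remove)
  then show ?thesis
    using assms by (simp add: cyclotomic_nonzero divisors_pos)
qed

lemma cyclotomic_1: "cyclotomic 1 = [:-1, 1:]"
proof -
  have "{j. j < 1 \<and> coprime j (1::nat)} = {0}"
    by auto
  then have "cpoly (cyclotomic 1) = cpoly [:-1, 1:]"
    by (subst cpoly_cyclotomic) (simp_all add: prim_poly_def prim_root_def map_poly_pCons)
  then show ?thesis
    by (rule cpoly_inj)
qed

text \<open>Obtained from \<open>Qpoly n = (\<Prod>d\<in>divisors n. cyclotomic d)\<close> by logarithmic differentiation; it
  replaces the partial fraction decomposition of \<open>1 / Qpoly n\<close> and bounds its denominator by \<open>n\<close>.\<close>

definition proj_poly :: "nat \<Rightarrow> nat \<Rightarrow> int poly" where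
  "proj_poly n d = monom 1 1 * pderiv (cyclotomic d) * (Qpoly n div cyclotomic d)"

text \<open>The derivative of Q_n is n x^(n-1); the factor x in \<open>proj_poly\<close> raises it
  to n x^n, which acts as multiplication by n wherever x^n acts as the identity.\<close>

lemma sum_proj_poly:
  assumes "n > 0"
  shows "(\<Sum>d\<in>divisors n. proj_poly n d) = monom (int n) n"
proof -
  have "pderiv (Qpoly n) = (\<Sum>d\<in>divisors n. pderiv (cyclotomic d) * (Qpoly n div cyclotomic d))"
    using assms by (subst prod_cyclotomic[symmetric])
      (auto simp: pderiv_prod Qpoly_div_cyclotomic mult.commute intro!: sum.cong)
  moreover have "pderiv (Qpoly n) = monom (int n) (n - 1)"
    by (simp add: Qpoly_def pderiv_diff pderiv_monom)
  ultimately have "(\<Sum>d\<in>divisors n. proj_poly n d) = monom 1 1 * monom (int n) (n - 1)"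
    by (simp add: proj_poly_def mult.assoc flip: sum_distrib_left)
  then show ?thesis
    using assms by (simp add: mult_monom)
qed

subsection \<open>Irreducibility\<close>

text \<open>General in the ring, since it is applied to integers for Fermat's little theorem and to
  integer polynomials for the Frobenius congruence.\<close>

lemma freshman_poly:
  fixes a b :: "'a::comm_ring_1"
  assumes "prime p"
  shows "of_nat p dvd (a + b) ^ p - a ^ p - b ^ p"
proof -
  have p: "p > 0"
    using assms prime_gt_0_nat by blast
  have "(a + b) ^ p = (\<Sum>k\<le>p. of_nat (p choose k) * a ^ k * b ^ (p - k))"
    by (rule binomial_ring)
  also have "{..p} = insert 0 (insert p {0<..<p})"
    using p by auto
  finally have "(a + b) ^ p - a ^ p - b ^ p = (\<Sum>k\<in>{0<..<p}. of_nat (p choose k) * a ^ k * b ^ (p - k))"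
    using p by simp
  moreover have "of_nat p dvd (of_nat (p choose k) * a ^ k * b ^ (p - k))" if "k \<in> {0<..<p}" for k
  proof -
    have "p dvd p choose k"
      using that assms by (intro dvd_choose_prime) auto
    then show ?thesis
      by (metis dvd_mult2 dvdE dvd_triv_left of_nat_mult)
  qed
  ultimately show ?thesis
    by (simp only:) (rule dvd_sum, blast)
qed

lemma fermat_int:
  fixes a :: int
  assumes "prime p"
  shows "int p dvd a ^ p - a"
proof -
  have p: "p > 0"
    using assms prime_gt_0_nat by blast
  have nat: "int p dvd int m ^ p - int m" for m
  proof (induction m)
    case (Suc m)
    have "int p dvd ((int m + 1) ^ p - int m ^ p - 1 ^ p) + (int m ^ p - int m)"
      using freshman_poly[OF assms, of "int m" 1] Suc by (intro dvd_add) simp_all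
    then show ?case
      by (simp add: algebra_simps)
  qed (use p in \<open>simp add: zero_power\<close>)
  define m where "m = nat (a mod int p)"
  have m: "int m = a mod int p"
    using p by (simp add: m_def)
  have "int m ^ p mod int p = a ^ p mod int p"
    by (simp add: m power_mod)
  moreover have "int m ^ p mod int p = int m mod int p"
    using nat[of m] by (simp only: mod_eq_dvd_iff)
  ultimately have "a ^ p mod int p = a mod int p"
    by (simp add: m)
  then show ?thesis
    by (simp only: mod_eq_dvd_iff)
qed

text \<open>Modulo p the p-th power is additive, and it fixes the integer coefficients by Fermat's
  little theorem.\<close>

lemma frobenius_int_poly:
  fixes f :: "int poly"
  assumes "prime p"
  shows "of_nat p dvd pcompose f (monom 1 p) - f ^ p"
proof (induction f)
  case 0
  then show ?case
    using assms prime_gt_0_nat by (simp add: zero_power)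
next
  case (pCons a f)
  let ?X = "monom 1 1 :: int poly"
  have eq: "pCons a f = [:a:] + ?X * f"
    by (simp add: monom_altdef)
  have "(of_nat p :: int poly) dvd pcompose (pCons a f) (monom 1 p) - ([:a:] ^ p + (?X * f) ^ p)"
  proof -
    have *: "pcompose (pCons a f) (monom 1 p) - ([:a:] ^ p + (?X * f) ^ p) =
        - [:a ^ p - a:] + monom 1 p * (pcompose f (monom 1 p) - f ^ p)"
      by (simp add: pcompose_pCons power_mult_distrib monom_power algebra_simps poly_const_pow
          flip: diff_pCons)
    have "(of_nat p :: int poly) dvd [:a ^ p - a:]"
      using fermat_int[OF assms, of a] by (simp add: of_nat_poly)
    with pCons show ?thesis
      unfolding * by (intro dvd_add dvd_mult) (simp_all only: dvd_minus_iff)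
  qed
  moreover have "(of_nat p :: int poly) dvd (pCons a f) ^ p - [:a:] ^ p - (?X * f) ^ p"
    unfolding eq by (rule freshman_poly[OF assms])
  ultimately have "(of_nat p :: int poly) dvd (pcompose (pCons a f) (monom 1 p) - ([:a:] ^ p + (?X * f) ^ p))
     - ((pCons a f) ^ p - [:a:] ^ p - (?X * f) ^ p)"
    by (rule dvd_diff)
  then show ?case
    by (simp add: algebra_simps)
qed

text \<open>Applied to powers of x, this makes the residue of f(x^k) modulo f depend only on k
  modulo n when f divides Q_n.\<close>

lemma pcompose_diff_dvd:
  fixes f a b :: "'a::comm_ring_1 poly"
  shows "a - b dvd pcompose f a - pcompose f b"
proof (induction f)
  case (pCons c f)
  have "pcompose (pCons c f) a - pcompose (pCons c f) b
      = (a - b) * pcompose f a + b * (pcompose f a - pcompose f b)"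
    by (simp add: pcompose_pCons algebra_simps)
  then show ?case
    using pCons by (simp add: dvd_add)
qed simp

text \<open>Landau's argument: \<open>f(x\<^sup>k)\<close> modulo \<open>f\<close> takes only finitely many values, and for a prime \<open>k\<close> all
  coefficients of this remainder are divisible by \<open>k\<close>.\<close>

lemma dvd_pcompose_large_prime:
  fixes f :: "int poly"
  assumes "n > 0" "lead_coeff f = 1" "f dvd Qpoly n"
  obtains A where "\<And>p. prime p \<Longrightarrow> p > A \<Longrightarrow> f dvd pcompose f (monom 1 p)"
proof -
  have "\<exists>q r. pcompose f (monom 1 k) = f * q + r \<and> (r = 0 \<or> degree r < degree f)" for k
    using monic_division[OF assms(2)] by metis
  then obtain q R where qR: "\<And>k. pcompose f (monom 1 k) = f * q k + R k"
    and R: "\<And>k. R k = 0 \<or> degree (R k) < degree f"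
    by metis
  have shift: "R (k + n) = R k" for k
  proof -
    have "monom 1 (k + n) - monom 1 k = monom 1 k * Qpoly n"
      by (simp add: Qpoly_def mult_monom algebra_simps)
    then have "f dvd monom 1 (k + n) - monom 1 k"
      using assms(3) by simp
    then have "f dvd pcompose f (monom 1 (k + n)) - pcompose f (monom 1 k)"
      using pcompose_diff_dvd dvd_trans by blast
    then obtain h where "pcompose f (monom 1 (k + n)) = pcompose f (monom 1 k) + f * h"
      by (metis add.commute diff_add_cancel dvdE)
    then have "f * q (k + n) + R (k + n) = f * (q k + h) + R k"
      by (simp add: qR algebra_simps)
    then show ?thesis
      using R monic_remainder_unique by blast
  qed
  have shift': "R (k + m * n) = R k" for k m
    by (induction m) (simp_all add: shift add.assoc[symmetric] add.commute[of n])
  have Rmod: "R k = R (k mod n)" for k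
    using shift'[of "k mod n" "k div n"] by (simp add: add.commute)
  \<comment> \<open>By periodicity only the remainders with k < n occur, so one bound serves all
    coefficients of all remainders.\<close>
  define A where "A = Max ((\<lambda>(k, i). nat \<bar>coeff (R k) i\<bar>) ` ({..<n} \<times> {..degree f}))"
  have A: "\<bar>coeff (R k) i\<bar> \<le> int A" for k i
  proof (cases "i \<le> degree f")
    case True
    have "nat \<bar>coeff (R (k mod n)) i\<bar> \<le> A"
      unfolding A_def using True assms(1) by (intro Max_ge) force+
    then show ?thesis
      using Rmod[of k] by simp
  next
    case False
    then have "coeff (R k) i = 0"
      using R[of k] by (auto intro: coeff_eq_0)
    then show ?thesis
      by simp
  qed
  have "f dvd pcompose f (monom 1 p)" if p: "prime p" "p > A" for p
  proof -
    obtain h where h: "pcompose f (monom 1 p) - f ^ p = of_nat p * h"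
      using frobenius_int_poly[OF p(1)] by (rule dvdE)
    \<comment> \<open>Since f divides f^p, only p h contributes to the remainder of f(x^p). Dividing
      h itself by f shows that this remainder is p times an integral polynomial.\<close>
    obtain q' r' where r': "h = f * q' + r'" "r' = 0 \<or> degree r' < degree f"
      using monic_division[OF assms(2)] by metis
    have "f ^ p = f * f ^ (p - 1)"
      using prime_gt_0_nat[OF p(1)] by (simp add: power_eq_if)
    then have "f * q p + R p = f * (f ^ (p - 1) + of_nat p * q') + of_nat p * r'"
      using h qR[of p] r'(1) by (simp add: algebra_simps)
    moreover have "of_nat p * r' = 0 \<or> degree (of_nat p * r') < degree f"
      using r'(2) degree_smult_le[of "int p" r'] by (auto simp: of_nat_poly)
    ultimately have Rp: "R p = of_nat p * r'"
      using R monic_remainder_unique by blast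
    have "coeff (R p) i = 0" for i
    proof -
      have "int p dvd coeff (R p) i"
        by (simp add: Rp of_nat_poly)
      moreover have "\<bar>coeff (R p) i\<bar> < int p"
        using A[of p i] p(2) by linarith
      ultimately show ?thesis
        using dvd_imp_le_int by force
    qed
    then have "R p = 0"
      by (simp add: poly_eq_iff)
    then show ?thesis
      using qR[of p] by simp
  qed
  then show ?thesis
    using that by blast
qed

text \<open>The exponents with this property are closed under multiplication, and the property
  depends only on the residue modulo n. So k may be replaced by a number of its residue class all of
  whose prime factors exceed the bound A.\<close>

lemma dvd_pcompose_coprime:
  fixes f :: "int poly"
  assumes n: "n > 0" and f: "lead_coeff f = 1" "f dvd Qpoly n" and k: "coprime k n"
  shows "f dvd pcompose f (monom 1 k)"
proof -
  obtain A where A: "\<And>p. prime p \<Longrightarrow> p > A \<Longrightarrow> f dvd pcompose f (monom 1 p)"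
    using dvd_pcompose_large_prime[OF n f] by blast
  have mult: "f dvd pcompose f (monom 1 (a * b))"
    if a: "f dvd pcompose f (monom 1 a)" and b: "f dvd pcompose f (monom 1 b)" for a b
  proof -
    obtain h where "pcompose f (monom 1 a) = f * h"
      using a by (rule dvdE)
    then have eq: "pcompose (pcompose f (monom 1 a)) (monom 1 b) = pcompose f (monom 1 b) * pcompose h (monom 1 b)"
      by (simp add: pcompose_mult)
    have "pcompose (monom 1 a) (monom 1 b) = (monom 1 (a * b) :: int poly)"
      by (induction a) (simp_all add: monom_Suc pcompose_pCons mult_monom monom_0)
    then have "pcompose f (monom 1 (a * b)) = pcompose (pcompose f (monom 1 a)) (monom 1 b)"
      by (simp add: pcompose_assoc[symmetric])
    then show ?thesis
      using b eq by simp
  qed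
  \<comment> \<open>A prime q \<le> A that divides k divides neither n, which is prime to k, nor the
    product; any other prime q \<le> A divides the product but not k. In both cases q does not
    divide m.\<close>
  define m where "m = k + n * \<Prod>{p. prime p \<and> p \<le> A \<and> \<not> p dvd k}"
  have fin: "finite {p. prime p \<and> p \<le> A \<and> \<not> p dvd k}"
    by (rule finite_subset[of _ "{..A}"]) auto
  have "\<Prod>{p. prime p \<and> p \<le> A \<and> \<not> p dvd k} > 0"
    by (intro prod_pos) (auto simp: prime_gt_0_nat)
  then have m0: "m > 0"
    using n by (simp add: m_def)
  have large: "q > A" if q: "prime q" "q dvd m" for q
  proof (rule ccontr)
    assume "\<not> q > A"
    then have qA: "q \<le> A"
      by simp
    show False
    proof (cases "q dvd k")
      case True
      then have "q dvd n * \<Prod>{p. prime p \<and> p \<le> A \<and> \<not> p dvd k}"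
        using q(2) by (simp add: m_def dvd_add_right_iff)
      moreover have "\<not> q dvd n"
        using True k q(1) by (meson coprime_common_divisor_nat not_prime_1 coprime_def not_prime_unit)
      ultimately have "q dvd \<Prod>{p. prime p \<and> p \<le> A \<and> \<not> p dvd k}"
        using q(1) by (simp add: prime_dvd_mult_iff)
      then obtain p where "prime p" "\<not> p dvd k" "q dvd p"
        using fin q(1) by (auto simp: prime_dvd_prod_iff)
      then show False
        using True q(1) primes_dvd_imp_eq by blast
    next
      case False
      then have "q dvd n * \<Prod>{p. prime p \<and> p \<le> A \<and> \<not> p dvd k}"
        using q(1) qA fin by (intro dvd_mult dvd_prodI[where f = "\<lambda>x. x"]) auto
      then have "q dvd k"
        using q(2) by (simp add: m_def dvd_add_left_iff)
      then show False
        using False by simp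
    qed
  qed
  have "f dvd pcompose f (monom 1 m)"
    using m0 large
  proof (induction m rule: less_induct)
    case (less m)
    show ?case
    proof (cases "m = 1")
      case True
      then show ?thesis
        by (simp add: monom_altdef)
    next
      case False
      then obtain p where p: "prime p" "p dvd m"
        using prime_factor_nat by blast
      then obtain l where l: "m = p * l"
        by auto
      then have "l < m" "l > 0"
        using less.prems(1) p(1) prime_gt_1_nat[of p] by auto
      then have "f dvd pcompose f (monom 1 l)"
        using less.IH[of l] less.prems(2) l by (metis dvd_mult)
      moreover have "f dvd pcompose f (monom 1 p)"
        using A p less.prems(2) by blast
      ultimately show ?thesis
        using mult l by blast
    qed
  qed
  moreover have "f dvd pcompose f (monom 1 m) - pcompose f (monom 1 k)"
  proof -
    have "Qpoly n dvd Qpoly (n * c)" for c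
    proof -
      have "monom 1 n - 1 dvd (monom 1 n :: int poly) ^ c - 1 ^ c"
        by (metis power_diff_sumr2 dvd_triv_left)
      then show ?thesis
        by (simp add: Qpoly_def monom_power)
    qed
    moreover have "monom 1 (k + c) - monom 1 k = monom 1 k * Qpoly c" for c
      by (simp add: Qpoly_def mult_monom algebra_simps)
    ultimately have "Qpoly n dvd monom 1 m - monom 1 k"
      unfolding m_def by (simp only:) (rule dvd_mult, blast)
    with f(2) have "f dvd monom 1 m - monom 1 k"
      by (rule dvd_trans)
    then show ?thesis
      using pcompose_diff_dvd dvd_trans by blast
  qed
  ultimately have "f dvd pcompose f (monom 1 m) - (pcompose f (monom 1 m) - pcompose f (monom 1 k))"
    by (rule dvd_diff)
  then show ?thesis
    by simp
qed

lemma poly_cpoly_pcompose: "poly (cpoly (pcompose f (monom 1 k))) z = poly (cpoly f) (z ^ k)"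
proof (induction f)
  case (pCons a f)
  then show ?case
    by (simp add: pcompose_pCons cpoly_add cpoly_mult map_poly_monom poly_monom map_poly_pCons)
qed simp

text \<open>Some root z of f is a primitive d-th root of unity. All others are powers of z with
  exponent prime to d, hence again roots of f, as f(x^k) is a multiple of f for such k. So f has as
  many roots as \<open>cyclotomic d\<close>.\<close>

lemma monic_factor_cyclotomic:
  assumes d: "d > 0" and f: "lead_coeff f = 1" "f dvd cyclotomic d" and deg: "degree f > 0"
  shows "degree f = degree (cyclotomic d)"
proof (rule antisym)
  have c0: "cyclotomic d \<noteq> 0"
    using d by (rule cyclotomic_nonzero)
  then show "degree f \<le> degree (cyclotomic d)"
    using f by (simp add: dvd_imp_degree_le)
  have fQ: "f dvd Qpoly d"
  proof -
    have "cyclotomic d dvd Qpoly d"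
      unfolding prod_cyclotomic[OF d, symmetric] using d by (intro dvd_prodI) (simp_all add: divisors_def)
    with f(2) show ?thesis
      by (rule dvd_trans)
  qed
  have "degree (cpoly f) > 0"
    using deg by (simp add: degree_cpoly)
  then obtain z where z: "poly (cpoly f) z = 0"
    using fundamental_theorem_of_algebra_alt[of "cpoly f"] by (metis degree_pCons_0 less_irrefl)
  obtain g where g: "cyclotomic d = f * g"
    using f(2) by (rule dvdE)
  have "poly (prim_poly d) z = 0"
    using z d by (simp add: g cpoly_mult flip: cpoly_cyclotomic)
  then obtain j where j: "j < d" "coprime j d" "z = prim_root d j"
    by (auto simp: prim_poly_def poly_prod)
  have "poly (cpoly f) (prim_root d i) = 0" if i: "i < d" "coprime i d" for i
  proof -
    \<comment> \<open>With j' inverse to j modulo d, the power z^(j' i) is the root of index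
      i.\<close>
    obtain j' where j': "[j * j' = 1] (mod d)"
      using cong_solve_coprime_nat[OF j(2)] by auto
    have "coprime j' d"
      using j' coprime_iff_invertible_nat by (metis mult.commute One_nat_def)
    then have "f dvd pcompose f (monom 1 (j' * i))"
      using i by (intro dvd_pcompose_coprime[OF d f(1) fQ]) simp
    then obtain h where "pcompose f (monom 1 (j' * i)) = f * h"
      by (rule dvdE)
    then have "poly (cpoly f) (z ^ (j' * i)) = 0"
      by (simp add: z cpoly_mult flip: poly_cpoly_pcompose)
    moreover have "z ^ (j' * i) = prim_root d i"
    proof -
      have "[j * j' * i = 1 * i] (mod d)"
        using j' by (rule cong_scalar_right)
      then have "(j * (j' * i)) mod d = i mod d"
        by (simp add: cong_def mult.assoc)
      then show ?thesis
        using d by (metis j(3) prim_root_power prim_root_mod)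
    qed
    ultimately show ?thesis
      by simp
  qed
  then have "prim_root d ` {j. j < d \<and> coprime j d} \<subseteq> {z. poly (cpoly f) z = 0}"
    by auto
  moreover have f0: "cpoly f \<noteq> 0"
    using f(1) deg by (metis degree_0 degree_cpoly less_irrefl)
  ultimately have "card (prim_root d ` {j. j < d \<and> coprime j d}) \<le> degree (cpoly f)"
    using card_mono[OF poly_roots_finite[OF f0]] card_poly_roots_bound[OF f0] by (blast intro: order_trans)
  moreover have "inj_on (prim_root d) {j. j < d \<and> coprime j d}"
    by (rule inj_on_subset[OF prim_root_inj]) auto
  ultimately show "degree (cyclotomic d) \<le> degree f"
    using d by (simp add: card_image degree_cpoly degree_cyclotomic)
qed

lemma irreducible_cyclotomic:
  assumes d: "d > 0"
  shows "irreducible (cyclotomic d)"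
proof (rule irreducibleI)
  show "cyclotomic d \<noteq> 0"
    using d by (rule cyclotomic_nonzero)
  show "\<not> cyclotomic d dvd 1"
  proof
    assume "cyclotomic d dvd 1"
    then have "degree (cyclotomic d) = 0"
      by (auto simp: is_unit_poly_iff)
    then show False
      using degree_cyclotomic_pos[OF d] by simp
  qed
  fix f g assume fg: "cyclotomic d = f * g"
  have unit: "a dvd 1" if ab: "cyclotomic d = a * b" "degree a = 0" for a b
  proof -
    have "lead_coeff a * lead_coeff b = 1"
      using ab(1) lead_coeff_cyclotomic[OF d] by (simp add: lead_coeff_mult)
    then have "lead_coeff a dvd 1"
      by (metis dvd_triv_left)
    then show ?thesis
      using ab(2) by (auto elim!: degree_eq_zeroE simp: is_unit_const_poly_iff)
  qed
  have "degree f = 0 \<or> degree g = 0"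
  proof (rule ccontr)
    assume nz: "\<not> ?thesis"
    have l: "lead_coeff f * lead_coeff g = 1"
      using fg lead_coeff_cyclotomic[OF d] by (simp add: lead_coeff_mult)
    \<comment> \<open>The leading coefficients are both 1 or both -1, so scaling f by its own one
      makes it a monic factor.\<close>
    then have u: "lead_coeff f * lead_coeff f = 1"
      by (auto simp: zmult_eq_1_iff)
    have "f \<noteq> 0"
      using fg cyclotomic_nonzero[OF d] by auto
    then have "lead_coeff (smult (lead_coeff f) f) = 1"
      using u by simp
    moreover have "smult (lead_coeff f) f dvd cyclotomic d"
      using u fg by (metis dvd_triv_left mult_smult_left mult_smult_right smult_smult smult_1_left)
    moreover have f0: "lead_coeff f \<noteq> 0"
      using u by (metis mult_zero_left zero_neq_one)
    moreover have "degree (smult (lead_coeff f) f) = degree f"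
      using f0 by simp
    ultimately have "degree f = degree (cyclotomic d)"
      using monic_factor_cyclotomic[OF d, of "smult (lead_coeff f) f"] nz by simp
    moreover have "degree (cyclotomic d) = degree f + degree g"
      using fg cyclotomic_nonzero[OF d] by (simp add: degree_mult_eq)
    ultimately show False
      using nz by simp
  qed
  then show "f dvd 1 \<or> g dvd 1"
    using unit[of f g] unit[of g f] fg by (auto simp: mult.commute)
qed

section \<open>The action of integer polynomials\<close>

lemma poly_act_altdef:
  assumes "degree p \<le> N"
  shows "poly_act p x v = (\<Sum>i\<le>N. of_int (coeff p i) *\<^sub>R (x ^^ i) v)"
  unfolding poly_act_def using assms
  by (intro sum.mono_neutral_left) (auto simp: coeff_eq_0)

lemma poly_act_0 [simp]: "poly_act 0 x v = 0"
  by (simp add: poly_act_def)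

lemma poly_act_pCons: "poly_act (pCons a p) x v = of_int a *\<^sub>R v + poly_act p x (x v)"
proof -
  have "poly_act (pCons a p) x v
      = (\<Sum>i\<le>Suc (degree p). of_int (coeff (pCons a p) i) *\<^sub>R (x ^^ i) v)"
    by (rule poly_act_altdef) (simp add: degree_pCons_le)
  also have "\<dots> = of_int a *\<^sub>R v + (\<Sum>i\<le>degree p. of_int (coeff p i) *\<^sub>R (x ^^ i) (x v))"
    unfolding sum.atMost_Suc_shift by (simp add: funpow_swap1)
  finally show ?thesis
    by (simp add: poly_act_def)
qed

lemma poly_act_add: "poly_act (p + q) x v = poly_act p x v + poly_act q x v"
proof -
  let ?N = "max (degree p) (degree q)"
  have "degree (p + q) \<le> ?N"
    by (rule degree_add_le_max)
  then show ?thesis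
    by (simp add: poly_act_altdef[of _ ?N] scaleR_add_left sum.distrib)
qed

lemma poly_act_smult: "poly_act (smult c p) x v = of_int c *\<^sub>R poly_act p x v"
  by (simp add: poly_act_altdef[OF degree_smult_le] poly_act_def scaleR_sum_right)

lemma poly_act_minus: "poly_act (- p) x v = - poly_act p x v"
  by (simp add: poly_act_def sum_negf)

lemma poly_act_diff: "poly_act (p - q) x v = poly_act p x v - poly_act q x v"
  using poly_act_add[of p "- q" x v] by (simp add: poly_act_minus)

lemma poly_act_sum: "poly_act (\<Sum>i\<in>I. p i) x v = (\<Sum>i\<in>I. poly_act (p i) x v)"
  by (induction I rule: infinite_finite_induct) (simp_all add: poly_act_add)

lemma poly_act_const: "poly_act [:c:] x v = of_int c *\<^sub>R v"
  by (simp add: poly_act_pCons)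

lemma poly_act_monom: "poly_act (monom c k) x v = of_int c *\<^sub>R (x ^^ k) v"
  by (induction k arbitrary: v) (simp_all add: monom_0 monom_Suc poly_act_pCons funpow_swap1)

lemma poly_act_1 [simp]: "poly_act 1 x v = v"
  using poly_act_const[of 1] by (simp add: one_pCons)

lemma poly_act_Qpoly: "poly_act (Qpoly n) x v = (x ^^ n) v - v"
  by (simp add: Qpoly_def poly_act_diff poly_act_monom)

lemma linear_funpow: "linear (x ^^ k)" if "linear (x :: 'a::real_vector \<Rightarrow> 'a)"
  by (induction k) (simp_all only: funpow.simps linear_id linear_compose[OF _ that])

context
  fixes x :: "'a::real_vector \<Rightarrow> 'a"
  assumes x: "linear x"
begin

lemma linear_poly_act: "linear (poly_act p x)"
  unfolding poly_act_def [abs_def]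
  by (intro linear_compose_sum linear_compose_scale_right ballI linear_funpow x)

lemma poly_act_commute: "poly_act p x (x v) = x (poly_act p x v)"
  by (simp add: poly_act_def linear_sum[OF x] linear_scale[OF x] funpow_swap1)

lemma poly_act_mult: "poly_act (p * q) x v = poly_act p x (poly_act q x v)"
proof (induction p arbitrary: v)
  case (pCons a p)
  have "poly_act (pCons a p * q) x v = of_int a *\<^sub>R poly_act q x v + poly_act (pCons 0 (p * q)) x v"
    by (simp add: mult_pCons_left poly_act_add poly_act_smult)
  also have "\<dots> = of_int a *\<^sub>R poly_act q x v + poly_act p x (x (poly_act q x v))"
    by (simp add: poly_act_pCons pCons poly_act_commute)
  finally show ?case
    by (simp add: poly_act_pCons)
qed simp

lemma poly_act_dvd: "p dvd q \<Longrightarrow> poly_act p x v = 0 \<Longrightarrow> poly_act q x v = 0"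
  by (elim dvdE) (simp add: mult.commute[of p] poly_act_mult linear_0[OF linear_poly_act])

lemma cyclotomic_dvd_Qpoly: "n > 0 \<Longrightarrow> d \<in> divisors n \<Longrightarrow> cyclotomic d dvd Qpoly n"
  by (simp add: dvd_prodI flip: prod_cyclotomic)

lemma cyclotomic_kernel_periodic:
  "n > 0 \<Longrightarrow> d \<in> divisors n \<Longrightarrow> poly_act (cyclotomic d) x v = 0 \<Longrightarrow> (x ^^ n) v = v"
  using poly_act_dvd[OF cyclotomic_dvd_Qpoly, of n d v] by (simp add: poly_act_Qpoly)

lemma sum_proj_poly_act:
  assumes "n > 0" "(x ^^ n) v = v"
  shows "(\<Sum>d\<in>divisors n. poly_act (proj_poly n d) x v) = of_nat n *\<^sub>R v"
  using assms by (simp add: sum_proj_poly poly_act_monom flip: poly_act_sum)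

text \<open>The product of Phi_d and \<open>proj_poly n d\<close> is a multiple of Q_n, which kills
  every vector fixed by x^n.\<close>

lemma cyclotomic_proj_poly_act:
  assumes "n > 0" "d \<in> divisors n" "(x ^^ n) v = v"
  shows "poly_act (cyclotomic d) x (poly_act (proj_poly n d) x v) = 0"
proof -
  have "cyclotomic d * (Qpoly n div cyclotomic d) = Qpoly n"
    using cyclotomic_dvd_Qpoly[OF assms(1,2)] by simp
  then have "cyclotomic d * proj_poly n d = monom 1 1 * pderiv (cyclotomic d) * Qpoly n"
    by (simp add: proj_poly_def mult.left_commute)
  then have "Qpoly n dvd cyclotomic d * proj_poly n d"
    by simp
  then show ?thesis
    using assms(3) by (auto simp flip: poly_act_mult intro: poly_act_dvd simp: poly_act_Qpoly)
qed

lemma quotient_poly_act_other: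
  assumes "n > 0" "d \<in> divisors n" "e \<in> divisors n" "e \<noteq> d" "poly_act (cyclotomic e) x v = 0"
  shows "poly_act (Qpoly n div cyclotomic d) x v = 0"
  using assms by (intro poly_act_dvd[OF _ assms(5)]) (auto simp: Qpoly_div_cyclotomic intro!: dvd_prodI)

lemma proj_poly_act_other:
  assumes "n > 0" "d \<in> divisors n" "e \<in> divisors n" "e \<noteq> d" "poly_act (cyclotomic e) x v = 0"
  shows "poly_act (proj_poly n d) x v = 0"
  using quotient_poly_act_other[OF assms]
  by (simp add: proj_poly_def poly_act_mult linear_0[OF linear_poly_act])

text \<open>Of the summands of n v only the one of index d survives on the kernel of Phi_d. Thus
  \<open>proj_poly n d\<close> is n times the projection to this kernel along the kernels of the
  other indices.\<close>

lemma proj_poly_act_same: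
  assumes "n > 0" "d \<in> divisors n" "poly_act (cyclotomic d) x v = 0"
  shows "poly_act (proj_poly n d) x v = of_nat n *\<^sub>R v"
proof -
  have "(\<Sum>e\<in>divisors n. poly_act (proj_poly n e) x v)
      = (\<Sum>e\<in>divisors n. if e = d then poly_act (proj_poly n d) x v else 0)"
    using assms by (intro sum.cong refl) (auto intro: proj_poly_act_other)
  then show ?thesis
    using assms sum_proj_poly_act[of n v] cyclotomic_kernel_periodic[of n d v] by simp
qed

lemma proj_poly_act_sum:
  assumes "n > 0" "d \<in> divisors n" "\<And>e. e \<in> divisors n \<Longrightarrow> poly_act (cyclotomic e) x (u e) = 0"
  shows "poly_act (proj_poly n d) x (\<Sum>e\<in>divisors n. u e) = of_nat n *\<^sub>R u d"
proof -
  have "poly_act (proj_poly n d) x (\<Sum>e\<in>divisors n. u e)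
      = (\<Sum>e\<in>divisors n. if e = d then of_nat n *\<^sub>R u d else 0)"
    unfolding linear_sum[OF linear_poly_act] using assms
    by (intro sum.cong refl) (auto intro: proj_poly_act_other proj_poly_act_same)
  then show ?thesis
    using assms by simp
qed

lemma cyclotomic_kernels_independent:
  assumes "n > 0" "\<And>e. e \<in> divisors n \<Longrightarrow> poly_act (cyclotomic e) x (u e) = 0"
    and "(\<Sum>e\<in>divisors n. u e) = 0" "d \<in> divisors n"
  shows "u d = 0"
  using proj_poly_act_sum[of n d u] assms by (simp add: linear_0[OF linear_poly_act])

lemma periodic_mult: "(x ^^ k) v = v \<Longrightarrow> (x ^^ (m * k)) v = v"
  by (induction m) (simp_all add: funpow_add)

text \<open>Let g = gcd k d, a proper divisor of d. Bezout makes v a fixed vector of x^g. But Q_g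
  divides Q_d / Phi_d, hence also \<open>proj_poly d d\<close>, which multiplies v by d; so d v =
  0.\<close>

lemma cyclotomic_kernel_fixed_point:
  assumes d: "d > 0" and v: "poly_act (cyclotomic d) x v = 0" "(x ^^ k) v = v" and k: "\<not> d dvd k"
  shows "v = 0"
proof -
  have dd: "d \<in> divisors d"
    by (simp add: divisors_def)
  have vd: "(x ^^ d) v = v"
    using cyclotomic_kernel_periodic[OF d dd v(1)] .
  have "k \<noteq> 0"
    using k by (metis dvd_0_right)
  then obtain a b where ab: "k * a = d * b + gcd k d"
    using bezout_nat by blast
  have "(x ^^ gcd k d) v = (x ^^ gcd k d) ((x ^^ (b * d)) v)"
    using periodic_mult[OF vd] by simp
  also have "\<dots> = (x ^^ (gcd k d + b * d)) v"
    by (simp add: funpow_add)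
  also have "gcd k d + b * d = a * k"
    using ab by (simp add: mult.commute)
  finally have g: "(x ^^ gcd k d) v = v"
    using periodic_mult[OF v(2)] by simp
  have gd: "gcd k d dvd d" "gcd k d \<noteq> d"
    using k by (simp, metis gcd_dvd1)
  have "Qpoly (gcd k d) dvd Qpoly d div cyclotomic d"
  proof -
    have "divisors (gcd k d) \<subseteq> divisors d - {d}"
      using gd d by (auto simp: divisors_def dest: dvd_antisym intro: dvd_trans)
    then have "(\<Prod>e\<in>divisors (gcd k d). cyclotomic e) dvd (\<Prod>e\<in>divisors d - {d}. cyclotomic e)"
      using d by (intro prod_dvd_prod_subset) auto
    then show ?thesis
      using d by (simp add: Qpoly_div_cyclotomic[OF d dd] prod_cyclotomic)
  qed
  then have "Qpoly (gcd k d) dvd proj_poly d d"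
    by (simp add: proj_poly_def)
  then have "poly_act (proj_poly d d) x v = 0"
    by (rule poly_act_dvd) (simp add: poly_act_Qpoly g)
  then show ?thesis
    using proj_poly_act_same[OF d dd v(1)] d by simp
qed

text \<open>Pseudo-division shows that an annihilating polynomial h of least degree divides every
  other one up to a nonzero integer. So c Phi_d = h t for some integer c, and the prime Phi_d
  divides h or t. If it divides h, it divides a constant multiple of p, hence p; if it divides t,
  then h is constant and v = 0.\<close>

lemma cyclotomic_kernel_torsion_free:
  assumes d: "d > 0" and v: "poly_act (cyclotomic d) x v = 0" "poly_act p x v = 0"
    and p: "\<not> cyclotomic d dvd p"
  shows "v = 0"
proof -
  define I where "I = {q. q \<noteq> 0 \<and> poly_act q x v = 0}"
  have c0: "cyclotomic d \<in> I"
    using v d by (simp add: I_def cyclotomic_nonzero)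
  then obtain h where h: "h \<in> I" "\<And>q. q \<in> I \<Longrightarrow> degree h \<le> degree q"
    using ex_has_least_nat[of "\<lambda>q. q \<in> I" "cyclotomic d" degree] by blast
  have h0: "h \<noteq> 0" "poly_act h x v = 0"
    using h(1) by (auto simp: I_def)
  have div: "\<exists>c. c \<noteq> 0 \<and> h dvd smult c q" if q: "poly_act q x v = 0" for q
  proof -
    obtain s r where sr: "pseudo_divmod q h = (s, r)"
      by fastforce
    define c where "c = lead_coeff h ^ (Suc (degree q) - degree h)"
    have eq: "smult c q = h * s + r" and r: "r = 0 \<or> degree r < degree h"
      using pseudo_divmod[OF h0(1) sr] by (simp_all add: c_def)
    have "poly_act (h * s) x v = 0"
      using h0(2) by (rule poly_act_dvd[rotated]) simp
    then have r0: "poly_act r x v = 0"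
      using arg_cong[OF eq, of "\<lambda>q. poly_act q x v"] q by (simp add: poly_act_smult poly_act_add)
    then have "r = 0"
    proof -
      have "r \<in> I \<Longrightarrow> degree h \<le> degree r"
        by (rule h(2))
      then show ?thesis
        using r r0 by (cases "r = 0") (auto simp: I_def)
    qed
    then show ?thesis
      using eq h0(1) by (intro exI[of _ c]) (simp add: c_def)
  qed
  have prime: "prime_elem (cyclotomic d)"
    using irreducible_cyclotomic[OF d] by (simp add: prime_elem_iff_irreducible)
  obtain c t where c: "c \<noteq> 0" "smult c (cyclotomic d) = h * t"
    using div[OF v(1)] unfolding dvd_def by blast
  have "cyclotomic d dvd h * t"
    unfolding c(2)[symmetric] by (simp add: dvd_smult)
  then have "cyclotomic d dvd h \<or> cyclotomic d dvd t"
    using prime by (simp add: prime_elem_dvd_mult_iff)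
  then show ?thesis
  proof
    assume "cyclotomic d dvd h"
    moreover obtain c' where "c' \<noteq> 0" "h dvd smult c' p"
      using div[OF v(2)] by auto
    ultimately have "cyclotomic d dvd [:c':] * p" and c': "c' \<noteq> 0"
      by (auto intro: dvd_trans)
    then have "cyclotomic d dvd [:c':]"
      using prime p by (simp only: prime_elem_dvd_mult_iff) simp
    then have "degree (cyclotomic d) \<le> degree [:c':]"
      using c' by (intro dvd_imp_degree_le) auto
    then show ?thesis
      using degree_cyclotomic_pos[OF d] by simp
  next
    assume "cyclotomic d dvd t"
    then obtain t' where "t = cyclotomic d * t'"
      by (rule dvdE)
    then have "cyclotomic d * [:c:] = cyclotomic d * (h * t')"
      using c(2) by (simp add: algebra_simps)
    then have "[:c:] = h * t'"
      using cyclotomic_nonzero[OF d] by (simp only: mult_cancel_left) simp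
    then have "degree h \<le> degree [:c:]"
      using c(1) by (intro dvd_imp_degree_le) auto
    then obtain a where "h = [:a:]"
      by (metis degree_eq_zeroE degree_pCons_0 le_zero_eq)
    then show ?thesis
      using h0 by (simp add: poly_act_const)
  qed
qed

end

lemma poly_act_intertwine:
  assumes "linear \<tau>" "\<And>w. w \<in> W \<Longrightarrow> x w \<in> W" "\<And>w. w \<in> W \<Longrightarrow> \<tau> (x w) = y (\<tau> w)" "w \<in> W"
  shows "\<tau> (poly_act p x w) = poly_act p y (\<tau> w)"
proof -
  have "(x ^^ i) w \<in> W \<and> \<tau> ((x ^^ i) w) = (y ^^ i) (\<tau> w)" for i
    by (induction i) (use assms in auto)
  then show ?thesis
    by (simp add: poly_act_def linear_sum[OF assms(1)] linear_scale[OF assms(1)])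
qed

section \<open>Lattices\<close>

definition zmodule :: "'a::ab_group_add set \<Rightarrow> bool" where
  "zmodule L \<longleftrightarrow> 0 \<in> L \<and> (\<forall>u\<in>L. \<forall>v\<in>L. u - v \<in> L)"

lemma zmoduleD:
  assumes "zmodule L"
  shows "0 \<in> L" "u \<in> L \<Longrightarrow> v \<in> L \<Longrightarrow> u - v \<in> L" "u \<in> L \<Longrightarrow> - u \<in> L"
    "u \<in> L \<Longrightarrow> v \<in> L \<Longrightarrow> u + v \<in> L"
proof -
  have 0: "0 \<in> L"
    using assms by (simp add: zmodule_def)
  have d: "u - v \<in> L" if "u \<in> L" "v \<in> L" for u v
    using assms that by (simp add: zmodule_def)
  have m: "- u \<in> L" if "u \<in> L" for u
    using d[OF 0 that] by simp
  show "0 \<in> L" "u \<in> L \<Longrightarrow> v \<in> L \<Longrightarrow> u - v \<in> L" "u \<in> L \<Longrightarrow> - u \<in> L"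
    using 0 d m by auto
  show "u + v \<in> L" if "u \<in> L" "v \<in> L"
    using d[OF that(1) m[OF that(2)]] by simp
qed

lemma zmodule_sum: "zmodule L \<Longrightarrow> (\<And>i. i \<in> I \<Longrightarrow> f i \<in> L) \<Longrightarrow> sum f I \<in> L"
  by (induction I rule: infinite_finite_induct) (auto intro: zmoduleD)

lemma zmodule_scale:
  fixes L :: "'a::real_vector set"
  assumes "zmodule L" "u \<in> L"
  shows "of_int k *\<^sub>R u \<in> L"
proof -
  have nat: "of_nat m *\<^sub>R u \<in> L" for m
    by (induction m) (use assms in \<open>auto simp: scaleR_add_left intro: zmoduleD\<close>)
  show ?thesis
  proof (cases "k \<ge> 0")
    case True
    then show ?thesis
      using nat[of "nat k"] by simp
  next
    case False
    then show ?thesis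
      using zmoduleD(3)[OF assms(1) nat[of "nat (- k)"]] by simp
  qed
qed

lemma zmodule_scale_nat:
  fixes L :: "'a::real_vector set"
  shows "zmodule L \<Longrightarrow> u \<in> L \<Longrightarrow> of_nat k *\<^sub>R u \<in> L"
  using zmodule_scale[of L u "int k"] by simp

lemma zmodule_funpow: "x ` L \<subseteq> L \<Longrightarrow> v \<in> L \<Longrightarrow> (x ^^ i) v \<in> L"
  by (induction i) auto

lemma zmodule_poly_act:
  fixes L :: "'a::real_vector set"
  assumes "zmodule L" "x ` L \<subseteq> L" "v \<in> L"
  shows "poly_act p x v \<in> L"
  unfolding poly_act_def
  by (intro zmodule_sum[OF assms(1)] zmodule_scale[OF assms(1)] zmodule_funpow assms)

lemma zmodule_subspace: "subspace W \<Longrightarrow> zmodule W"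
  by (simp add: zmodule_def subspace_0 subspace_diff)

section \<open>Groups spanned over \<int> by finite sets\<close>

lemma int_spanI: "u = (\<Sum>b\<in>B. of_int (c b) *\<^sub>R b) \<Longrightarrow> u \<in> int_span B"
  unfolding int_span_def by (rule CollectI, rule exI[of _ c]) simp

lemma zmodule_int_span: "zmodule (int_span B)"
proof -
  have "0 \<in> int_span B"
    unfolding int_span_def by (rule CollectI) (rule exI[of _ "\<lambda>_. 0"], simp)
  moreover have "u - v \<in> int_span B" if uv: "u \<in> int_span B" "v \<in> int_span B" for u v
  proof -
    obtain c d where "u = (\<Sum>b\<in>B. of_int (c b) *\<^sub>R b)" "v = (\<Sum>b\<in>B. of_int (d b) *\<^sub>R b)"
      using uv unfolding int_span_def by auto
    then have "u - v = (\<Sum>b\<in>B. of_int (c b - d b) *\<^sub>R b)"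
      by (simp add: scaleR_diff_left sum_subtractf)
    then show ?thesis
      by (rule int_spanI)
  qed
  ultimately show ?thesis
    by (simp add: zmodule_def)
qed

lemma int_span_superset: "finite B \<Longrightarrow> B \<subseteq> int_span B"
proof
  fix b assume "finite B" "b \<in> B"
  have "(\<Sum>a\<in>B. of_int (if a = b then 1 else 0) *\<^sub>R a) = (\<Sum>a\<in>B. if a = b then a else 0)"
    by (intro sum.cong) auto
  then have "b = (\<Sum>a\<in>B. of_int (if a = b then 1 else 0) *\<^sub>R a)"
    using \<open>finite B\<close> \<open>b \<in> B\<close> by simp
  then show "b \<in> int_span B"
    by (rule int_spanI)
qed

lemma int_span_subset_span: "int_span B \<subseteq> span B"
  by (auto simp: int_span_def intro!: span_sum span_scale intro: span_base)

lemma int_span_minimal: "zmodule L \<Longrightarrow> B \<subseteq> L \<Longrightarrow> int_span B \<subseteq> L"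
  by (auto simp: int_span_def intro!: zmodule_sum zmodule_scale)

lemma span_int_span: "finite B \<Longrightarrow> span (int_span B) = span B"
  by (meson int_span_subset_span int_span_superset order_antisym span_minimal span_mono subspace_span)

lemma int_span_insert:
  assumes "finite B" "b \<notin> B"
  shows "int_span (insert b B) = {of_int k *\<^sub>R b + v | k v. v \<in> int_span B}"
proof (intro subset_antisym subsetI)
  fix u assume "u \<in> int_span (insert b B)"
  then show "u \<in> {of_int k *\<^sub>R b + v | k v. v \<in> int_span B}"
    using assms by (auto simp: int_span_def)
next
  fix u assume "u \<in> {of_int k *\<^sub>R b + v | k v. v \<in> int_span B}"
  then obtain k c where "u = of_int k *\<^sub>R b + (\<Sum>a\<in>B. of_int (c a) *\<^sub>R a)"
    by (auto simp: int_span_def)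
  also have "\<dots> = (\<Sum>a\<in>insert b B. of_int ((c(b := k)) a) *\<^sub>R a)"
    using assms by (auto intro: sum.cong)
  finally show "u \<in> int_span (insert b B)"
    by (rule int_spanI)
qed

text \<open>Division with remainder by the least positive element. It supplies the pivots of lattice
  bases and the orders of cyclic subgroups.\<close>

lemma zmodule_int_ideal:
  fixes I :: "int set"
  assumes "zmodule I"
  obtains k where "k \<in> I" "\<And>i. i \<in> I \<Longrightarrow> k dvd i"
proof (cases "I = {0}")
  case True
  then show ?thesis
    using that[of 0] by simp
next
  case False
  then obtain a where a: "a \<in> I" "a \<noteq> 0"
    using zmoduleD(1)[OF assms] by auto
  have scale: "c * i \<in> I" if "i \<in> I" for c i
  proof -
    have "int m * i \<in> I" for m
      by (induction m) (use assms that in \<open>auto simp: algebra_simps intro: zmoduleD\<close>)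
    then show ?thesis
      by (metis (no_types) assms int_cases2 minus_mult_left zmoduleD(3))
  qed
  define P where "P = (\<lambda>m. m > 0 \<and> int m \<in> I)"
  have "P (nat \<bar>a\<bar>)"
    using a zmoduleD(3)[OF assms a(1)] by (auto simp: P_def abs_if)
  then have P: "P (LEAST m. P m)" and least: "\<And>m. P m \<Longrightarrow> (LEAST m. P m) \<le> m"
    by (auto intro: LeastI Least_le)
  let ?k = "int (LEAST m. P m)"
  have "?k dvd i" if i: "i \<in> I" for i
  proof (rule ccontr)
    assume "\<not> ?k dvd i"
    then have "i mod ?k > 0"
      using P by (metis P_def dvd_eq_mod_eq_0 less_le of_nat_0_less_iff pos_mod_sign)
    moreover have "i mod ?k \<in> I"
      using zmoduleD(2)[OF assms i scale[of ?k "i div ?k"]] P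
      by (simp add: P_def minus_div_mult_eq_mod)
    ultimately have "P (nat (i mod ?k))"
      by (simp add: P_def)
    then have "(LEAST m. P m) \<le> nat (i mod ?k)"
      by (rule least)
    then have "?k \<le> i mod ?k"
      using \<open>i mod ?k > 0\<close> by linarith
    moreover have "i mod ?k < ?k"
      using P by (simp add: P_def)
    ultimately show False
      by simp
  qed
  then show ?thesis
    using that P by (auto simp: P_def)
qed

text \<open>Echelon form: the coefficients of b in elements of M form an ideal, and a lift
  \<open>?m\<close> of its generator together with a basis of the part of M without b is a basis of
  M. If the ideal is zero, M already lies in the smaller span.\<close>

lemma submodule_int_span:
  fixes B :: "'a::euclidean_space set"
  assumes "finite B" "independent B" "zmodule M" "M \<subseteq> int_span B"
  shows "\<exists>C. finite C \<and> independent C \<and> M = int_span C"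
  using assms
proof (induction B arbitrary: M rule: finite_induct)
  case empty
  then have "M = int_span {}"
    using zmoduleD(1) by (auto simp: int_span_def)
  then show ?case
    by (intro exI[of _ "{}"]) (simp add: independent_empty)
next
  case (insert b B)
  have indB: "independent B" and nb: "b \<notin> span B"
    using insert.prems(1) insert.hyps(2) by (auto simp: independent_insert)
  define M0 where "M0 = M \<inter> int_span B"
  have M0: "zmodule M0"
    using insert.prems(2) zmodule_int_span[of B] by (auto simp: M0_def zmodule_def)
  obtain C where C: "finite C" "independent C" "M0 = int_span C"
    using insert.IH[OF indB M0] by (auto simp: M0_def)
  define I where "I = {k. \<exists>v\<in>int_span B. of_int k *\<^sub>R b + v \<in> M}"
  have "zmodule I"
  proof -
    have "k - l \<in> I" if kl: "k \<in> I" "l \<in> I" for k l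
    proof -
      obtain v w where vw: "v \<in> int_span B" "of_int k *\<^sub>R b + v \<in> M"
          "w \<in> int_span B" "of_int l *\<^sub>R b + w \<in> M"
        using kl by (auto simp: I_def)
      have "of_int (k - l) *\<^sub>R b + (v - w) = (of_int k *\<^sub>R b + v) - (of_int l *\<^sub>R b + w)"
        by (simp add: algebra_simps)
      also have "\<dots> \<in> M"
        using vw insert.prems(2) by (intro zmoduleD(2))
      finally show ?thesis
        using vw zmoduleD(2)[OF zmodule_int_span] by (auto simp: I_def)
    qed
    moreover have "0 \<in> I"
      using zmoduleD(1)[OF zmodule_int_span[of B]] zmoduleD(1)[OF insert.prems(2)]
      by (auto simp: I_def intro!: bexI[of _ 0])
    ultimately show ?thesis
      by (simp add: zmodule_def)
  qed
  then obtain k where k: "k \<in> I" "\<And>i. i \<in> I \<Longrightarrow> k dvd i"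
    using zmodule_int_ideal by blast
  show ?case
  proof (cases "k = 0")
    case True
    have "M \<subseteq> int_span B"
    proof
      fix u assume u: "u \<in> M"
      then obtain l v where lv: "u = of_int l *\<^sub>R b + v" "v \<in> int_span B"
        using insert.prems(3) insert.hyps by (auto simp: int_span_insert)
      then have "l \<in> I"
        using u by (auto simp: I_def)
      then have "l = 0"
        using k(2) True by auto
      then show "u \<in> int_span B"
        using lv by simp
    qed
    then have "M = M0"
      by (auto simp: M0_def)
    then show ?thesis
      using C by auto
  next
    case False
    obtain v0 where v0: "v0 \<in> int_span B" "of_int k *\<^sub>R b + v0 \<in> M"
      using k(1) by (auto simp: I_def)
    let ?m = "of_int k *\<^sub>R b + v0"
    have "int_span C \<subseteq> int_span B"
      using C(3) by (auto simp: M0_def)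
    then have CB: "span C \<subseteq> span B"
      using int_span_superset[OF C(1)] int_span_subset_span[of B] by (intro span_minimal) auto
    have "?m \<notin> span B"
    proof
      assume "?m \<in> span B"
      then have "of_int k *\<^sub>R b \<in> span B"
        using v0(1) int_span_subset_span[of B] by (metis add_diff_cancel_right' span_diff subsetD)
      then have "(1 / of_int k) *\<^sub>R (of_int k *\<^sub>R b) \<in> span B"
        by (rule span_scale)
      then show False
        using nb False by simp
    qed
    then have mC: "?m \<notin> span C"
      using CB by auto
    then have mC': "?m \<notin> C"
      using span_base by auto
    have "M = int_span (insert ?m C)"
    proof (intro subset_antisym subsetI)
      fix u assume u: "u \<in> M"
      then obtain l v where lv: "u = of_int l *\<^sub>R b + v" "v \<in> int_span B"
        using insert.prems(3) insert.hyps by (auto simp: int_span_insert)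
      then have "l \<in> I"
        using u by (auto simp: I_def)
      then obtain c where c: "l = k * c"
        using k(2) by (meson dvdE)
      have eq: "u - of_int c *\<^sub>R ?m = v - of_int c *\<^sub>R v0"
        by (simp add: lv c algebra_simps)
      have "u - of_int c *\<^sub>R ?m \<in> M"
        using u v0(2) insert.prems(2) by (intro zmoduleD(2) zmodule_scale)
      moreover have "v - of_int c *\<^sub>R v0 \<in> int_span B"
        using lv(2) v0(1) by (intro zmoduleD(2) zmodule_scale zmodule_int_span)
      ultimately have "u - of_int c *\<^sub>R ?m \<in> int_span C"
        using C(3) eq by (auto simp: M0_def)
      moreover have "u = of_int c *\<^sub>R ?m + (u - of_int c *\<^sub>R ?m)"
        by simp
      ultimately show "u \<in> int_span (insert ?m C)"
        unfolding int_span_insert[OF C(1) mC'] by blast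
    next
      have "insert ?m C \<subseteq> M"
        using v0(2) int_span_superset[OF C(1)] C(3) by (auto simp: M0_def)
      then show "u \<in> M" if "u \<in> int_span (insert ?m C)" for u
        using int_span_minimal[OF insert.prems(2)] that by blast
    qed
    moreover have "independent (insert ?m C)"
      using C(2) mC mC' by (simp add: independent_insert)
    ultimately show ?thesis
      using C(1) by blast
  qed
qed

lemma is_lattice_finite_basis:
  assumes "is_lattice L W"
  obtains B where "finite B" "independent B" "L = int_span B" "span B = W"
  using assms by (auto simp: is_lattice_def lattice_basis_def intro: independent_imp_finite)

lemma is_lattice_int_span: "independent B \<Longrightarrow> is_lattice (int_span B) (span B)"
  by (auto simp: is_lattice_def lattice_basis_def)

lemma is_lattice_zmodule: "is_lattice L W \<Longrightarrow> zmodule L"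
  by (auto elim: is_lattice_finite_basis intro: zmodule_int_span)

lemma is_lattice_span: "is_lattice L W \<Longrightarrow> span L = W"
  by (auto elim!: is_lattice_finite_basis simp: span_int_span)

lemma is_lattice_subset: "is_lattice L W \<Longrightarrow> L \<subseteq> W"
  using is_lattice_span span_superset by blast

text \<open>Every basis spans the same real space, which gives the definite description a meaning
  and turns parity of the rank into parity of a real dimension.\<close>

lemma lattice_rank_eq_dim:
  assumes "is_lattice L W"
  shows "lattice_rank L = dim W"
proof -
  have "card B = dim W" if "lattice_basis B L" for B
  proof -
    have B: "independent B" "L = int_span B"
      using that by (auto simp: lattice_basis_def)
    then have "span B = W"
      using is_lattice_span[OF assms] span_int_span[of B] independent_imp_finite by blast
    then show ?thesis
      using B(1) by (metis dim_eq_card_independent dim_span)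
  qed
  moreover obtain B where "lattice_basis B L"
    using assms by (auto simp: is_lattice_def)
  ultimately show ?thesis
    unfolding lattice_rank_def by (intro the_equality) auto
qed

lemma is_lattice_submodule:
  assumes "is_lattice L W" "zmodule M" "M \<subseteq> L"
  shows "is_lattice M (span M)"
proof -
  obtain B where B: "finite B" "independent B" "L = int_span B"
    using assms(1) by (rule is_lattice_finite_basis)
  then obtain C where C: "finite C" "independent C" "M = int_span C"
    using submodule_int_span assms(2,3) by blast
  then show ?thesis
    using is_lattice_int_span[OF C(2)] by (simp add: span_int_span)
qed

lemma int_span_image:
  assumes "linear f" "inj_on f B"
  shows "int_span (f ` B) = f ` int_span B"
proof (intro subset_antisym subsetI)
  fix u assume "u \<in> int_span (f ` B)"
  then obtain c where "u = (\<Sum>b\<in>f ` B. of_int (c b) *\<^sub>R b)"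
    by (auto simp: int_span_def)
  then have "u = f (\<Sum>b\<in>B. of_int ((c \<circ> f) b) *\<^sub>R b)"
    using assms by (simp add: sum.reindex linear_sum linear_scale)
  then show "u \<in> f ` int_span B"
    by (auto intro: int_spanI)
next
  fix u assume "u \<in> f ` int_span B"
  then obtain c where "u = f (\<Sum>b\<in>B. of_int (c b) *\<^sub>R b)"
    by (auto simp: int_span_def)
  also have "\<dots> = (\<Sum>b\<in>B. of_int (c (inv_into B f (f b))) *\<^sub>R f b)"
    using assms by (simp add: linear_sum linear_scale inv_into_f_f)
  also have "\<dots> = (\<Sum>b\<in>f ` B. of_int ((c \<circ> inv_into B f) b) *\<^sub>R b)"
    using assms(2) by (simp add: sum.reindex)
  finally show "u \<in> int_span (f ` B)"
    by (rule int_spanI)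
qed

lemma is_lattice_image:
  assumes "is_lattice L W" "linear f" "inj_on f W"
  shows "is_lattice (f ` L) (f ` W)"
proof -
  obtain B where B: "finite B" "independent B" "L = int_span B" "span B = W"
    using assms(1) by (rule is_lattice_finite_basis)
  have inj: "inj_on f B"
    using assms(3) B(4) span_superset inj_on_subset by metis
  have "independent (f ` B)"
    using linear_independent_injective_image[OF assms(2) B(2)] assms(3) B(4) by simp
  moreover have "span (f ` B) = f ` W"
    using linear_span_image[OF assms(2)] B(4) by metis
  ultimately show ?thesis
    using is_lattice_int_span[of "f ` B"] int_span_image[OF assms(2) inj] B(3) by simp
qed

text \<open>N M is a subgroup of the lattice L, hence a lattice, and multiplication by 1/N carries
  it back to M.\<close>

lemma is_lattice_commensurable:
  assumes L: "is_lattice L W" and M: "zmodule M" "L \<subseteq> M"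
    and N: "N > 0" "\<And>m. m \<in> M \<Longrightarrow> of_nat N *\<^sub>R m \<in> L"
  shows "is_lattice M W"
proof -
  let ?NM = "(*\<^sub>R) (real N) ` M"
  have "zmodule ?NM"
    unfolding zmodule_def
  proof (intro conjI ballI)
    show "0 \<in> ?NM"
      using zmoduleD(1)[OF M(1)] by (intro image_eqI[of _ _ 0]) auto
    show "u - v \<in> ?NM" if "u \<in> ?NM" "v \<in> ?NM" for u v
      using that zmoduleD(2)[OF M(1)] by (auto simp flip: scaleR_diff_right)
  qed
  moreover have "?NM \<subseteq> L"
    using N(2) by auto
  ultimately have "is_lattice ?NM (span ?NM)"
    by (rule is_lattice_submodule[OF L])
  then have "is_lattice ((*\<^sub>R) (1 / real N) ` ?NM) ((*\<^sub>R) (1 / real N) ` span ?NM)"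
    using N(1) by (intro is_lattice_image) (auto simp: inj_on_def)
  moreover have eq: "(*\<^sub>R) (1 / real N) ` ?NM = M"
    using N(1) by (simp add: image_image)
  ultimately have "is_lattice M (span M)"
    using is_lattice_span by metis
  moreover have "span M = W"
  proof (rule subset_antisym)
    have "m \<in> W" if "m \<in> M" for m
    proof -
      have "(1 / real N) *\<^sub>R (real N *\<^sub>R m) \<in> span L"
        using N(2)[OF that] by (intro span_scale span_base)
      then show ?thesis
        using N(1) is_lattice_span[OF L] by simp
    qed
    then show "span M \<subseteq> W"
      using is_lattice_span[OF L] by (metis span_minimal subsetI subspace_span)
    show "W \<subseteq> span M"
      using M(2) is_lattice_span[OF L] span_mono by blast
  qed
  ultimately show ?thesis
    by simp
qed

text \<open>The coordinates are extended to linear functionals on the whole space, where linear maps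
  are bounded.\<close>

lemma lattice_coordinates:
  fixes B :: "'a::euclidean_space set"
  assumes "independent B"
  obtains f where "\<And>b. linear (f b)" "\<And>w. w \<in> span B \<Longrightarrow> w = (\<Sum>b\<in>B. f b w *\<^sub>R b)"
    "\<And>c b. b \<in> B \<Longrightarrow> f b (\<Sum>a\<in>B. c a *\<^sub>R a) = c b"
proof -
  have finB: "finite B"
    using assms by (rule independent_imp_finite)
  have "\<exists>g. linear g \<and> (\<forall>a\<in>B. g a = (if a = b then 1 else (0::real)))" for b
    using linear_independent_extend[OF assms, of "\<lambda>a. if a = b then 1 else (0::real)"] by simp
  then obtain f where f: "\<And>b. linear (f b)" "\<And>a b. a \<in> B \<Longrightarrow> f b a = (if a = b then 1 else (0::real))"
    by metis
  have coord: "f b (\<Sum>a\<in>B. c a *\<^sub>R a) = c b" if "b \<in> B" for b c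
  proof -
    have "f b (\<Sum>a\<in>B. c a *\<^sub>R a) = (\<Sum>a\<in>B. if a = b then c a else 0)"
      unfolding linear_sum[OF f(1)] linear_scale[OF f(1)] by (intro sum.cong) (auto simp: f(2))
    then show ?thesis
      using finB that by simp
  qed
  have "w = (\<Sum>b\<in>B. f b w *\<^sub>R b)" if w: "w \<in> span B" for w
  proof -
    obtain c where c: "w = (\<Sum>b\<in>B. c b *\<^sub>R b)"
      using w by (auto simp: span_finite[OF finB])
    then show ?thesis
      using coord by (auto intro!: sum.cong)
  qed
  then show ?thesis
    using that[of f] f(1) coord by blast
qed

text \<open>Coordinates are bounded functionals, so those of a short lattice vector are integers of
  absolute value less than 1.\<close>

lemma is_lattice_discrete:
  assumes "is_lattice L W"
  obtains e where "e > 0" "\<And>l. l \<in> L \<Longrightarrow> norm l < e \<Longrightarrow> l = 0"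
proof -
  obtain B where B: "finite B" "independent B" "L = int_span B" "span B = W"
    using assms by (rule is_lattice_finite_basis)
  obtain f where f: "\<And>b. linear (f b)" "\<And>w. w \<in> span B \<Longrightarrow> w = (\<Sum>b\<in>B. f b w *\<^sub>R b)"
      "\<And>c b. b \<in> B \<Longrightarrow> f b (\<Sum>a\<in>B. c a *\<^sub>R a) = c b"
    using lattice_coordinates[OF B(2)] by blast
  have "\<exists>K>0. \<forall>w. norm (f b w) \<le> norm w * K" for b
    using f(1) linear_conv_bounded_linear bounded_linear.pos_bounded by blast
  then obtain K where K: "\<And>b. K b > 0" "\<And>b w. norm (f b w) \<le> norm w * K b"
    by metis
  \<comment> \<open>The summand 1 keeps the bound positive for the zero lattice.\<close>
  define M where "M = (\<Sum>b\<in>B. K b) + 1"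
  have KM: "K b \<le> M" if "b \<in> B" for b
    using member_le_sum[of b B K] that B(1) less_imp_le[OF K(1)] by (force simp: M_def)
  have "(\<Sum>b\<in>B. K b) \<ge> 0"
    by (intro sum_nonneg less_imp_le K(1))
  then have M: "M > 0"
    by (simp add: M_def)
  have "l = 0" if l: "l \<in> L" "norm l < 1 / M" for l
  proof -
    obtain c where c: "l = (\<Sum>b\<in>B. of_int (c b) *\<^sub>R b)"
      using l(1) B(3) by (auto simp: int_span_def)
    have "c b = 0" if b: "b \<in> B" for b
    proof -
      have "norm (f b l) \<le> norm l * M"
        using K(2)[of b l] KM[OF b] mult_left_mono[OF KM[OF b] norm_ge_zero[of l]] by simp
      also have "\<dots> < 1"
        using l(2) M by (simp add: field_simps)
      finally have "\<bar>of_int (c b)\<bar> < (1::real)"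
        using f(3)[OF b] by (simp add: c)
      then show ?thesis
        by linarith
    qed
    then show ?thesis
      by (simp add: c)
  qed
  then show ?thesis
    using that[of "1 / M"] M by simp
qed

text \<open>Rounding the coordinates down moves a point into the fundamental parallelotope of the
  basis.\<close>

lemma is_lattice_bounded_reps:
  assumes "is_lattice L W"
  obtains R where "\<And>w. w \<in> W \<Longrightarrow> \<exists>l\<in>L. norm (w - l) \<le> R"
proof -
  obtain B where B: "finite B" "independent B" "L = int_span B" "span B = W"
    using assms by (rule is_lattice_finite_basis)
  have "\<exists>l\<in>L. norm (w - l) \<le> (\<Sum>b\<in>B. norm b)" if w: "w \<in> W" for w
  proof -
    obtain c where c: "w = (\<Sum>b\<in>B. c b *\<^sub>R b)"
      using w unfolding B(4)[symmetric] span_finite[OF B(1)] by blast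
    let ?l = "\<Sum>b\<in>B. of_int \<lfloor>c b\<rfloor> *\<^sub>R b"
    have "norm (w - ?l) = norm (\<Sum>b\<in>B. frac (c b) *\<^sub>R b)"
      by (simp add: c frac_def scaleR_diff_left sum_subtractf)
    also have "\<dots> \<le> (\<Sum>b\<in>B. norm (frac (c b) *\<^sub>R b))"
      by (rule norm_sum)
    also have "\<dots> \<le> (\<Sum>b\<in>B. norm b)"
      by (intro sum_mono) (auto intro!: mult_left_le_one_le simp: frac_ge_0 less_imp_le[OF frac_lt_1])
    finally have "norm (w - ?l) \<le> (\<Sum>b\<in>B. norm b)" .
    moreover have "?l \<in> L"
      unfolding B(3) by (rule int_spanI) simp
    ultimately show ?thesis
      by blast
  qed
  then show ?thesis
    using that by blast
qed

section \<open>Quotient groups\<close>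

lemma vclass_conv_image: "vclass V L v = (\<lambda>l. l + v) ` L"
  by (auto simp: vclass_def r_coset_def vgroup_def)

lemma vclass_eq_iff:
  assumes "zmodule L"
  shows "vclass V L u = vclass V L v \<longleftrightarrow> u - v \<in> L"
proof
  assume "vclass V L u = vclass V L v"
  then have "0 + u \<in> (\<lambda>l. l + v) ` L"
    using zmoduleD(1)[OF assms] unfolding vclass_conv_image by blast
  then show "u - v \<in> L"
    by auto
next
  assume uv: "u - v \<in> L"
  have *: "(\<lambda>l. l + u) ` L \<subseteq> (\<lambda>l. l + v) ` L" if "u - v \<in> L" for u v
  proof
    fix a assume "a \<in> (\<lambda>l. l + u) ` L"
    then obtain l where l: "l \<in> L" "a = l + u"
      by auto
    then have "a = (l + (u - v)) + v" "l + (u - v) \<in> L"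
      using that zmoduleD(4)[OF assms] by auto
    then show "a \<in> (\<lambda>l. l + v) ` L"
      by blast
  qed
  have "v - u \<in> L"
    using zmoduleD(3)[OF assms uv] by simp
  then show "vclass V L u = vclass V L v"
    unfolding vclass_conv_image using * uv by blast
qed

lemma vclass_0: "vclass V L 0 = L"
  by (simp add: vclass_conv_image)

lemma carrier_vquot: "carrier (vquot V L) = vclass V L ` V"
  by (simp add: vquot_def carrier_FactGroup vclass_def vgroup_def)

lemma one_vquot [simp]: "\<one>\<^bsub>vquot V L\<^esub> = L"
  by (simp add: vquot_def)

lemma vclass_eq_one_iff: "zmodule L \<Longrightarrow> vclass V L u = L \<longleftrightarrow> u \<in> L"
  using vclass_eq_iff[of L V u 0] by (simp add: vclass_0)

context
  fixes V L :: "'a::ab_group_add set"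
  assumes V: "zmodule V" and L: "zmodule L" and LV: "L \<subseteq> V"
begin

lemma comm_group_vgroup: "comm_group (vgroup V)"
proof (rule comm_groupI)
  fix u assume "u \<in> carrier (vgroup V)"
  then show "\<exists>v\<in>carrier (vgroup V). v \<otimes>\<^bsub>vgroup V\<^esub> u = \<one>\<^bsub>vgroup V\<^esub>"
    using zmoduleD(3)[OF V] by (intro bexI[of _ "- u"]) (auto simp: vgroup_def)
qed (use zmoduleD(1,4)[OF V] in \<open>auto simp: vgroup_def algebra_simps\<close>)

lemma normal_vgroup: "normal L (vgroup V)"
proof -
  interpret comm_group "vgroup V"
    by (rule comm_group_vgroup)
  have "inv\<^bsub>vgroup V\<^esub> u = - u" if "u \<in> V" for u
    using that zmoduleD(3)[OF V] by (intro inv_equality) (auto simp: vgroup_def)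
  then have "subgroup L (vgroup V)"
    using LV zmoduleD[OF L] by (intro subgroup.intro) (auto simp: vgroup_def dest: subsetD)
  then show ?thesis
    by (rule subgroup_imp_normal)
qed

lemma group_vquot: "group (vquot V L)"
  unfolding vquot_def using normal_vgroup by (rule normal.factorgroup_is_group)

lemma mult_vquot:
  "u \<in> V \<Longrightarrow> v \<in> V \<Longrightarrow> vclass V L u \<otimes>\<^bsub>vquot V L\<^esub> vclass V L v = vclass V L (u + v)"
  using normal.rcos_sum[OF normal_vgroup, of u v] by (simp add: vquot_def vclass_def vgroup_def)

lemma vclass_in_carrier: "u \<in> V \<Longrightarrow> vclass V L u \<in> carrier (vquot V L)"
  by (simp add: carrier_vquot)

lemma inv_vquot:
  assumes "u \<in> V"
  shows "inv\<^bsub>vquot V L\<^esub> vclass V L u = vclass V L (- u)"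
proof -
  interpret group "vquot V L"
    by (rule group_vquot)
  show ?thesis
    using assms zmoduleD(3)[OF V]
    by (intro inv_equality) (auto simp: mult_vquot vclass_in_carrier vclass_0)
qed

text \<open>One half of the correspondence between subgroups of V/L and groups between L and V. It
  turns the finite subgroup of a datum into an overlattice.\<close>

lemma subgroup_vquotD:
  assumes S: "subgroup S (vquot V L)"
  shows "zmodule {w \<in> V. vclass V L w \<in> S}" "L \<subseteq> {w \<in> V. vclass V L w \<in> S}"
    "S = vclass V L ` {w \<in> V. vclass V L w \<in> S}"
proof -
  have "vclass V L (u - v) \<in> S" if "u \<in> V" "vclass V L u \<in> S" "v \<in> V" "vclass V L v \<in> S" for u v
  proof -
    have "vclass V L u \<otimes>\<^bsub>vquot V L\<^esub> inv\<^bsub>vquot V L\<^esub> vclass V L v \<in> S"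
      using that S by (simp add: subgroup.m_closed subgroup.m_inv_closed)
    then show ?thesis
      using that zmoduleD(3)[OF V] by (simp add: inv_vquot mult_vquot)
  qed
  moreover have "vclass V L w \<in> S" if "w \<in> L" for w
  proof -
    have "vclass V L w = L"
      using that L by (simp add: vclass_eq_one_iff)
    then show ?thesis
      using subgroup.one_closed[OF S] by simp
  qed
  ultimately show "zmodule {w \<in> V. vclass V L w \<in> S}" "L \<subseteq> {w \<in> V. vclass V L w \<in> S}"
    using V L LV by (auto simp: zmodule_def)
  show "S = vclass V L ` {w \<in> V. vclass V L w \<in> S}"
    using subgroup.subset[OF S] by (auto simp: carrier_vquot)
qed

lemma subgroup_vquotI:
  assumes "zmodule M" "M \<subseteq> V"
  shows "subgroup (vclass V L ` M) (vquot V L)"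
proof (rule subgroup.intro)
  show "vclass V L ` M \<subseteq> carrier (vquot V L)"
    using assms by (auto simp: carrier_vquot)
  show "\<one>\<^bsub>vquot V L\<^esub> \<in> vclass V L ` M"
    using zmoduleD(1)[OF assms(1)] vclass_0[of V L] by (metis image_eqI one_vquot)
  show "a \<otimes>\<^bsub>vquot V L\<^esub> b \<in> vclass V L ` M" if ab: "a \<in> vclass V L ` M" "b \<in> vclass V L ` M" for a b
  proof -
    obtain u where u: "u \<in> M" "a = vclass V L u"
      using ab(1) by auto
    obtain v where v: "v \<in> M" "b = vclass V L v"
      using ab(2) by auto
    note uv = u v
    have "a \<otimes>\<^bsub>vquot V L\<^esub> b = vclass V L (u + v)"
      using assms(2) uv mult_vquot[of u v] by auto
    then show ?thesis
      using uv zmoduleD(4)[OF assms(1)] by auto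
  qed
  show "inv\<^bsub>vquot V L\<^esub> a \<in> vclass V L ` M" if "a \<in> vclass V L ` M" for a
    using that assms zmoduleD(3)[OF assms(1)] by (auto simp: inv_vquot dest!: subsetD)
qed

end

lemma generate_vquot:
  fixes V L :: "'a::real_vector set"
  assumes V: "zmodule V" "zmodule L" "L \<subseteq> V" and w: "w \<in> V"
  shows "generate (vquot V L) {vclass V L w} = range (\<lambda>k::int. vclass V L (of_int k *\<^sub>R w))"
proof -
  interpret group "vquot V L"
    using V by (rule group_vquot)
  have nat: "vclass V L w [^]\<^bsub>vquot V L\<^esub> m = vclass V L (of_nat m *\<^sub>R w)" for m :: nat
    by (induction m) (use V w in \<open>simp_all add: vclass_0 mult_vquot zmodule_scale_nat scaleR_add_left add.commute\<close>)
  have "vclass V L w [^]\<^bsub>vquot V L\<^esub> k = vclass V L (of_int k *\<^sub>R w)" for k :: int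
  proof (cases k rule: int_cases2)
    case (nonneg m)
    then show ?thesis
      using nat[of m] by (simp add: int_pow_int)
  next
    case (nonpos m)
    then show ?thesis
      using nat[of m] V w zmodule_scale_nat[OF V(1) w, of m]
      by (simp add: int_pow_neg_int vclass_in_carrier inv_vquot)
  qed
  then show ?thesis
    using V w by (subst generate_pow) (auto simp: carrier_vquot)
qed

text \<open>The integers k with k w in L form an ideal with generator m, and the absolute value of m
  is the order of the class of w.\<close>

lemma card_generate_vquot:
  fixes V L :: "'a::real_vector set"
  assumes V: "zmodule V" "zmodule L" "L \<subseteq> V" and w: "w \<in> V" and n: "n > 0"
  shows "card (generate (vquot V L) {vclass V L w}) = n \<longleftrightarrow> (\<forall>k. of_int k *\<^sub>R w \<in> L \<longleftrightarrow> int n dvd k)"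
proof -
  define I where "I = {k. of_int k *\<^sub>R w \<in> L}"
  have "zmodule I"
    using zmoduleD[OF V(2)] by (auto simp: I_def zmodule_def scaleR_diff_left)
  then obtain m where m: "m \<in> I" "\<And>k. k \<in> I \<Longrightarrow> m dvd k"
    using zmodule_int_ideal by blast
  have I: "of_int k *\<^sub>R w \<in> L \<longleftrightarrow> m dvd k" for k
  proof
    assume "m dvd k"
    then obtain c where "k = c * m"
      by (metis dvdE mult.commute)
    then show "of_int k *\<^sub>R w \<in> L"
      using zmodule_scale[OF V(2), of "of_int m *\<^sub>R w" c] m(1) by (simp add: I_def)
  qed (use m in \<open>simp add: I_def\<close>)
  define f where "f = (\<lambda>k::int. vclass V L (of_int k *\<^sub>R w))"
  have f: "f k = f l \<longleftrightarrow> m dvd k - l" for k l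
    using I[of "k - l"] by (simp add: f_def vclass_eq_iff[OF V(2)] scaleR_diff_left)
  have "card (range f) = nat \<bar>m\<bar>"
  proof (cases "m = 0")
    \<comment> \<open>An infinite cyclic group has \<open>card\<close> 0, which agrees with m =
      0.\<close>
    case True
    then have "inj f"
      by (auto simp: inj_on_def f)
    then have "infinite (range f)"
      using finite_imageD infinite_UNIV_int by blast
    then show ?thesis
      using True by simp
  next
    case False
    have "range f = f ` {0..<\<bar>m\<bar>}"
    proof (intro subset_antisym subsetI)
      fix a assume "a \<in> range f"
      then obtain k where "a = f k"
        by auto
      also have "\<dots> = f (k mod \<bar>m\<bar>)"
        unfolding f by (metis abs_dvd_iff dvd_minus_mod)
      finally show "a \<in> f ` {0..<\<bar>m\<bar>}"
        using False by auto
    qed auto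
    moreover have "inj_on f {0..<\<bar>m\<bar>}"
    proof (rule inj_onI)
      fix k l assume "k \<in> {0..<\<bar>m\<bar>}" "l \<in> {0..<\<bar>m\<bar>}" "f k = f l"
      then have "\<bar>m\<bar> dvd k - l" "\<bar>k - l\<bar> < \<bar>m\<bar>"
        by (auto simp: f)
      then show "k = l"
        using dvd_imp_le_int[of "k - l" "\<bar>m\<bar>"] by auto
    qed
    ultimately show ?thesis
      by (simp add: card_image)
  qed
  then have "card (generate (vquot V L) {vclass V L w}) = nat \<bar>m\<bar>"
    using generate_vquot[OF V w] by (simp add: f_def)
  moreover have "nat \<bar>m\<bar> = n \<longleftrightarrow> (\<forall>k. m dvd k \<longleftrightarrow> int n dvd k)"
  proof
    assume *: "\<forall>k. m dvd k \<longleftrightarrow> int n dvd k"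
    have "m dvd int n" "int n dvd m"
      using *[THEN spec, of "int n"] *[THEN spec, of m] by simp_all
    then have "\<bar>m\<bar> = \<bar>int n\<bar>"
      by (rule zdvd_antisym_abs)
    then show "nat \<bar>m\<bar> = n"
      by simp
  qed auto
  ultimately show ?thesis
    by (simp add: I)
qed

text \<open>In a basis of M such a w has coordinates with denominator N, and modulo M only the
  numerators modulo N matter.\<close>

lemma finite_vquot_torsion:
  fixes M :: "'a::euclidean_space set"
  assumes "is_lattice M W" "N > 0"
  shows "finite (vclass V M ` {w. of_nat N *\<^sub>R w \<in> M})"
proof -
  obtain B where B: "finite B" "independent B" "M = int_span B" "span B = W"
    using assms(1) by (rule is_lattice_finite_basis)
  have M: "zmodule M"
    using assms(1) by (rule is_lattice_zmodule)
  define g where "g c = vclass V M (\<Sum>b\<in>B. (of_int (c b) / of_nat N) *\<^sub>R b)" for c :: "'a \<Rightarrow> int"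
  have "vclass V M w \<in> g ` (PiE B (\<lambda>_. {0..<int N}))" if "of_nat N *\<^sub>R w \<in> M" for w
  proof -
    obtain c where c: "of_nat N *\<^sub>R w = (\<Sum>b\<in>B. of_int (c b) *\<^sub>R b)"
      using \<open>of_nat N *\<^sub>R w \<in> M\<close> B(3) by (auto simp: int_span_def)
    have "w = (1 / of_nat N) *\<^sub>R (of_nat N *\<^sub>R w)"
      using assms(2) by simp
    then have w: "w = (\<Sum>b\<in>B. (of_int (c b) / of_nat N) *\<^sub>R b)"
      unfolding c by (simp add: scaleR_sum_right)
    let ?c = "\<lambda>b\<in>B. c b mod int N"
    have "w - (\<Sum>b\<in>B. (of_int (?c b) / of_nat N) *\<^sub>R b) = (\<Sum>b\<in>B. of_int (c b div int N) *\<^sub>R b)"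
    proof -
      have "of_int (c b) / real N - of_int (c b mod int N) / real N = of_int (c b div int N)" for b
      proof -
        have "of_int (c b) = real N * of_int (c b div int N) + of_int (c b mod int N)"
          by (metis mult_div_mod_eq of_int_add of_int_mult of_int_of_nat_eq)
        then show ?thesis
          using assms(2) by (simp add: field_simps)
      qed
      then show ?thesis
        by (simp add: w flip: sum_subtractf scaleR_diff_left)
    qed
    also have "\<dots> \<in> M"
      unfolding B(3) by (rule int_spanI) simp
    finally have "vclass V M w = g ?c"
      by (simp add: g_def vclass_eq_iff[OF M])
    moreover have "?c \<in> PiE B (\<lambda>_. {0..<int N})"
      using assms(2) by auto
    ultimately show ?thesis
      by blast
  qed
  then have "vclass V M ` {w. of_nat N *\<^sub>R w \<in> M} \<subseteq> g ` (PiE B (\<lambda>_. {0..<int N}))"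
    by auto
  then show ?thesis
    by (rule finite_subset) (intro finite_imageI finite_PiE B(1) finite_atLeastLessThan_int)
qed

section \<open>Sums of subgroups\<close>

lemma sum_ofE:
  assumes "w \<in> sum_of I U"
  obtains u where "w = (\<Sum>i\<in>I. u i)" "\<And>i. i \<in> I \<Longrightarrow> u i \<in> U i"
  using assms by (auto simp: sum_of_def)

lemma sum_ofI: "w = (\<Sum>i\<in>I. u i) \<Longrightarrow> (\<And>i. i \<in> I \<Longrightarrow> u i \<in> U i) \<Longrightarrow> w \<in> sum_of I U"
  by (auto simp: sum_of_def)

lemma sum_of_mono: "(\<And>i. i \<in> I \<Longrightarrow> U i \<subseteq> U' i) \<Longrightarrow> sum_of I U \<subseteq> sum_of I U'"
  by (fastforce simp: sum_of_def)

lemma sum_of_component: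
  assumes "finite I" "i \<in> I" "\<And>j. j \<in> I \<Longrightarrow> 0 \<in> U j" "w \<in> U i"
  shows "w \<in> sum_of I U"
proof (rule sum_ofI)
  show "w = (\<Sum>j\<in>I. if j = i then w else 0)"
    using assms by simp
qed (use assms in auto)

lemma zmodule_sum_of:
  assumes "\<And>i. i \<in> I \<Longrightarrow> zmodule (U i)"
  shows "zmodule (sum_of I U)"
proof -
  have "u - v \<in> sum_of I U" if uv: "u \<in> sum_of I U" "v \<in> sum_of I U" for u v
  proof -
    obtain a where a: "u = (\<Sum>i\<in>I. a i)" "\<And>i. i \<in> I \<Longrightarrow> a i \<in> U i"
      using uv(1) unfolding sum_of_def by blast
    obtain b where b: "v = (\<Sum>i\<in>I. b i)" "\<And>i. i \<in> I \<Longrightarrow> b i \<in> U i"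
      using uv(2) unfolding sum_of_def by blast
    show ?thesis
    proof (rule sum_ofI)
      show "u - v = (\<Sum>i\<in>I. a i - b i)"
        by (simp add: a b sum_subtractf)
    qed (use a b assms in \<open>auto simp: zmodule_def\<close>)
  qed
  moreover have "0 \<in> sum_of I U"
    by (rule sum_ofI[of _ "\<lambda>_. 0"]) (use assms zmoduleD(1) in auto)
  ultimately show ?thesis
    by (simp add: zmodule_def)
qed

lemma subspace_sum_of:
  assumes "\<And>i. i \<in> I \<Longrightarrow> subspace (U i)"
  shows "subspace (sum_of I U)"
proof (rule subspaceI)
  have Z: "zmodule (sum_of I U)"
    using assms by (intro zmodule_sum_of zmodule_subspace)
  show "0 \<in> sum_of I U" "\<And>u v. u \<in> sum_of I U \<Longrightarrow> v \<in> sum_of I U \<Longrightarrow> u + v \<in> sum_of I U"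
    using zmoduleD[OF Z] by auto
  fix c u assume "u \<in> sum_of I U"
  then obtain a where "u = (\<Sum>i\<in>I. a i)" "\<And>i. i \<in> I \<Longrightarrow> a i \<in> U i"
    unfolding sum_of_def by blast
  then show "c *\<^sub>R u \<in> sum_of I U"
    using assms by (intro sum_ofI[of _ "\<lambda>i. c *\<^sub>R a i"]) (auto simp: scaleR_sum_right subspace_scale)
qed

lemma is_lattice_sum_of:
  fixes L :: "'i \<Rightarrow> 'a::euclidean_space set"
  assumes I: "finite I" and L: "\<And>i. i \<in> I \<Longrightarrow> is_lattice (L i) (W i)"
    and dir: "\<And>u. (\<And>i. i \<in> I \<Longrightarrow> u i \<in> W i) \<Longrightarrow> (\<Sum>i\<in>I. u i) = 0 \<Longrightarrow> \<forall>i\<in>I. u i = 0"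
  shows "is_lattice (sum_of I L) (sum_of I W)"
proof -
  have "\<forall>i\<in>I. \<exists>B. finite B \<and> independent B \<and> L i = int_span B \<and> span B = W i"
    using L is_lattice_finite_basis by metis
  then obtain B where B: "\<And>i. i \<in> I \<Longrightarrow> finite (B i) \<and> independent (B i) \<and> L i = int_span (B i) \<and> span (B i) = W i"
    by metis
  have BW: "b \<in> W i" if "i \<in> I" "b \<in> B i" for i b
    using B[OF that(1)] that(2) span_base by metis
  have disj: "B i \<inter> B j = {}" if ij: "i \<in> I" "j \<in> I" "i \<noteq> j" for i j
  proof (rule ccontr)
    assume "B i \<inter> B j \<noteq> {}"
    then obtain b where b: "b \<in> B i" "b \<in> B j"
      by auto
    \<comment> \<open>A common basis vector b would give the relation b - b = 0 between two
      different summands.\<close>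
    define u where "u = (\<lambda>k. if k = i then b else if k = j then - b else 0)"
    have "0 \<in> W k" "w \<in> W k \<Longrightarrow> - w \<in> W k" if "k \<in> I" for k w
      using B[OF that] by (metis span_zero, metis span_neg)
    then have "u k \<in> W k" if "k \<in> I" for k
      using b BW that ij by (auto simp: u_def)
    moreover have "(\<Sum>k\<in>I. u k) = 0"
    proof -
      have "(\<Sum>k\<in>I. u k) = (\<Sum>k\<in>{i, j}. u k)"
        using I ij by (intro sum.mono_neutral_right) (auto simp: u_def)
      then show ?thesis
        using ij by (simp add: u_def)
    qed
    ultimately have "u i = 0"
      using dir ij by blast
    then show False
      using b B[OF ij(1)] dependent_zero by (auto simp: u_def)
  qed
  let ?B = "\<Union>i\<in>I. B i"
  have fin: "finite ?B"
    using I B by auto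
  have sum: "(\<Sum>b\<in>?B. g b) = (\<Sum>i\<in>I. \<Sum>b\<in>B i. g b)" for g :: "'a \<Rightarrow> 'a"
    using I B disj by (intro sum.UNION_disjoint) auto
  have "independent ?B"
  proof (rule independent_if_scalars_zero[OF fin])
    fix f b assume f: "(\<Sum>b\<in>?B. f b *\<^sub>R b) = 0" and "b \<in> ?B"
    then obtain i where i: "i \<in> I" "b \<in> B i"
      by auto
    have "(\<Sum>b\<in>B j. f b *\<^sub>R b) \<in> W j" if "j \<in> I" for j
    proof -
      have "(\<Sum>b\<in>B j. f b *\<^sub>R b) \<in> span (B j)"
        by (intro span_sum span_scale span_base)
      then show ?thesis
        using B[OF that] by simp
    qed
    then have "(\<Sum>b\<in>B i. f b *\<^sub>R b) = 0"
      using dir[of "\<lambda>i. \<Sum>b\<in>B i. f b *\<^sub>R b"] f i by (simp add: sum)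
    then show "f b = 0"
      using B[OF i(1)] i(2) independentD by (metis order_refl)
  qed
  \<comment> \<open>The bases are disjoint, so coefficients chosen summand by summand come from one
    function on the union.\<close>
  moreover have combine: "\<exists>c. \<forall>i\<in>I. \<forall>b\<in>B i. c b = d i b" for d :: "'i \<Rightarrow> 'a \<Rightarrow> 'b"
  proof (intro exI ballI)
    fix i b assume ib: "i \<in> I" "b \<in> B i"
    then have "(THE j. j \<in> I \<and> b \<in> B j) = i"
      using disj by (intro the_equality) auto
    then show "(\<lambda>b. d (THE j. j \<in> I \<and> b \<in> B j) b) b = d i b"
      by simp
  qed
  have "int_span ?B = sum_of I L"
  proof (intro subset_antisym subsetI)
    fix w assume "w \<in> int_span ?B"
    then obtain c where "w = (\<Sum>b\<in>?B. of_int (c b) *\<^sub>R b)"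
      by (auto simp: int_span_def)
    then show "w \<in> sum_of I L"
      unfolding sum by (rule sum_ofI) (use B in \<open>auto intro: int_spanI\<close>)
  next
    fix w assume "w \<in> sum_of I L"
    then obtain u where u: "w = (\<Sum>i\<in>I. u i)" "\<And>i. i \<in> I \<Longrightarrow> u i \<in> int_span (B i)"
      using B by (metis sum_ofE)
    then have "\<forall>i\<in>I. \<exists>d. u i = (\<Sum>b\<in>B i. of_int (d b) *\<^sub>R b)"
      by (fastforce simp: int_span_def)
    then obtain d where d: "\<And>i. i \<in> I \<Longrightarrow> u i = (\<Sum>b\<in>B i. of_int (d i b) *\<^sub>R b)"
      by metis
    obtain c where c: "\<forall>i\<in>I. \<forall>b\<in>B i. c b = d i b"
      using combine[of d] by blast
    have "w = (\<Sum>b\<in>?B. of_int (c b) *\<^sub>R b)"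
      unfolding sum u(1) using c d by (auto intro!: sum.cong)
    then show "w \<in> int_span ?B"
      by (rule int_spanI)
  qed
  moreover have "span ?B = sum_of I W"
  proof (rule subset_antisym)
    have "subspace (sum_of I W)"
      using B by (intro subspace_sum_of) (metis subspace_span)
    moreover have "?B \<subseteq> sum_of I W"
      using I BW B by (auto intro!: sum_of_component[OF I]) (metis span_zero)
    ultimately show "span ?B \<subseteq> sum_of I W"
      by (simp add: span_minimal)
    have "W i \<subseteq> span ?B" if "i \<in> I" for i
      using B[OF that] that by (metis UN_upper span_mono)
    then show "sum_of I W \<subseteq> span ?B"
      by (auto elim!: sum_ofE intro!: span_sum)
  qed
  ultimately show ?thesis
    using is_lattice_int_span[of ?B] by simp
qed

section \<open>Complexification\<close>

abbreviation clinear :: "(complex^'k \<Rightarrow> complex^'m) \<Rightarrow> bool" where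
  "clinear \<equiv> Vector_Spaces.linear (*s) (*s)"

lemma clinearI:
  assumes "\<And>u v. f (u + v) = f u + f v" "\<And>c v. f (c *s v) = c *s f v"
  shows "clinear f"
  by (unfold_locales) (use assms in auto)

lemma clinearD:
  assumes "clinear f"
  shows "f (u + v) = f u + f v" "f (c *s v) = c *s f v" "f 0 = 0" "f (u - v) = f u - f v"
    "f (- v) = - f v" "f (sum g I) = (\<Sum>i\<in>I. f (g i))"
  using assms
  by (auto simp: vec.linear_add vec.linear_scale vec.linear_0 vec.linear_diff vec.linear_neg vec.linear_sum)

lemma scaleR_vec_complex: "r *\<^sub>R (z :: complex^'k) = of_real r *s z"
  by (simp add: vec_eq_iff scaleR_conv_of_real[where 'a = complex])

lemma clinear_imp_linear: "clinear f \<Longrightarrow> linear f"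
  by (intro linearI) (auto simp: clinearD scaleR_vec_complex)

lemma norm_cscale: "norm (c *s (u :: complex^'k)) = cmod c * norm u"
  by (simp add: norm_vec_def norm_mult L2_set_right_distrib)

lemma dist_cscale: "dist (t *s u) (s *s (u :: complex^'k)) = cmod (s - t) * norm u"
  by (metis dist_norm norm_cscale norm_minus_commute vector_sub_rdistrib)

lemma csubspaceD:
  assumes "vec.subspace V"
  shows "0 \<in> V" "u \<in> V \<Longrightarrow> v \<in> V \<Longrightarrow> u + v \<in> V" "u \<in> V \<Longrightarrow> c *s u \<in> V"
    "u \<in> V \<Longrightarrow> v \<in> V \<Longrightarrow> u - v \<in> V" "u \<in> V \<Longrightarrow> - u \<in> V"
  using assms by (auto intro: vec.subspace_0 vec.subspace_add vec.subspace_scale vec.subspace_diff vec.subspace_neg)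

lemma csubspace_imp_subspace: "vec.subspace (V :: (complex^'k) set) \<Longrightarrow> subspace V"
  by (intro subspaceI) (auto simp: csubspaceD scaleR_vec_complex)

lemma csubspaceI:
  assumes "subspace (V :: (complex^'k) set)" "\<And>v. v \<in> V \<Longrightarrow> \<i> *s v \<in> V"
  shows "vec.subspace V"
proof (rule vec.subspaceI)
  show "0 \<in> V" "\<And>u v. u \<in> V \<Longrightarrow> v \<in> V \<Longrightarrow> u + v \<in> V"
    using assms(1) by (auto intro: subspace_0 subspace_add)
  fix c v assume v: "v \<in> V"
  have "c *s v = Re c *\<^sub>R v + Im c *\<^sub>R (\<i> *s v)"
    by (simp add: vec_eq_iff scaleR_conv_of_real[where 'a = complex] complex_eq_iff)
  then show "c *s v \<in> V"
    using assms v by (simp add: subspace_add subspace_scale)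
qed

lemma linear_cvec: "linear cvec"
  by (intro linearI) (simp_all add: cvec_def vec_eq_iff scaleR_conv_of_real[where 'a = complex])

lemma linear_vRe: "linear vRe" and linear_vIm: "linear vIm" and linear_vcnj: "linear vcnj"
  by (intro linearI; simp add: vRe_def vIm_def vcnj_def vec_eq_iff)+

lemma vRe_cvec [simp]: "vRe (cvec v) = v" and vIm_cvec [simp]: "vIm (cvec v) = 0"
  and vcnj_cvec [simp]: "vcnj (cvec v) = cvec v" and vcnj_vcnj [simp]: "vcnj (vcnj z) = z"
  and vRe_vcnj [simp]: "vRe (vcnj z) = vRe z" and vIm_vcnj [simp]: "vIm (vcnj z) = - vIm z"
  and vRe_i [simp]: "vRe (\<i> *s z) = - vIm z" and vIm_i [simp]: "vIm (\<i> *s z) = vRe z"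
  by (simp_all add: vRe_def vIm_def vcnj_def cvec_def vec_eq_iff)

lemma cvec_vRe_vIm: "cvec (vRe z) + \<i> *s cvec (vIm z) = z"
  by (simp add: vRe_def vIm_def cvec_def vec_eq_iff complex_eq_iff)

lemma add_vcnj: "z + vcnj z = cvec (2 *\<^sub>R vRe z)"
  by (simp add: vRe_def vcnj_def cvec_def vec_eq_iff complex_eq_iff)

lemma vRe_vIm_eqI: "vRe z = vRe w \<Longrightarrow> vIm z = vIm w \<Longrightarrow> z = w"
  by (metis cvec_vRe_vIm)

lemma cext_cvec [simp]: "linear f \<Longrightarrow> cext f (cvec v) = f v"
  by (simp add: cext_def linear_0)

lemma clinear_cext:
  assumes "linear f"
  shows "clinear (cext f)"
proof (rule clinearI)
  show "cext f (u + v) = cext f u + cext f v" for u v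
    by (simp add: cext_def linear_add[OF linear_vRe] linear_add[OF linear_vIm] linear_add[OF assms]
        vector_add_ldistrib)
  show "cext f (c *s v) = c *s cext f v" for c v
  proof -
    have eq: "vRe (c *s v) = Re c *\<^sub>R vRe v - Im c *\<^sub>R vIm v" "vIm (c *s v) = Re c *\<^sub>R vIm v + Im c *\<^sub>R vRe v"
      by (simp_all add: vRe_def vIm_def vec_eq_iff)
    show ?thesis
      unfolding cext_def eq linear_add[OF assms] linear_diff[OF assms] linear_scale[OF assms]
      by (simp add: vec_eq_iff complex_eq_iff algebra_simps)
  qed
qed

context
  fixes x :: "real^'k \<Rightarrow> real^'k"
  assumes x: "linear x"
begin

lemma linear_cvec_comp: "linear (\<lambda>v. cvec (x v))"
  using linear_compose[OF x linear_cvec] by (simp add: o_def)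

lemma clinear_cact: "clinear (cact x)"
  unfolding cact_def by (rule clinear_cext[OF linear_cvec_comp])

lemma vRe_cact: "vRe (cact x z) = x (vRe z)" and vIm_cact: "vIm (cact x z) = x (vIm z)"
  by (simp_all add: cact_def cext_def linear_add[OF linear_vRe] linear_add[OF linear_vIm])

lemma vRe_cact_funpow: "vRe ((cact x ^^ k) z) = (x ^^ k) (vRe z)"
  and vIm_cact_funpow: "vIm ((cact x ^^ k) z) = (x ^^ k) (vIm z)"
  by (induction k) (simp_all add: vRe_cact vIm_cact)

lemma vRe_poly_act_cact: "vRe (poly_act p (cact x) z) = poly_act p x (vRe z)"
  by (simp add: poly_act_def linear_sum[OF linear_vRe] linear_scale[OF linear_vRe] vRe_cact_funpow)

lemma vIm_poly_act_cact: "vIm (poly_act p (cact x) z) = poly_act p x (vIm z)"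
  by (simp add: poly_act_def linear_sum[OF linear_vIm] linear_scale[OF linear_vIm] vIm_cact_funpow)

lemma poly_act_cact_eq_0_iff:
  "poly_act p (cact x) z = 0 \<longleftrightarrow> poly_act p x (vRe z) = 0 \<and> poly_act p x (vIm z) = 0"
  by (metis vRe_poly_act_cact vIm_poly_act_cact vRe_vIm_eqI linear_0 linear_vRe linear_vIm)

end

lemma mem_cspan_iff: "z \<in> cspan L \<longleftrightarrow> vRe z \<in> span L \<and> vIm z \<in> span L"
proof
  let ?S = "{z. vRe z \<in> span L \<and> vIm z \<in> span L}"
  have S: "vec.subspace ?S"
  proof (rule csubspaceI)
    show "subspace ?S"
      by (rule subspaceI) (auto simp: linear_0 linear_add linear_scale linear_vRe linear_vIm span_zero
          intro: span_add span_scale)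
  qed (auto intro: span_neg)
  have "cvec ` L \<subseteq> ?S"
    by (auto simp: span_base span_zero)
  then have "cspan L \<subseteq> ?S"
    unfolding cspan_def using S by (rule vec.span_minimal)
  then show "vRe z \<in> span L \<and> vIm z \<in> span L" if "z \<in> cspan L"
    using that by auto
next
  assume z: "vRe z \<in> span L \<and> vIm z \<in> span L"
  have "subspace {v. cvec v \<in> cspan L}"
    unfolding cspan_def
    by (rule subspaceI) (auto simp: linear_0 linear_add linear_scale linear_cvec scaleR_vec_complex
        vec.span_zero intro: vec.span_add vec.span_scale)
  then have "span L \<subseteq> {v. cvec v \<in> cspan L}"
    by (intro span_minimal) (auto simp: cspan_def intro: vec.span_base)
  then have "cvec (vRe z) \<in> cspan L" "cvec (vIm z) \<in> cspan L"
    using z by auto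
  then have "cvec (vRe z) + \<i> *s cvec (vIm z) \<in> cspan L"
    unfolding cspan_def by (intro vec.span_add vec.span_scale)
  then show "z \<in> cspan L"
    by (simp add: cvec_vRe_vIm)
qed

text \<open>Complex linear maps are total, while \<open>f\<close> commutes with i only on V. So
  \<open>f\<close> is restricted to a complex basis of V and extended from there; the agreement set
  is a complex subspace because \<open>f\<close> commutes with i on V.\<close>

lemma clinear_extend:
  assumes V: "vec.subspace V" and f: "linear f" "\<And>v. v \<in> V \<Longrightarrow> f (\<i> *s v) = \<i> *s f v"
  obtains g where "clinear g" "\<And>v. v \<in> V \<Longrightarrow> g v = f v"
proof -
  obtain B where B: "B \<subseteq> V" "vec.independent B" "V \<subseteq> vec.span B"
    using vec.basis_exists by metis
  obtain g where g: "clinear g" "\<forall>b\<in>B. g b = f b"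
    using vec.linear_independent_extend[OF B(2)] by blast
  let ?S = "{v \<in> V. g v = f v}"
  have "vec.subspace ?S"
  proof (rule csubspaceI)
    show "subspace ?S"
      by (rule subspaceI) (use V g f(1) in \<open>auto simp: csubspaceD clinearD linear_0 linear_add linear_scale
          scaleR_vec_complex\<close>, simp add: linear_scale flip: scaleR_vec_complex)
  qed (use V g f(2) in \<open>auto simp: csubspaceD clinearD\<close>)
  then have "vec.span B \<subseteq> ?S"
    using B g by (intro vec.span_minimal) auto
  then show ?thesis
    using that[of g] g(1) B(3) by blast
qed

text \<open>Each vector b of a complex basis contributes the two real dimensions of b and i
  b.\<close>

lemma even_dim_csubspace:
  fixes V :: "(complex^'k) set"
  assumes V: "vec.subspace V"
  shows "even (dim V)"
proof -
  have *: "even (dim (vec.span B))" if "finite B" "vec.independent B" for B :: "(complex^'k) set"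
    using that
  proof (induction B rule: finite_induct)
    case (insert b B)
    let ?W = "vec.span B"
    have W: "vec.subspace ?W" "span ?W = ?W"
      by (auto simp: csubspace_imp_subspace)
    have b: "b \<notin> ?W"
      using insert by (simp add: vec.independent_insert)
    have ib: "\<i> *s b \<notin> ?W"
    proof
      assume "\<i> *s b \<in> ?W"
      then have "(- \<i>) *s (\<i> *s b) \<in> ?W"
        by (rule csubspaceD(3)[OF W(1)])
      then show False
        using b by (simp add: vector_smult_assoc)
    qed
    \<comment> \<open>A real relation would put (1 - r i) b into the span of the previous vectors
      for some real r, and 1 - r i is invertible.\<close>
    have b': "b \<notin> span (insert (\<i> *s b) ?W)"
    proof
      assume "b \<in> span (insert (\<i> *s b) ?W)"
      then obtain r where "b - r *\<^sub>R (\<i> *s b) \<in> ?W"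
        by (auto simp: span_insert W)
      moreover have "b - r *\<^sub>R (\<i> *s b) = (1 - of_real r * \<i>) *s b"
        by (simp add: scaleR_vec_complex vector_sub_rdistrib vector_smult_assoc)
      ultimately have "(1 / (1 - of_real r * \<i>)) *s ((1 - of_real r * \<i>) *s b) \<in> ?W"
        using W(1) by (metis csubspaceD(3))
      moreover have "1 - of_real r * \<i> \<noteq> (0::complex)"
        by (simp add: complex_eq_iff)
      ultimately show False
        using b by (simp only: vector_smult_assoc) simp
    qed
    have eq: "vec.span (insert b B) = span (insert b (insert (\<i> *s b) ?W))"
    proof (intro subset_antisym)
      show "span (insert b (insert (\<i> *s b) ?W)) \<subseteq> vec.span (insert b B)"
        using vec.span_mono[of B "insert b B"]
        by (intro span_minimal csubspace_imp_subspace vec.subspace_span)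
          (auto intro: vec.span_base vec.span_scale)
      show "vec.span (insert b B) \<subseteq> span (insert b (insert (\<i> *s b) ?W))"
      proof
        fix z assume "z \<in> vec.span (insert b B)"
        then obtain c where c: "z - c *s b \<in> ?W"
          by (auto simp: vec.span_insert)
        have "z = (z - c *s b) + (Re c *\<^sub>R b + Im c *\<^sub>R (\<i> *s b))"
          by (simp add: vec_eq_iff scaleR_conv_of_real[where 'a = complex] complex_eq_iff)
        also have "\<dots> \<in> span (insert b (insert (\<i> *s b) ?W))"
          using c by (intro span_add span_scale span_base) auto
        finally show "z \<in> span (insert b (insert (\<i> *s b) ?W))" .
      qed
    qed
    have "dim (vec.span (insert b B)) = dim (insert b (insert (\<i> *s b) ?W))"
      unfolding eq by (rule dim_span)
    also have "\<dots> = dim ?W + 2"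
      unfolding dim_insert W(2) using b' ib by simp
    finally show ?case
      using insert by (simp add: vec.independent_insert)
  qed simp
  obtain B where B: "B \<subseteq> V" "vec.independent B" "V \<subseteq> vec.span B"
    using vec.basis_exists by metis
  then have "vec.span B = V"
    using V vec.span_minimal by blast
  then show ?thesis
    using *[of B] B(2) vec.finiteI_independent by blast
qed

section \<open>Holomorphic maps of complex tori\<close>

definition torus_lift ::
    "(complex^'m) set \<Rightarrow> (complex^'m \<Rightarrow> 'p) \<Rightarrow> ('p \<Rightarrow> 'p) \<Rightarrow> complex^'m \<Rightarrow> real \<Rightarrow> (complex^'m \<Rightarrow> complex^'m) \<Rightarrow> bool"
  where "torus_lift V P \<gamma> v e F \<longleftrightarrow>
    holomorphic_into F (ball v e) V V \<and> (\<forall>w\<in>ball v e \<inter> V. P (F w) = \<gamma> (P w))"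

context
  fixes V \<Lambda> :: "(complex^'m) set" and \<gamma>
  assumes T: "complex_torus V \<Lambda>"
    and hol: "holomorphic_map V (vclass V \<Lambda>) V (vclass V \<Lambda>) \<gamma>"
begin

lemma torus_subspace: "vec.subspace V" and torus_lattice: "is_lattice \<Lambda> V"
  using T by (auto simp: complex_torus_def)

lemma torus_lattice_zmodule: "zmodule \<Lambda>"
  using torus_lattice by (rule is_lattice_zmodule)

lemma torus_lattice_subset: "\<Lambda> \<subseteq> V"
  using torus_lattice by (rule is_lattice_subset)

abbreviation (input) lift where "lift \<equiv> torus_lift V (vclass V \<Lambda>) \<gamma>"

lemma lift_continuous:
  assumes "lift v e F" "w \<in> ball v e \<inter> V"
  shows "continuous (at w within V) F"
proof -
  obtain D where "(F has_derivative D) (at w within V)"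
    using assms unfolding torus_lift_def holomorphic_into_def by blast
  then show ?thesis
    by (rule has_derivative_continuous)
qed

text \<open>The difference of two lifts is continuous with values in the discrete group \<Lambda>,
  hence locally constant. In particular the derivative at a point does not depend on the
  lift.\<close>

lemma lifts_locally_parallel:
  assumes F: "lift v1 e1 F1" "w \<in> ball v1 e1 \<inter> V" and G: "lift v2 e2 F2" "w \<in> ball v2 e2 \<inter> V"
  obtains d where "d > 0" "\<And>y. y \<in> V \<Longrightarrow> dist y w < d \<Longrightarrow> F1 y - F2 y = F1 w - F2 w"
proof -
  obtain e where e: "e > 0" "\<And>l. l \<in> \<Lambda> \<Longrightarrow> norm l < e \<Longrightarrow> l = 0"
    using is_lattice_discrete[OF torus_lattice] by blast
  have in\<Lambda>: "F1 y - F2 y \<in> \<Lambda>" if "y \<in> ball v1 e1 \<inter> ball v2 e2 \<inter> V" for y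
    using that F(1) G(1) vclass_eq_iff[OF torus_lattice_zmodule, of V "F1 y" "F2 y"] by (auto simp: torus_lift_def)
  have "continuous (at w within V) (\<lambda>y. F1 y - F2 y)"
    using lift_continuous[OF F] lift_continuous[OF G] by (rule continuous_diff)
  then obtain d where d: "d > 0" "\<And>y. y \<in> V \<Longrightarrow> dist y w < d \<Longrightarrow> dist (F1 y - F2 y) (F1 w - F2 w) < e"
    unfolding continuous_within_eps_delta using e(1) by metis
  obtain r where r: "r > 0" "ball w r \<subseteq> ball v1 e1 \<inter> ball v2 e2"
    using F(2) G(2) by (meson IntD1 IntI open_Int open_ball open_contains_ball_eq)
  have *: "F1 y - F2 y = F1 w - F2 w" if y: "y \<in> V" "dist y w < min d r" for y
  proof -
    have "y \<in> ball v1 e1 \<inter> ball v2 e2 \<inter> V" "w \<in> ball v1 e1 \<inter> ball v2 e2 \<inter> V"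
      using y r F(2) G(2) by (auto simp: dist_commute)
    then have "(F1 y - F2 y) - (F1 w - F2 w) \<in> \<Lambda>"
      using in\<Lambda> zmoduleD(2)[OF torus_lattice_zmodule] by blast
    moreover have "norm ((F1 y - F2 y) - (F1 w - F2 w)) < e"
      using d(2)[of y] y by (simp add: dist_norm)
    ultimately have "(F1 y - F2 y) - (F1 w - F2 w) = 0"
      using e(2) by blast
    then show ?thesis
      by simp
  qed
  show ?thesis
    by (rule that[of "min d r"]) (use d(1) r(1) * in auto)
qed

text \<open>As \<gamma> is a map on classes, a lift near v also serves near v + l. This carries
  lifts from a compact set of representatives to all of V.\<close>

lemma lift_translate:
  assumes F: "lift v e F" and l: "l \<in> \<Lambda>"
  shows "lift (v + l) e (\<lambda>y. F (y - l))"
proof -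
  have lV: "l \<in> V"
    using l torus_lattice_subset by auto
  have mem: "y - l \<in> ball v e \<inter> V" if "y \<in> ball (v + l) e \<inter> V" for y
    using that lV torus_subspace by (auto simp: csubspaceD dist_norm algebra_simps)
  have cls: "vclass V \<Lambda> (y - l) = vclass V \<Lambda> y" for y
    using l zmoduleD(3)[OF torus_lattice_zmodule] by (simp add: vclass_eq_iff[OF torus_lattice_zmodule])
  have "\<exists>D. clinear D \<and> ((\<lambda>y. F (y - l)) has_derivative D) (at w within V)" if w: "w \<in> ball (v + l) e \<inter> V" for w
  proof -
    obtain D where D: "clinear D" "(F has_derivative D) (at (w - l) within V)"
      using mem[OF w] F unfolding torus_lift_def holomorphic_into_def by blast
    have "(\<lambda>y. y - l) ` V \<subseteq> V"
      using lV torus_subspace by (auto simp: csubspaceD)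
    then have "(F has_derivative D) (at (w - l) within (\<lambda>y. y - l) ` V)"
      using D(2) by (rule has_derivative_subset[rotated])
    moreover have "((\<lambda>y. y - l) has_derivative (\<lambda>h. h)) (at w within V)"
      by (auto intro!: derivative_eq_intros)
    ultimately have "((\<lambda>y. F (y - l)) has_derivative (\<lambda>h. D h)) (at w within V)"
      by (rule has_derivative_in_compose[rotated])
    then show ?thesis
      using D(1) by auto
  qed
  moreover have "(\<lambda>y. F (y - l)) ` (ball (v + l) e \<inter> V) \<subseteq> V"
    using mem F by (auto simp: torus_lift_def holomorphic_into_def)
  ultimately show ?thesis
    using mem F cls by (auto simp: torus_lift_def holomorphic_into_def)
qed

lemma lift_shrink:
  assumes "lift v e F" "ball w r \<subseteq> ball v e"
  shows "lift w r F"
proof -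
  have "ball w r \<inter> V \<subseteq> ball v e \<inter> V"
    using assms(2) by auto
  then show ?thesis
    using assms(1) unfolding torus_lift_def holomorphic_into_def by blast
qed

text \<open>A compact set meets every coset of \<Lambda>. Balls of half the radius of a bounded lift
  cover it, and finitely many suffice; the other half of the radius leaves room for a ball of common
  radius r about every point.\<close>

lemma uniform_lifts:
  obtains r M where "r > 0" "\<And>w. w \<in> V \<Longrightarrow> \<exists>F. lift w r F \<and> (\<forall>y\<in>ball w r \<inter> V. norm (F y) \<le> M)"
proof -
  have "\<exists>e>0. \<exists>F M. lift v e F \<and> (\<forall>y\<in>ball v e \<inter> V. norm (F y) \<le> M)" if v: "v \<in> V" for v
  proof -
    obtain e F where F: "e > 0" "lift v e F"
      using hol[unfolded holomorphic_map_def, rule_format, OF v] unfolding torus_lift_def by blast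
    have "continuous (at v within V) F"
      using lift_continuous[OF F(2)] F(1) v by simp
    then obtain d where d: "d > 0" "\<And>y. y \<in> V \<Longrightarrow> dist y v < d \<Longrightarrow> dist (F y) (F v) < 1"
      unfolding continuous_within_eps_delta by (metis zero_less_one)
    have "lift v (min d e) F"
      by (rule lift_shrink[OF F(2)]) auto
    moreover have "norm (F y) \<le> norm (F v) + 1" if "y \<in> ball v (min d e) \<inter> V" for y
    proof -
      have "dist (F y) (F v) < 1"
        using that d(2)[of y] by (auto simp: dist_commute)
      then show ?thesis
        using norm_triangle_sub[of "F y" "F v"] by (simp add: dist_norm)
    qed
    ultimately show ?thesis
      using d(1) F(1) by (intro exI[of _ "min d e"] conjI exI[of _ F] exI[of _ "norm (F v) + 1"]) auto
  qed
  then obtain e F M where eF: "\<And>v. v \<in> V \<Longrightarrow> e v > 0 \<and> lift v (e v) (F v) \<and> (\<forall>y\<in>ball v (e v) \<inter> V. norm (F v y) \<le> M v)"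
    by metis
  obtain R where R: "\<And>w. w \<in> V \<Longrightarrow> \<exists>l\<in>\<Lambda>. norm (w - l) \<le> R"
    using is_lattice_bounded_reps[OF torus_lattice] by blast
  let ?K = "V \<inter> cball 0 R"
  have cK: "compact ?K"
    using closed_subspace[OF csubspace_imp_subspace[OF torus_subspace]] by (simp add: closed_Int_compact)
  have cov: "?K \<subseteq> (\<Union>v\<in>?K. ball v (e v / 2))"
  proof
    fix v assume v: "v \<in> ?K"
    then have "v \<in> ball v (e v / 2)"
      using eF[of v] by simp
    with v show "v \<in> (\<Union>v\<in>?K. ball v (e v / 2))"
      by blast
  qed
  obtain C where C: "C \<subseteq> ?K" "finite C" "?K \<subseteq> (\<Union>v\<in>C. ball v (e v / 2))"
    by (rule compactE_image[OF cK _ cov]) auto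
  define r where "r = Min (insert 1 ((\<lambda>v. e v / 2) ` C))"
  define M' where "M' = Max (insert 0 (M ` C))"
  have rC: "r \<le> e v / 2" "M v \<le> M'" if "v \<in> C" for v
    unfolding r_def M'_def using that C(2) by (intro Min_le Max_ge; simp)+
  have "r > 0"
    using C(1,2) eF by (auto simp: r_def)
  moreover have "\<exists>F. lift w r F \<and> (\<forall>y\<in>ball w r \<inter> V. norm (F y) \<le> M')" if w: "w \<in> V" for w
  proof -
    obtain l where l: "l \<in> \<Lambda>" "norm (w - l) \<le> R"
      using R[OF w] by auto
    have lV: "l \<in> V"
      using l(1) torus_lattice_subset by auto
    then have "w - l \<in> ?K"
      using l(2) w torus_subspace by (auto simp: csubspaceD)
    then obtain v where v: "v \<in> C" "dist v (w - l) < e v / 2"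
      using C(3) by auto
    have vV: "v \<in> V"
      using v(1) C(1) by auto
    have "ball w r \<subseteq> ball (v + l) (e v)"
    proof
      fix y assume "y \<in> ball w r"
      then have "dist w y < e v / 2"
        using rC(1)[OF v(1)] by simp
      moreover have "dist (v + l) w = dist v (w - l)"
        by (simp add: dist_norm algebra_simps)
      ultimately show "y \<in> ball (v + l) (e v)"
        using v(2) dist_triangle[of "v + l" y w] by simp
    qed
    then have "lift w r (\<lambda>y. F v (y - l))"
      using lift_shrink[OF lift_translate[OF _ l(1)]] eF[OF vV] by blast
    moreover have "norm (F v (y - l)) \<le> M'" if "y \<in> ball w r \<inter> V" for y
    proof -
      have "y - l \<in> ball v (e v) \<inter> V"
        using that \<open>ball w r \<subseteq> ball (v + l) (e v)\<close> lV torus_subspace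
        by (auto simp: csubspaceD dist_norm algebra_simps dest!: subsetD)
      then show ?thesis
        using eF[OF vV] rC(2)[OF v(1)] order_trans by blast
    qed
    ultimately show ?thesis
      by blast
  qed
  ultimately show ?thesis
    using that by blast
qed

text \<open>The derivatives of the local lifts do not depend on the lift and are bounded by Cauchy's
  estimate, as finitely many lifts suffice up to translations. So they are constant along complex
  lines by Liouville's theorem. No global lift is needed.\<close>

lemma torus_map_affine:
  obtains \<alpha> c where "clinear \<alpha>" "\<alpha> ` V \<subseteq> V" "c \<in> V"
    "\<And>v. v \<in> V \<Longrightarrow> \<gamma> (vclass V \<Lambda> v) = vclass V \<Lambda> (\<alpha> v + c)"
proof -
  obtain r M where r: "r > 0"
    and "\<And>w. w \<in> V \<Longrightarrow> \<exists>F. lift w r F \<and> (\<forall>y\<in>ball w r \<inter> V. norm (F y) \<le> M)"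
    using uniform_lifts by blast
  then obtain F where F: "\<And>w. w \<in> V \<Longrightarrow> lift w r (F w)" "\<And>w y. w \<in> V \<Longrightarrow> y \<in> ball w r \<inter> V \<Longrightarrow> norm (F w y) \<le> M"
    by metis
  have "\<exists>D. clinear D \<and> (F w has_derivative D) (at w within V)" if "w \<in> V" for w
    using F(1)[OF that] r that by (auto simp: torus_lift_def holomorphic_into_def)
  then obtain D where D: "\<And>w. w \<in> V \<Longrightarrow> clinear (D w)" "\<And>w. w \<in> V \<Longrightarrow> (F w has_derivative D w) (at w within V)"
    by metis
  \<comment> \<open>The lifts about v and about w are parallel near w, so D w is the derivative of
    both at w.\<close>
  have der: "(F v has_derivative D w) (at w within V)" if v: "v \<in> V" and w: "w \<in> ball v r \<inter> V" for v w
  proof -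
    obtain d where d: "d > 0" "\<And>y. y \<in> V \<Longrightarrow> dist y w < d \<Longrightarrow> F v y - F w y = F v w - F w w"
      using lifts_locally_parallel[OF F(1)[OF v] w F(1)[of w]] w r by auto
    have "((\<lambda>y. F w y + (F v w - F w w)) has_derivative D w) (at w within V)"
      using D(2)[of w] w by (auto intro!: derivative_eq_intros)
    then show ?thesis
    proof (rule has_derivative_transform_within[OF _ d(1)])
      show "w \<in> V"
        using w by simp
      show "F w y + (F v w - F w w) = F v y" if "y \<in> V" "dist y w < d" for y
        using d(2)[OF that] by (simp add: algebra_simps)
    qed
  qed
  have mem: "c *s u \<in> V" if "u \<in> V" for c u
    using that torus_subspace by (simp add: csubspaceD)
  have line: "((\<lambda>s. F (t *s u) (s *s u) $ i) has_field_derivative (D (s *s u) u $ i)) (at s)"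
    if u: "u \<in> V" and s: "cmod (s - t) * norm u < r" for s t u i
  proof -
    have dist: "dist (t *s u) (s *s u) < r"
      using s by (simp add: dist_cscale)
    have "(F (t *s u) has_derivative D (s *s u)) (at (s *s u) within V)"
      using dist mem[OF u] by (intro der) auto
    then have "(F (t *s u) has_derivative D (s *s u)) (at (s *s u) within (\<lambda>s. s *s u) ` UNIV)"
      by (rule has_derivative_subset) (use mem[OF u] in auto)
    moreover have "((\<lambda>s. s *s u) has_derivative (\<lambda>h. h *s u)) (at s)"
    proof -
      have "linear (\<lambda>h. h *s u)"
        by (intro linearI) (simp_all add: vec_eq_iff algebra_simps)
      then show ?thesis
        by (simp add: linear_linear bounded_linear_imp_has_derivative)
    qed
    ultimately have "((\<lambda>s. F (t *s u) (s *s u)) has_derivative (\<lambda>h. D (s *s u) (h *s u))) (at s)"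
      using has_derivative_in_compose[of "\<lambda>s. s *s u" "\<lambda>h. h *s u" s UNIV "F (t *s u)" "D (s *s u)"] by simp
    then have "((\<lambda>s. F (t *s u) (s *s u) $ i) has_derivative (\<lambda>h. D (s *s u) (h *s u) $ i)) (at s)"
      by (rule bounded_linear.has_derivative[OF bounded_linear_vec_nth])
    moreover have "(\<lambda>h. D (s *s u) (h *s u) $ i) = (*) (D (s *s u) u $ i)"
      using D(1)[OF mem[OF u]] by (auto simp: clinearD)
    ultimately show ?thesis
      by (simp add: has_field_derivative_def)
  qed
  have const: "D (t *s u) u = D 0 u" if u: "u \<in> V" for u t
  proof -
    have "D (t *s u) u $ i = D 0 u $ i" for i
    proof -
      define G where "G = (\<lambda>t. D (t *s u) u $ i)"
      \<comment> \<open>A parameter disc of radius q about t is mapped into the ball of radius r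
        about t u; the added 1 covers u = 0.\<close>
      define q where "q = r / (2 * (norm u + 1))"
      have q: "q > 0"
        unfolding q_def using r by (intro divide_pos_pos mult_pos_pos add_nonneg_pos) auto
      have qs: "cmod (s - t) * norm u < r" if "cmod (s - t) \<le> q" for s t
      proof -
        have "cmod (s - t) * norm u \<le> q * norm u"
          using that by (intro mult_right_mono) auto
        also have "\<dots> < q * (2 * (norm u + 1))"
          using q by (intro mult_strict_left_mono) (smt (verit) norm_ge_zero)+
        also have "\<dots> = r"
          using norm_ge_zero[of u] by (simp add: q_def) (smt (verit) norm_ge_zero)
        finally show ?thesis .
      qed
      have H: "((\<lambda>s. F (t *s u) (s *s u) $ i) has_field_derivative G s) (at s)" if "cmod (s - t) \<le> q" for s t
        unfolding G_def using line[OF u qs[OF that]] .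
      have Hhol: "(\<lambda>s. F (t *s u) (s *s u) $ i) holomorphic_on ball t q" for t
        by (rule holomorphic_onI) (metis H at_within_open dist_commute dist_norm field_differentiable_def
            less_imp_le mem_ball open_ball)
      have Gderiv: "G s = deriv (\<lambda>s. F (t *s u) (s *s u) $ i) s" if "s \<in> ball t q" for s t
        using H[of s t] that by (auto simp: DERIV_imp_deriv dist_norm norm_minus_commute less_imp_le)
      have "G holomorphic_on ball t q" for t
        by (rule holomorphic_transform[OF holomorphic_deriv[OF Hhol[of t] open_ball]]) (simp add: Gderiv)
      then have "G holomorphic_on UNIV"
        unfolding holomorphic_on_open[OF open_UNIV] holomorphic_on_open[OF open_ball]
        using q centre_in_ball by blast
      moreover have "bounded (range G)"
      proof -
        have "cmod (G t) \<le> M / q" for t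
        proof -
          \<comment> \<open>Cauchy's estimate; as q and M do not depend on t, it bounds G on the
            whole plane.\<close>
          have "cmod ((deriv ^^ 1) (\<lambda>s. F (t *s u) (s *s u) $ i) t) \<le> fact 1 * M / q ^ 1"
          proof (rule Cauchy_inequality[OF Hhol _ q])
            show "continuous_on (cball t q) (\<lambda>s. F (t *s u) (s *s u) $ i)"
              by (rule continuous_at_imp_continuous_on)
                (metis H DERIV_isCont dist_commute dist_norm mem_cball)
            fix s assume "cmod (t - s) = q"
            then have "cmod (s - t) * norm u < r"
              using qs[of s t] by (simp add: norm_minus_commute)
            then have "norm (F (t *s u) (s *s u)) \<le> M"
              using mem[OF u] by (intro F(2)) (auto simp: dist_cscale)
            then show "cmod (F (t *s u) (s *s u) $ i) \<le> M"
              by (rule order_trans[OF Finite_Cartesian_Product.norm_nth_le])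
          qed
          then show ?thesis
            using Gderiv[of t t] q by simp
        qed
        then show ?thesis
          by (auto simp: bounded_iff)
      qed
      ultimately have "G constant_on UNIV"
        by (rule Liouville_theorem)
      then have "G t = G 0"
        unfolding constant_on_def by (metis UNIV_I)
      then show ?thesis
        by (simp add: G_def)
    qed
    then show ?thesis
      by (simp add: vec_eq_iff)
  qed
  define \<alpha> where "\<alpha> = D 0"
  define c where "c = F 0 0"
  have V0: "0 \<in> V"
    using torus_subspace by (rule csubspaceD)
  have \<alpha>: "clinear \<alpha>"
    unfolding \<alpha>_def using V0 by (rule D(1))
  have FV: "F w y \<in> V" if "w \<in> V" "y \<in> ball w r \<inter> V" for w y
    using F(1)[OF that(1)] that(2) by (auto simp: torus_lift_def holomorphic_into_def)
  have cV: "c \<in> V"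
    unfolding c_def using V0 r by (intro FV) auto
  have affine: "F (complex_of_real t *s u) (complex_of_real s *s u) - s *\<^sub>R \<alpha> u
      = F (complex_of_real t *s u) (complex_of_real t *s u) - t *\<^sub>R \<alpha> u"
    if u: "u \<in> V" and st: "\<bar>s - t\<bar> * norm u < r" for s t u
  proof -
    \<comment> \<open>Along the real segment the lift and s \<alpha> u have the same derivative, so
      this difference is constant.\<close>
    let ?f = "\<lambda>s. F (complex_of_real t *s u) (complex_of_real s *s u) - s *\<^sub>R \<alpha> u"
    let ?I = "closed_segment t s"
    have "((\<lambda>s. ?f s $ i) has_derivative (\<lambda>h. 0)) (at s' within ?I)" if s': "s' \<in> ?I" for s' i
    proof -
      have "\<bar>s' - t\<bar> \<le> \<bar>s - t\<bar>"
        using s' by (auto simp: closed_segment_eq_real_ivl split: if_splits)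
      then have "\<bar>s' - t\<bar> * norm u \<le> \<bar>s - t\<bar> * norm u"
        by (intro mult_right_mono) auto
      then have lt: "cmod (of_real s' - of_real t) * norm u < r"
        using st by (simp flip: of_real_diff)
      have "((\<lambda>s. F (complex_of_real t *s u) (s *s u) $ i) has_field_derivative \<alpha> u $ i) (at (of_real s'))"
        using line[OF u lt, of i] const[OF u] by (simp add: \<alpha>_def)
      then have "((\<lambda>s. F (complex_of_real t *s u) (complex_of_real s *s u) $ i) has_vector_derivative \<alpha> u $ i) (at s')"
        by (rule has_vector_derivative_real_field)
      moreover have "((\<lambda>s. (s *\<^sub>R \<alpha> u) $ i) has_vector_derivative \<alpha> u $ i) (at s')"
        by (auto intro!: derivative_eq_intros simp: has_vector_derivative_def)
      ultimately have "((\<lambda>s. ?f s $ i) has_vector_derivative \<alpha> u $ i - \<alpha> u $ i) (at s')"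
        unfolding vector_minus_component by (rule has_vector_derivative_diff)
      then show ?thesis
        by (simp add: has_vector_derivative_def has_derivative_at_withinI)
    qed
    then have "?f s $ i = ?f t $ i" for i
      by (intro has_derivative_zero_unique[OF convex_closed_segment, of t s "\<lambda>s. ?f s $ i"]) auto
    then show ?thesis
      by (simp add: vec_eq_iff)
  qed
  have \<alpha>V: "\<alpha> u \<in> V" if u: "u \<in> V" for u
  proof -
    \<comment> \<open>\<alpha> is known only as a derivative. A small multiple of \<alpha> u is
      recovered as the difference of two values of the lift \<open>F 0\<close>, and these lie in
      V.\<close>
    define s where "s = r / (2 * (norm u + 1))"
    have s: "s > 0"
      unfolding s_def using r by (intro divide_pos_pos mult_pos_pos add_nonneg_pos) auto
    have "s * norm u < s * (2 * (norm u + 1))"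
      using s by (intro mult_strict_left_mono) (smt (verit) norm_ge_zero)+
    also have "\<dots> = r"
      by (simp add: s_def) (smt (verit) norm_ge_zero)
    finally have sr: "s * norm u < r" .
    have "F 0 (complex_of_real s *s u) - s *\<^sub>R \<alpha> u = c"
      using affine[OF u, of s 0] s sr by (simp add: c_def)
    then have eq: "s *\<^sub>R \<alpha> u = F 0 (complex_of_real s *s u) - c"
      by (simp add: algebra_simps)
    have "norm (complex_of_real s *s u) < r"
      using s sr by (simp flip: scaleR_vec_complex)
    then have "F 0 (complex_of_real s *s u) \<in> V"
      using V0 mem[OF u] by (intro FV) auto
    then have "s *\<^sub>R \<alpha> u \<in> V"
      unfolding eq using cV torus_subspace by (simp add: csubspaceD)
    then have "(1 / s) *\<^sub>R (s *\<^sub>R \<alpha> u) \<in> V"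
      by (rule subspace_scale[OF csubspace_imp_subspace[OF torus_subspace]])
    moreover have "(1 / s) *\<^sub>R (s *\<^sub>R \<alpha> u) = \<alpha> u"
      using s by simp
    ultimately show ?thesis
      by simp
  qed
  have "\<gamma> (vclass V \<Lambda> u) = vclass V \<Lambda> (\<alpha> u + c)" if u: "u \<in> V" for u
  proof -
    define P where "P s \<longleftrightarrow> \<gamma> (vclass V \<Lambda> (complex_of_real s *s u)) = vclass V \<Lambda> (s *\<^sub>R \<alpha> u + c)" for s
    have step: "P s" if "P t" "\<bar>s - t\<bar> * norm u < r" for s t
    proof -
      let ?F = "F (complex_of_real t *s u)"
      have near: "dist (complex_of_real t *s u) (complex_of_real s *s u) < r"
        using that(2) by (simp add: dist_cscale flip: of_real_diff)
      have L: "vclass V \<Lambda> (?F y) = \<gamma> (vclass V \<Lambda> y)" if "y \<in> ball (complex_of_real t *s u) r \<inter> V" for y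
        using F(1)[OF mem[OF u]] that by (auto simp: torus_lift_def)
      have "vclass V \<Lambda> (?F (complex_of_real t *s u)) = vclass V \<Lambda> (t *\<^sub>R \<alpha> u + c)"
        using L[of "complex_of_real t *s u"] \<open>P t\<close> r mem[OF u] by (simp add: P_def)
      then have "?F (complex_of_real t *s u) - (t *\<^sub>R \<alpha> u + c) \<in> \<Lambda>"
        by (simp add: vclass_eq_iff[OF torus_lattice_zmodule])
      moreover have "?F (complex_of_real t *s u) - (t *\<^sub>R \<alpha> u + c) = ?F (complex_of_real s *s u) - (s *\<^sub>R \<alpha> u + c)"
        using affine[OF u that(2)] by (simp add: algebra_simps)
      ultimately have "vclass V \<Lambda> (?F (complex_of_real s *s u)) = vclass V \<Lambda> (s *\<^sub>R \<alpha> u + c)"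
        by (simp add: vclass_eq_iff[OF torus_lattice_zmodule])
      then show ?thesis
        using L[of "complex_of_real s *s u"] near mem[OF u] by (simp add: P_def)
    qed
    have P0: "P 0"
      using F(1)[OF V0] V0 r by (simp add: P_def c_def torus_lift_def)
    \<comment> \<open>The formula is carried from 0 to u in N steps, each shorter than the radius r
      on which a lift is defined.\<close>
    obtain N :: nat where N: "norm u / r < of_nat N"
      using reals_Archimedean2 by blast
    have N0: "N > 0"
      using N r by (metis divide_nonneg_pos norm_ge_zero not_less of_nat_0 gr0I)
    have "P (of_nat k / of_nat N)" for k
    proof (induction k)
      case (Suc k)
      have "of_nat (Suc k) / of_nat N - of_nat k / of_nat N = (1 / of_nat N :: real)"
        by (simp add: diff_divide_distrib[symmetric])
      then have "\<bar>of_nat (Suc k) / of_nat N - of_nat k / of_nat N\<bar> * norm u = norm u / of_nat N"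
        by simp
      also have "\<dots> < r"
        using N N0 r by (simp add: field_simps)
      finally show ?case
        using step[OF Suc] by blast
    qed (use P0 in simp)
    from this[of N] have "P 1"
      using N0 by simp
    then show ?thesis
      by (simp add: P_def)
  qed
  then show ?thesis
    using that[of \<alpha> c] \<alpha> \<alpha>V cV by blast
qed

end

section \<open>Biholomorphic maps induced by affine maps\<close>

lemma has_derivative_affine:
  assumes "clinear A"
  shows "((\<lambda>v. A v + a) has_derivative A) F"
proof -
  have "bounded_linear A"
    using assms clinear_imp_linear linear_linear by blast
  then show ?thesis
    using bounded_linear_imp_has_derivative by (auto intro!: derivative_eq_intros)
qed

lemma holomorphic_map_affine:
  assumes "clinear A" "\<And>v. v \<in> V \<Longrightarrow> A v + a \<in> V'" "\<And>v. v \<in> V \<Longrightarrow> P' (A v + a) = f (P v)"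
  shows "holomorphic_map V P V' P' f"
  unfolding holomorphic_map_def holomorphic_into_def
proof (intro ballI exI conjI)
  show "(1::real) > 0"
    by simp
  show "(\<lambda>v. A v + a) ` (ball v 1 \<inter> V) \<subseteq> V'" for v
    using assms(2) by auto
  show "((\<lambda>v. A v + a) has_derivative A) (at w within V)" for w
    using assms(1) by (rule has_derivative_affine)
qed (use assms in auto)

lemma t_points_conv_image: "t_points n X = t_proj n X ` t_space X"
  by (auto simp: t_points_def t_proj_def orbits_def carrier_vquot)

text \<open>The inverse of the induced map on orbits is given only by \<open>inv_into\<close>; it is
  identified with the map induced by the inverse affine map, which is then a global lift of
  it.\<close>

lemma biholomorphic_affine:
  assumes A: "clinear A" "clinear A'"
    and maps: "\<And>v. v \<in> t_space X \<Longrightarrow> A v + a \<in> t_space Y" "\<And>v. v \<in> t_space Y \<Longrightarrow> A' v + a' \<in> t_space X"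
    and inverse: "\<And>v. v \<in> t_space X \<Longrightarrow> A' (A v + a) + a' = v" "\<And>v. v \<in> t_space Y \<Longrightarrow> A (A' v + a') + a = v"
    and proj: "\<And>u v. u \<in> t_space X \<Longrightarrow> v \<in> t_space X \<Longrightarrow>
      t_proj n Y (A u + a) = t_proj n Y (A v + a) \<longleftrightarrow> t_proj n X u = t_proj n X v"
  shows "biholomorphic n X Y"
proof -
  define f where "f p = t_proj n Y (A (SOME v. v \<in> t_space X \<and> t_proj n X v = p) + a)" for p
  have f: "f (t_proj n X v) = t_proj n Y (A v + a)" if v: "v \<in> t_space X" for v
  proof -
    let ?u = "SOME u. u \<in> t_space X \<and> t_proj n X u = t_proj n X v"
    have "?u \<in> t_space X \<and> t_proj n X ?u = t_proj n X v"
      by (rule someI[of _ v]) (simp add: v)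
    then show ?thesis
      using proj[of ?u v] v by (simp add: f_def)
  qed
  have bij: "bij_betw f (t_points n X) (t_points n Y)"
    unfolding bij_betw_def
  proof
    show "inj_on f (t_points n X)"
      by (rule inj_onI) (auto simp: t_points_conv_image f proj)
    show "f ` t_points n X = t_points n Y"
    proof (intro subset_antisym subsetI)
      fix p assume "p \<in> t_points n Y"
      then obtain v where "v \<in> t_space Y" "p = t_proj n Y v"
        by (auto simp: t_points_conv_image)
      then have "p = f (t_proj n X (A' v + a'))" "A' v + a' \<in> t_space X"
        using maps inverse by (auto simp: f)
      then show "p \<in> f ` t_points n X"
        by (auto simp: t_points_conv_image)
    qed (auto simp: t_points_conv_image f maps)
  qed
  have inv: "inv_into (t_points n X) f (t_proj n Y v) = t_proj n X (A' v + a')" if v: "v \<in> t_space Y" for v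
  proof -
    have "t_proj n Y v = f (t_proj n X (A' v + a'))" "A' v + a' \<in> t_space X"
      using v maps inverse by (auto simp: f)
    then show ?thesis
      using bij by (simp add: t_points_conv_image bij_betw_def inv_into_f_f)
  qed
  show ?thesis
    unfolding biholomorphic_def
    by (intro exI[of _ f] conjI bij holomorphic_map_affine[OF A(1)] holomorphic_map_affine[OF A(2)])
      (use maps in \<open>auto simp: f inv\<close>)
qed

section \<open>The modules and the group they define\<close>

locale datum_lattices =
  fixes n :: nat and L :: "nat \<Rightarrow> (real^'k) set" and x :: "real^'k \<Rightarrow> real^'k"
  assumes n_pos: "n > 0" and modules: "datum_modules n L x"
begin

abbreviation W where "W \<equiv> real_sum n L"
abbreviation M where "M \<equiv> lat_sum n L"

lemma finite_divisors: "finite (divisors n)"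
  using n_pos by simp

lemma one_divisor: "1 \<in> divisors n"
  by (simp add: divisors_def)

lemma linear_x: "linear x"
  using modules by (simp add: datum_modules_def)

lemma lattice_L: "d \<in> divisors n \<Longrightarrow> is_lattice (L d) (span (L d))"
  using modules by (simp add: datum_modules_def)

lemma zmodule_L: "d \<in> divisors n \<Longrightarrow> zmodule (L d)"
  using lattice_L by (rule is_lattice_zmodule)

lemma x_L: "d \<in> divisors n \<Longrightarrow> x ` L d \<subseteq> L d"
  using modules by (simp add: datum_modules_def fg_torsion_free_module_def)

lemma cyclotomic_L: "d \<in> divisors n \<Longrightarrow> v \<in> span (L d) \<Longrightarrow> poly_act (cyclotomic d) x v = 0"
proof -
  assume "d \<in> divisors n" and v: "v \<in> span (L d)"
  then have "\<forall>u\<in>L d. poly_act (cyclotomic d) x u = 0"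
    using modules by (simp add: datum_modules_def fg_torsion_free_module_def)
  then show ?thesis
    using linear_eq_0_on_span[OF linear_poly_act[OF linear_x] _ v] by blast
qed

lemma x_span: "d \<in> divisors n \<Longrightarrow> x ` span (L d) \<subseteq> span (L d)"
  using span_mono[OF x_L] linear_span_image[OF linear_x] by metis

lemma subspace_W: "subspace W"
  unfolding real_sum_def by (rule subspace_sum_of) (rule subspace_span)

lemma zmodule_W: "zmodule W"
  using subspace_W by (rule zmodule_subspace)

lemma span_L_subset: "d \<in> divisors n \<Longrightarrow> span (L d) \<subseteq> W"
  unfolding real_sum_def using finite_divisors by (auto intro: sum_of_component simp: span_zero)

lemma L_subset_M: "d \<in> divisors n \<Longrightarrow> L d \<subseteq> M"
  unfolding lat_sum_def using finite_divisors zmoduleD(1)[OF zmodule_L] by (auto intro: sum_of_component)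

lemma zmodule_M: "zmodule M"
  unfolding lat_sum_def by (rule zmodule_sum_of) (rule zmodule_L)

lemma M_subset_W: "M \<subseteq> W"
  unfolding lat_sum_def real_sum_def by (rule sum_of_mono) (rule span_superset)

text \<open>A polynomial in x, hence linear on the whole space and commuting with x, with
  denominator n. On W it is the projection to the summand of index d.\<close>

definition comp :: "nat \<Rightarrow> real^'k \<Rightarrow> real^'k" where
  "comp d w = (1 / of_nat n) *\<^sub>R poly_act (proj_poly n d) x w"

lemma linear_comp: "linear (comp d)"
  unfolding comp_def [abs_def] by (intro linear_compose_scale_right linear_poly_act linear_x)

lemma comp_sum:
  assumes "d \<in> divisors n" "\<And>e. e \<in> divisors n \<Longrightarrow> u e \<in> span (L e)"
  shows "comp d (\<Sum>e\<in>divisors n. u e) = u d"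
  using proj_poly_act_sum[OF linear_x n_pos assms(1), of u] assms(2) cyclotomic_L n_pos
  by (simp add: comp_def)

lemma W_cases:
  assumes "w \<in> W"
  shows "w = (\<Sum>d\<in>divisors n. comp d w)" "d \<in> divisors n \<Longrightarrow> comp d w \<in> span (L d)"
proof -
  obtain u where u: "w = (\<Sum>e\<in>divisors n. u e)" "\<And>e. e \<in> divisors n \<Longrightarrow> u e \<in> span (L e)"
    using assms unfolding real_sum_def sum_of_def by blast
  then have "comp d w = u d" if "d \<in> divisors n" for d
    using comp_sum that by simp
  then show "w = (\<Sum>d\<in>divisors n. comp d w)" "d \<in> divisors n \<Longrightarrow> comp d w \<in> span (L d)"
    using u by simp_all
qed

lemma comp_component:
  assumes "d \<in> divisors n" "e \<in> divisors n" "w \<in> span (L e)"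
  shows "comp d w = (if d = e then w else 0)"
proof -
  have "w = (\<Sum>i\<in>divisors n. if i = e then w else 0)"
    using assms(2) finite_divisors by simp
  then show ?thesis
    using comp_sum[OF assms(1), of "\<lambda>i. if i = e then w else 0"] assms(3) by (simp add: span_zero)
qed

lemma comp_M: "d \<in> divisors n \<Longrightarrow> w \<in> M \<Longrightarrow> comp d w \<in> L d"
proof -
  assume d: "d \<in> divisors n" and "w \<in> M"
  then obtain u where u: "w = (\<Sum>e\<in>divisors n. u e)" "\<And>e. e \<in> divisors n \<Longrightarrow> u e \<in> L e"
    unfolding lat_sum_def sum_of_def by blast
  then show "comp d w \<in> L d"
    using comp_sum[OF d, of u] d by (simp add: span_base)
qed

text \<open>In other words, A_d, the quotient of span (L d) by L d, embeds into A'.\<close>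

lemma M_Int_span: "d \<in> divisors n \<Longrightarrow> w \<in> span (L d) \<Longrightarrow> w \<in> M \<longleftrightarrow> w \<in> L d"
  using comp_M[of d w] comp_component[of d d w] L_subset_M by auto

lemma x_W: "w \<in> W \<Longrightarrow> x w \<in> W"
proof -
  assume "w \<in> W"
  then obtain u where u: "w = (\<Sum>e\<in>divisors n. u e)" "\<And>e. e \<in> divisors n \<Longrightarrow> u e \<in> span (L e)"
    unfolding real_sum_def sum_of_def by blast
  have "x w = (\<Sum>e\<in>divisors n. x (u e))"
    by (simp add: u(1) linear_sum[OF linear_x])
  then show "x w \<in> W"
    unfolding real_sum_def by (rule sum_ofI) (use u(2) x_span in blast)
qed

lemma x_power_n: "w \<in> W \<Longrightarrow> (x ^^ n) w = w"
proof -
  assume w: "w \<in> W"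
  have "(x ^^ n) (comp d w) = comp d w" if "d \<in> divisors n" for d
    using cyclotomic_kernel_periodic[OF linear_x n_pos that cyclotomic_L[OF that W_cases(2)[OF w that]]] .
  then have "(x ^^ n) (\<Sum>d\<in>divisors n. comp d w) = (\<Sum>d\<in>divisors n. comp d w)"
    by (simp add: linear_sum[OF linear_funpow[OF linear_x]])
  then show ?thesis
    using W_cases(1)[OF w] by simp
qed

lemma mem_span_L_iff:
  assumes "d \<in> divisors n"
  shows "w \<in> span (L d) \<longleftrightarrow> w \<in> W \<and> poly_act (cyclotomic d) x w = 0"
proof
  assume w: "w \<in> W \<and> poly_act (cyclotomic d) x w = 0"
  then have "comp d w = w"
    using proj_poly_act_same[OF linear_x n_pos assms, of w] n_pos by (simp add: comp_def)
  then show "w \<in> span (L d)"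
    using W_cases(2)[of w d] w assms by simp
qed (use span_L_subset cyclotomic_L assms in auto)

lemma span_L_independent:
  assumes "\<And>d. d \<in> divisors n \<Longrightarrow> u d \<in> span (L d)" "(\<Sum>d\<in>divisors n. u d) = 0" "d \<in> divisors n"
  shows "u d = 0"
  using comp_sum[of d u] assms linear_0[OF linear_comp] by simp

lemma lattice_M: "is_lattice M W"
  unfolding lat_sum_def real_sum_def
  by (rule is_lattice_sum_of[OF finite_divisors lattice_L]) (use span_L_independent in auto)

text \<open>The decomposition is unique, so the choice made in \<open>proj_comp\<close> returns the
  polynomial projection.\<close>

lemma proj_comp_eq:
  assumes "w \<in> W" "d \<in> divisors n"
  shows "proj_comp (divisors n) (\<lambda>d. span (L d)) d w = comp d w"
proof -
  let ?P = "\<lambda>u. (\<forall>e\<in>divisors n. u e \<in> span (L e)) \<and> w = (\<Sum>e\<in>divisors n. u e)"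
  have "?P (\<lambda>d. comp d w)"
    using W_cases[OF assms(1)] by auto
  then have "?P (SOME u. ?P u)"
    by (rule someI[of ?P])
  then have u: "\<And>e. e \<in> divisors n \<Longrightarrow> (SOME u. ?P u) e \<in> span (L e)"
      and w: "w = (\<Sum>e\<in>divisors n. (SOME u. ?P u) e)"
    by blast+
  have "comp d w = (SOME u. ?P u) d"
    by (subst (1) w) (rule comp_sum[OF assms(2) u])
  then show ?thesis
    by (simp add: proj_comp_def)
qed

lemma cls_eq_iff: "cls n L u = cls n L v \<longleftrightarrow> u - v \<in> M"
  unfolding cls_def by (rule vclass_eq_iff[OF zmodule_M])

lemma cls_eq_M_iff: "cls n L u = M \<longleftrightarrow> u \<in> M"
  unfolding cls_def by (rule vclass_eq_one_iff[OF zmodule_M])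

lemma one_A_prime: "\<one>\<^bsub>A_prime n L\<^esub> = M"
  by (simp add: A_prime_def)

lemma cond_B_iff:
  "cond_B n L S \<longleftrightarrow> M \<in> S \<and> (\<forall>d\<in>divisors n. \<forall>w\<in>span (L d). cls n L w \<in> S \<longrightarrow> w \<in> L d)"
proof -
  have MA: "M \<in> A_sub n L d" for d
    unfolding A_sub_def using cls_eq_M_iff[of 0] zmoduleD(1)[OF zmodule_M] span_zero by (metis imageI)
  show ?thesis
  proof
    assume B: "cond_B n L S"
    have "w \<in> L d" if d: "d \<in> divisors n" and w: "w \<in> span (L d)" "cls n L w \<in> S" for d w
    proof -
      have "cls n L w \<in> S \<inter> A_sub n L d"
        using w by (auto simp: A_sub_def)
      then have "cls n L w = M"
        using B d by (auto simp: cond_B_def one_A_prime)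
      then show ?thesis
        using w(1) d by (simp add: cls_eq_M_iff M_Int_span)
    qed
    moreover have "M \<in> S"
      using B one_divisor by (auto simp: cond_B_def one_A_prime)
    ultimately show "M \<in> S \<and> (\<forall>d\<in>divisors n. \<forall>w\<in>span (L d). cls n L w \<in> S \<longrightarrow> w \<in> L d)"
      by blast
  next
    assume *: "M \<in> S \<and> (\<forall>d\<in>divisors n. \<forall>w\<in>span (L d). cls n L w \<in> S \<longrightarrow> w \<in> L d)"
    have "a = M" if d: "d \<in> divisors n" and a: "a \<in> S" "a \<in> A_sub n L d" for d a
    proof -
      obtain w where w: "w \<in> span (L d)" "a = cls n L w"
        using a(2) by (auto simp: A_sub_def)
      then have "w \<in> M"
        using * d a(1) by (simp add: M_Int_span)
      then show ?thesis
        using w(2) cls_eq_M_iff by simp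
    qed
    then show "cond_B n L S"
      unfolding cond_B_def one_A_prime using * MA by blast
  qed
qed

text \<open>On the kernel of Phi_d, multiplication by n is x Phi_d' Q_n / Phi_d, and the factor Q_n
  / Phi_d already maps v into L d. That these quotients are killed by n is what makes their sum
  finite.\<close>

lemma Phi_over_Q_scale:
  assumes "d \<in> divisors n" "v \<in> Phi_over_Q n L x d"
  shows "of_nat n *\<^sub>R v \<in> L d"
proof -
  have v: "v \<in> span (L d)" "poly_act (Qpoly n div cyclotomic d) x v \<in> L d"
    using assms(2) by (auto simp: Phi_over_Q_def)
  have "of_nat n *\<^sub>R v = poly_act (proj_poly n d) x v"
    using proj_poly_act_same[OF linear_x n_pos assms(1) cyclotomic_L[OF assms(1) v(1)]] by simp
  also have "\<dots> = poly_act (monom 1 1 * pderiv (cyclotomic d)) x (poly_act (Qpoly n div cyclotomic d) x v)"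
    by (simp add: proj_poly_def poly_act_mult[OF linear_x])
  also have "\<dots> \<in> L d"
    by (rule zmodule_poly_act[OF zmodule_L[OF assms(1)] x_L[OF assms(1)] v(2)])
  finally show ?thesis .
qed

lemma sum_Phi_over_Q_scale:
  assumes "w \<in> sum_of (divisors n) (Phi_over_Q n L x)"
  shows "of_nat n *\<^sub>R w \<in> M"
proof -
  obtain u where u: "w = (\<Sum>d\<in>divisors n. u d)" "\<And>d. d \<in> divisors n \<Longrightarrow> u d \<in> Phi_over_Q n L x d"
    using assms unfolding sum_of_def by blast
  have "of_nat n *\<^sub>R w = (\<Sum>d\<in>divisors n. of_nat n *\<^sub>R u d)"
    by (simp add: u(1) scaleR_sum_right)
  then show ?thesis
    unfolding lat_sum_def by (rule sum_ofI) (use u(2) Phi_over_Q_scale in auto)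
qed

lemma finite_torsion: "finite (cls n L ` {w. of_nat n *\<^sub>R w \<in> M})"
  unfolding cls_def by (rule finite_vquot_torsion[OF lattice_M n_pos])

lemma finite_Phi_over_Q_sum: "finite (Phi_over_Q_sum n L x)"
  by (rule finite_subset[OF _ finite_torsion]) (auto simp: Phi_over_Q_sum_def sum_Phi_over_Q_scale)

context
  fixes S
  assumes S: "subgroup S (A_prime n L)" and A: "cond_A n L x S" and B: "cond_B n L S"
begin

abbreviation S_lat where "S_lat \<equiv> {w \<in> W. cls n L w \<in> S}"

lemma S_conv_image: "S = cls n L ` S_lat"
  using subgroup_vquotD(3)[OF zmodule_W zmodule_M M_subset_W] S by (simp add: A_prime_def cls_def)

lemma zmodule_S_lat: "zmodule S_lat"
  using subgroup_vquotD(1)[OF zmodule_W zmodule_M M_subset_W] S by (simp add: A_prime_def cls_def)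

lemma M_subset_S_lat: "M \<subseteq> S_lat"
  using subgroup_vquotD(2)[OF zmodule_W zmodule_M M_subset_W] S by (simp add: A_prime_def cls_def)

lemma x_S_lat: "x ` S_lat \<subseteq> S_lat"
  using A x_W by (auto simp: cond_A_def)

text \<open>Q_n / Phi_d kills all components of w except the one of index d. By (A) the result still
  has its class in S, and it lies in the span of L d; so (B) places it in L d.\<close>

lemma S_lat_subset: "S_lat \<subseteq> sum_of (divisors n) (Phi_over_Q n L x)"
proof
  fix w assume w: "w \<in> S_lat"
  have "comp d w \<in> Phi_over_Q n L x d" if d: "d \<in> divisors n" for d
  proof -
    let ?p = "Qpoly n div cyclotomic d"
    have c: "comp e w \<in> span (L e)" if "e \<in> divisors n" for e
      using W_cases(2) w that by simp
    have "poly_act ?p x w = poly_act ?p x (\<Sum>e\<in>divisors n. comp e w)"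
      using W_cases(1) w by simp
    also have "\<dots> = (\<Sum>e\<in>divisors n. poly_act ?p x (comp e w))"
      by (rule linear_sum[OF linear_poly_act[OF linear_x]])
    also have "\<dots> = (\<Sum>e\<in>divisors n. if e = d then poly_act ?p x (comp d w) else 0)"
      using quotient_poly_act_other[OF linear_x n_pos d _ _ cyclotomic_L[OF _ c]]
      by (intro sum.cong) auto
    also have "\<dots> = poly_act ?p x (comp d w)"
      using d finite_divisors by simp
    finally have "poly_act ?p x (comp d w) \<in> S_lat"
      using zmodule_poly_act[OF zmodule_S_lat x_S_lat w, of ?p] by simp
    moreover have "poly_act ?p x (comp d w) \<in> span (L d)"
      by (rule zmodule_poly_act[OF zmodule_subspace[OF subspace_span] x_span[OF d] c[OF d]])
    ultimately have "poly_act ?p x (comp d w) \<in> L d"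
      using B d by (auto simp: cond_B_iff)
    then show ?thesis
      using c[OF d] by (simp add: Phi_over_Q_def)
  qed
  moreover have "w = (\<Sum>d\<in>divisors n. comp d w)"
    using W_cases(1) w by simp
  ultimately show "w \<in> sum_of (divisors n) (Phi_over_Q n L x)"
    by (intro sum_ofI)
qed

lemma subgroup_subset_Phi_over_Q_sum: "S \<subseteq> Phi_over_Q_sum n L x"
  using S_conv_image S_lat_subset unfolding Phi_over_Q_sum_def by blast

lemma lattice_S_lat: "is_lattice S_lat W"
  using S_lat_subset sum_Phi_over_Q_scale
  by (intro is_lattice_commensurable[OF lattice_M zmodule_S_lat M_subset_S_lat n_pos]) auto

end

lemma card_generate_cls:
  assumes "w \<in> W"
  shows "card (generate (A_prime n L) {cls n L w}) = n \<longleftrightarrow> (\<forall>k. of_int k *\<^sub>R w \<in> M \<longleftrightarrow> int n dvd k)"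
  unfolding A_prime_def cls_def
  by (rule card_generate_vquot[OF zmodule_W zmodule_M M_subset_W assms n_pos])

lemma generate_cls:
  assumes "w \<in> W"
  shows "generate (A_prime n L) {cls n L w} = range (\<lambda>k::int. cls n L (of_int k *\<^sub>R w))"
  unfolding A_prime_def cls_def
  by (rule generate_vquot[OF zmodule_W zmodule_M M_subset_W assms])

lemma projection_A1_eq: "projection_A1 n L S = (\<lambda>w. cls n L (comp 1 w)) ` {w \<in> W. cls n L w \<in> S}"
  using proj_comp_eq[OF _ one_divisor] by (auto simp: projection_A1_def) (metis (no_types, lifting))

end

section \<open>Hodge decompositions\<close>

text \<open>The sum over \<open>bool\<close>, with \<open>False\<close> for H and
  \<open>True\<close> for its conjugate, is unfolded into a statement about pairs.\<close>

lemma hodge_decomposition_iff: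
  "hodge_decomposition L x H \<longleftrightarrow> vec.subspace H \<and> cact x ` H \<subseteq> H \<and>
     (\<forall>z. z \<in> cspan L \<longleftrightarrow> (\<exists>h\<in>H. \<exists>h'\<in>H. z = h + vcnj h')) \<and>
     (\<forall>h\<in>H. \<forall>h'\<in>H. h + vcnj h' = 0 \<longrightarrow> h = 0 \<and> h' = 0)"
proof -
  let ?U = "\<lambda>c. if c then vcnj ` H else H"
  have sum: "(\<Sum>c\<in>UNIV. u c) = u False + u True" for u :: "bool \<Rightarrow> complex^'a"
    by (simp add: UNIV_bool)
  have mem: "z \<in> sum_of UNIV ?U \<longleftrightarrow> (\<exists>h\<in>H. \<exists>h'\<in>H. z = h + vcnj h')" for z
  proof
    assume "z \<in> sum_of UNIV ?U"
    then obtain u where u: "z = (\<Sum>c\<in>UNIV. u c)" "\<And>c. u c \<in> ?U c"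
      unfolding sum_of_def by blast
    have "u False \<in> H"
      using u(2)[of False] by simp
    moreover obtain h' where "u True = vcnj h'" "h' \<in> H"
      using u(2)[of True] by auto
    ultimately show "\<exists>h\<in>H. \<exists>h'\<in>H. z = h + vcnj h'"
      using sum[of u] u(1) by auto
  next
    assume "\<exists>h\<in>H. \<exists>h'\<in>H. z = h + vcnj h'"
    then obtain h h' where "h \<in> H" "h' \<in> H" "z = h + vcnj h'"
      by blast
    then show "z \<in> sum_of UNIV ?U"
      by (intro sum_ofI[of _ "\<lambda>c. if c then vcnj h' else h"]) (auto simp: UNIV_bool)
  qed
  have ind: "(\<forall>u. (\<forall>c\<in>UNIV. u c \<in> ?U c) \<and> (\<Sum>c\<in>UNIV. u c) = 0 \<longrightarrow> (\<forall>c\<in>UNIV. u c = 0)) \<longleftrightarrow>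
      (\<forall>h\<in>H. \<forall>h'\<in>H. h + vcnj h' = 0 \<longrightarrow> h = 0 \<and> h' = 0)" (is "?l \<longleftrightarrow> ?r")
  proof
    assume l: ?l
    show ?r
    proof (intro ballI impI)
      fix h h' assume h: "h \<in> H" "h' \<in> H" "h + vcnj h' = 0"
      have "\<forall>c\<in>UNIV. (if c then vcnj h' else h) = 0"
        by (rule l[THEN spec, of "\<lambda>c. if c then vcnj h' else h", THEN mp]) (use h in \<open>auto simp: UNIV_bool\<close>)
      then have "vcnj h' = 0" "h = 0"
        by (metis UNIV_I)+
      then show "h = 0 \<and> h' = 0"
        using vcnj_vcnj[of h'] linear_0[OF linear_vcnj] by metis
    qed
  next
    assume r: ?r
    show ?l
    proof (intro allI impI ballI)
      fix u :: "bool \<Rightarrow> complex^'a" and c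
      assume u: "(\<forall>c\<in>UNIV. u c \<in> ?U c) \<and> (\<Sum>c\<in>UNIV. u c) = 0"
      have "u False \<in> H" "u True \<in> vcnj ` H"
        using u by (metis UNIV_I)+
      then obtain h' where h': "u False \<in> H" "u True = vcnj h'" "h' \<in> H"
        by blast
      moreover have "u False + vcnj h' = 0"
        using u h'(2) by (simp add: sum)
      ultimately have "u False = 0" "h' = 0"
        using r by blast+
      then have "u False = 0 \<and> u True = 0"
        using h'(2) linear_0[OF linear_vcnj] by simp
      then show "u c = 0"
        by (cases c) auto
    qed
  qed
  show ?thesis
    unfolding hodge_decomposition_def is_direct_sum_def ind set_eq_iff mem by blast
qed

lemma cext_vcnj:
  assumes "linear f"
  shows "cext f (vcnj z) = f (vRe z) - \<i> *s f (vIm z)"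
  by (simp add: cext_def linear_neg[OF assms])

locale hodge_datum =
  fixes n :: nat and D :: "('k::finite) bdf_datum"
  assumes positive: "n > 0" and valid: "valid_datum n D"
begin

sublocale datum_lattices n "d_lat D" "d_x D"
  by unfold_locales (use positive valid in \<open>auto simp: valid_datum_def\<close>)

abbreviation L where "L \<equiv> d_lat D"
abbreviation x where "x \<equiv> d_x D"
abbreviation H where "H \<equiv> d_hodge D"
abbreviation \<alpha> where "\<alpha> \<equiv> cact (d_x D)"

lemma hodge: "d \<in> divisors n \<Longrightarrow> hodge_decomposition (L d) x (H d)"
  using valid by (simp add: valid_datum_def)

lemma csubspace_H: "d \<in> divisors n \<Longrightarrow> vec.subspace (H d)"
  and cact_H: "d \<in> divisors n \<Longrightarrow> h \<in> H d \<Longrightarrow> \<alpha> h \<in> H d"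
  and cspan_iff: "d \<in> divisors n \<Longrightarrow> z \<in> cspan (L d) \<longleftrightarrow> (\<exists>h\<in>H d. \<exists>h'\<in>H d. z = h + vcnj h')"
  and H_independent: "d \<in> divisors n \<Longrightarrow> h \<in> H d \<Longrightarrow> h' \<in> H d \<Longrightarrow> h + vcnj h' = 0 \<Longrightarrow> h = 0 \<and> h' = 0"
  using hodge[of d] unfolding hodge_decomposition_iff by blast+

lemma H_cspan: "d \<in> divisors n \<Longrightarrow> h \<in> H d \<Longrightarrow> h \<in> cspan (L d)"
  using cspan_iff[of d h] csubspaceD(1)[OF csubspace_H] linear_0[OF linear_vcnj] by fastforce

lemma H_span: "d \<in> divisors n \<Longrightarrow> h \<in> H d \<Longrightarrow> vRe h \<in> span (L d) \<and> vIm h \<in> span (L d)"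
  using H_cspan by (simp add: mem_cspan_iff)

lemma clinear_\<alpha>: "clinear \<alpha>"
  using linear_x by (rule clinear_cact)

lemma cyclotomic_H: "d \<in> divisors n \<Longrightarrow> h \<in> H d \<Longrightarrow> poly_act (cyclotomic d) \<alpha> h = 0"
  using H_span cyclotomic_L by (simp add: poly_act_cact_eq_0_iff[OF linear_x])

subsection \<open>Eigenspaces\<close>

lemma funpow_eigenvector: "\<alpha> z = c *s z \<Longrightarrow> (\<alpha> ^^ i) z = c ^ i *s z"
  by (induction i) (simp_all add: clinearD[OF clinear_\<alpha>] vector_smult_assoc mult.commute)

lemma poly_act_eigenvector:
  assumes "\<alpha> z = c *s z"
  shows "poly_act p \<alpha> z = poly (cpoly p) c *s z"
proof -
  have "poly_act p \<alpha> z = (\<Sum>i\<le>degree p. (of_int (coeff p i) * c ^ i) *s z)"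
    by (simp add: poly_act_def funpow_eigenvector[OF assms] scaleR_vec_complex vector_smult_assoc)
  also have "\<dots> = (\<Sum>i\<le>degree p. of_int (coeff p i) * c ^ i) *s z"
    by (rule vec.scale_sum_left[symmetric])
  also have "(\<Sum>i\<le>degree p. of_int (coeff p i) * c ^ i) = poly (cpoly p) c"
    by (simp add: poly_altdef degree_cpoly coeff_map_poly)
  finally show ?thesis .
qed

lemma funpow_H: "d \<in> divisors n \<Longrightarrow> h \<in> H d \<Longrightarrow> (\<alpha> ^^ i) h \<in> H d"
  by (induction i) (auto simp: cact_H)

text \<open>The discrete Fourier component: on H d, where \<alpha>^d = 1, this is the projection to
  the eigenvalue \<open>prim_root d j\<close>.\<close>

definition eigenproj :: "nat \<Rightarrow> nat \<Rightarrow> complex^'k \<Rightarrow> complex^'k" where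
  "eigenproj d j z = (1 / of_nat d) *s (\<Sum>i<d. (1 / prim_root d j) ^ i *s (\<alpha> ^^ i) z)"

lemma prim_root_nonzero: "prim_root d j \<noteq> 0"
  by (simp add: prim_root_def)

lemma sum_root_powers:
  assumes "d > 0" "\<omega> ^ d = 1"
  shows "(\<Sum>i<d. \<omega> ^ i) = (if \<omega> = 1 then of_nat d else (0::complex))"
  using assms by (simp add: geometric_sum)

context
  fixes d
  assumes d: "d \<in> divisors n"
begin

lemma d_pos: "d > 0"
  using d n_pos divisors_pos by blast

lemma \<alpha>_power_d: "h \<in> H d \<Longrightarrow> (\<alpha> ^^ d) h = h"
  using cyclotomic_kernel_periodic[OF clinear_imp_linear[OF clinear_\<alpha>] d_pos _ cyclotomic_H[OF d]]
  by (simp add: divisors_def)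

lemma eigenproj_H: "h \<in> H d \<Longrightarrow> eigenproj d j h \<in> H d"
  unfolding eigenproj_def using csubspace_H[OF d] funpow_H[OF d]
  by (intro vec.subspace_scale vec.subspace_sum) auto

lemma eigenproj_eigenvector:
  assumes h: "h \<in> H d"
  shows "\<alpha> (eigenproj d j h) = prim_root d j *s eigenproj d j h"
proof -
  define f where "f i = (1 / prim_root d j) ^ i *s (\<alpha> ^^ i) h" for i
  have "\<alpha> (f i) = prim_root d j *s f (Suc i)" for i
    using prim_root_nonzero[of d j] by (simp add: f_def clinearD[OF clinear_\<alpha>] vector_smult_assoc)
  then have "\<alpha> (\<Sum>i<d. f i) = prim_root d j *s (\<Sum>i<d. f (Suc i))"
    by (simp add: clinearD[OF clinear_\<alpha>] vec.scale_sum_right)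
  \<comment> \<open>The shifted sum has f d in place of f 0, and these agree because \<alpha>^d and
    the d-th power of the root are trivial on h.\<close>
  also have "(\<Sum>i<d. f (Suc i)) = (\<Sum>i<d. f i)"
  proof -
    have "f d = f 0"
      using \<alpha>_power_d[OF h] prim_root_power_eq_1[OF d_pos, of j] by (simp add: f_def power_one_over)
    then show ?thesis
      using sum.lessThan_Suc_shift[of f d] sum.lessThan_Suc[of f d] by simp
  qed
  finally show ?thesis
    by (simp add: eigenproj_def f_def clinearD[OF clinear_\<alpha>] vector_smult_assoc mult.commute)
qed

lemma sum_eigenproj:
  assumes h: "h \<in> H d"
  shows "(\<Sum>j<d. eigenproj d j h) = h"
proof -
  \<comment> \<open>Orthogonality of characters: the powers of a d-th root of unity other than 1 sum
    to 0.\<close>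
  have roots: "(\<Sum>j<d. (1 / prim_root d j) ^ i) = (if i = 0 then of_nat d else 0)" if i: "i < d" for i
  proof -
    let ?\<omega> = "1 / prim_root d i"
    have eq: "(1 / prim_root d j) ^ i = ?\<omega> ^ j" for j
      by (simp add: power_one_over prim_root_power mult.commute)
    have "?\<omega> = 1 \<longleftrightarrow> i = 0"
    proof -
      have "prim_root d 0 = 1"
        by (simp add: prim_root_def)
      then have "?\<omega> = 1 \<longleftrightarrow> prim_root d i = prim_root d 0"
        using prim_root_nonzero[of d i] by (auto simp: field_simps)
      also have "\<dots> \<longleftrightarrow> i = 0"
        using inj_on_eq_iff[OF prim_root_inj] i by auto
      finally show ?thesis .
    qed
    moreover have "?\<omega> ^ d = 1"
      by (simp add: power_one_over prim_root_power_eq_1[OF d_pos])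
    ultimately show ?thesis
      unfolding eq by (simp add: sum_root_powers[OF d_pos])
  qed
  have "(\<Sum>j<d. eigenproj d j h) = (1 / of_nat d) *s (\<Sum>i<d. (\<Sum>j<d. (1 / prim_root d j) ^ i) *s (\<alpha> ^^ i) h)"
    unfolding eigenproj_def vec.scale_sum_right[symmetric] vec.scale_sum_left by (subst sum.swap) simp
  also have "(\<Sum>i<d. (\<Sum>j<d. (1 / prim_root d j) ^ i) *s (\<alpha> ^^ i) h) = (\<Sum>i<d. if i = 0 then of_nat d *s h else 0)"
    by (intro sum.cong) (auto simp: roots)
  also have "(1 / of_nat d) *s \<dots> = h"
    using d_pos by (simp add: vector_smult_assoc)
  finally show ?thesis .
qed

lemma eigenproj_eigenspace:
  assumes "\<alpha> u = prim_root d k *s u" "j < d" "k < d"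
  shows "eigenproj d j u = (if j = k then u else 0)"
proof -
  let ?\<omega> = "prim_root d k / prim_root d j"
  have "eigenproj d j u = (1 / of_nat d) *s ((\<Sum>i<d. ?\<omega> ^ i) *s u)"
    by (simp add: eigenproj_def funpow_eigenvector[OF assms(1)] vector_smult_assoc vec.scale_sum_left
        power_divide)
  also have "?\<omega> = 1 \<longleftrightarrow> j = k"
    using inj_on_eq_iff[OF prim_root_inj, of k d j] assms(2,3) prim_root_nonzero[of d j] by auto
  then have "(\<Sum>i<d. ?\<omega> ^ i) = (if j = k then of_nat d else 0)"
    using sum_root_powers[OF d_pos, of ?\<omega>] by (simp add: power_divide prim_root_power_eq_1[OF d_pos])
  finally show ?thesis
    using d_pos by (simp add: vector_smult_assoc)
qed

text \<open>Phi_d(\<alpha>) vanishes on H d, but acts on the component as the value of Phi_d at its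
  eigenvalue, which is nonzero unless the root is primitive.\<close>

lemma eigenproj_not_coprime:
  assumes "h \<in> H d" "j < d" "\<not> coprime j d"
  shows "eigenproj d j h = 0"
proof -
  have "poly (cpoly (cyclotomic d)) (prim_root d j) *s eigenproj d j h = 0"
    using poly_act_eigenvector[OF eigenproj_eigenvector[OF assms(1), of j], of "cyclotomic d"]
      cyclotomic_H[OF d eigenproj_H[OF assms(1)]] by simp
  moreover have "poly (cpoly (cyclotomic d)) (prim_root d j) \<noteq> 0"
    using inj_on_eq_iff[OF prim_root_inj] assms(2,3) d_pos
    by (auto simp: cpoly_cyclotomic prim_poly_def poly_prod)
  ultimately show ?thesis
    by simp
qed

lemma eigenspace_decomposition:
  "is_direct_sum {j. j < d \<and> coprime j d} (eigenspace x (H d) d) (H d)"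
proof -
  let ?J = "{j. j < d \<and> coprime j d}"
  have E: "eigenspace x (H d) d j = {z \<in> H d. \<alpha> z = prim_root d j *s z}" for j
    by (simp add: eigenspace_def prim_root_def)
  have "H d = sum_of ?J (eigenspace x (H d) d)"
  proof (intro subset_antisym subsetI)
    fix h assume h: "h \<in> H d"
    have "h = (\<Sum>j<d. eigenproj d j h)"
      using sum_eigenproj[OF h] by simp
    also have "\<dots> = (\<Sum>j\<in>?J. eigenproj d j h)"
      using eigenproj_not_coprime[OF h] by (intro sum.mono_neutral_right) auto
    finally show "h \<in> sum_of ?J (eigenspace x (H d) d)"
      by (rule sum_ofI) (simp add: E eigenproj_H[OF h] eigenproj_eigenvector[OF h])
  next
    fix h assume "h \<in> sum_of ?J (eigenspace x (H d) d)"
    then obtain u where "h = (\<Sum>j\<in>?J. u j)" "\<And>j. j \<in> ?J \<Longrightarrow> u j \<in> eigenspace x (H d) d j"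
      unfolding sum_of_def by blast
    then show "h \<in> H d"
      using csubspace_H[OF d] by (auto simp: E intro!: vec.subspace_sum)
  qed
  moreover have "u k = 0" if u: "\<forall>j\<in>?J. u j \<in> eigenspace x (H d) d j" "(\<Sum>j\<in>?J. u j) = 0" and k: "k \<in> ?J" for u k
  proof -
    have lin: "eigenproj d k (\<Sum>j\<in>?J. u j) = (\<Sum>j\<in>?J. eigenproj d k (u j))"
    proof -
      have "clinear (\<alpha> ^^ i)" for i
        by (induction i) (auto intro!: clinearI simp: clinearD[OF clinear_\<alpha>] vec.linear_add vec.linear_scale)
      then have "clinear (eigenproj d k)"
        by (intro clinearI) (simp_all add: eigenproj_def clinearD vector_add_ldistrib sum.distrib
            vec.scale_sum_right vector_smult_assoc mult_ac)
      then show ?thesis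
        by (rule clinearD)
    qed
    have "(\<Sum>j\<in>?J. eigenproj d k (u j)) = (\<Sum>j\<in>?J. if j = k then u k else 0)"
    proof (intro sum.cong refl)
      fix j assume j: "j \<in> ?J"
      have "\<alpha> (u j) = prim_root d j *s u j"
        using u(1) j by (auto simp: E)
      then show "eigenproj d k (u j) = (if j = k then u k else 0)"
        using eigenproj_eigenspace[of "u j" j k] j k by auto
    qed
    also have "\<dots> = u k"
      using k by simp
    finally have "eigenproj d k 0 = u k"
      using lin u(2) by simp
    moreover have "(\<alpha> ^^ i) 0 = 0" for i
      by (induction i) (simp_all add: clinearD[OF clinear_\<alpha>])
    ultimately show ?thesis
      by (simp add: eigenproj_def)
  qed
  ultimately show ?thesis
    unfolding is_direct_sum_def by blast
qed

end

end

section \<open>Cyclic actions by affine maps\<close>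

text \<open>Bijectivity comes from the action of the residue of -g; extensionality is part of
  \<open>Bij\<close>.\<close>

lemma group_action_integer_mod_groupI:
  assumes n: "n > 0"
    and ext: "\<And>g. g \<in> {0..<int n} \<Longrightarrow> \<phi> g \<in> extensional E"
    and closed: "\<And>g a. g \<in> {0..<int n} \<Longrightarrow> a \<in> E \<Longrightarrow> \<phi> g a \<in> E"
    and comp: "\<And>g h a. g \<in> {0..<int n} \<Longrightarrow> h \<in> {0..<int n} \<Longrightarrow> a \<in> E \<Longrightarrow>
      \<phi> ((g + h) mod int n) a = \<phi> g (\<phi> h a)"
    and unit: "\<And>a. a \<in> E \<Longrightarrow> \<phi> 0 a = a"
  shows "group_action (integer_mod_group n) E \<phi>"
proof -
  have Bij: "\<phi> g \<in> Bij E" if g: "g \<in> {0..<int n}" for g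
  proof -
    let ?h = "(- g) mod int n"
    have h: "?h \<in> {0..<int n}"
      using n by simp
    have "\<phi> ?h (\<phi> g a) = a" "\<phi> g (\<phi> ?h a) = a" if "a \<in> E" for a
      using comp[OF h g that] comp[OF g h that] unit[OF that] by (simp_all add: mod_simps)
    then have "bij_betw (\<phi> g) E E"
      using closed g h by (intro bij_betwI[where g = "\<phi> ?h"]) auto
    then show ?thesis
      using ext[OF g] by (simp add: Bij_def)
  qed
  have "\<phi> \<in> hom (integer_mod_group n) (BijGroup E)"
  proof (rule homI)
    show "\<phi> g \<in> carrier (BijGroup E)" if "g \<in> carrier (integer_mod_group n)" for g
      using that n Bij by (simp add: carrier_integer_mod_group BijGroup_def)
    fix g h assume "g \<in> carrier (integer_mod_group n)" "h \<in> carrier (integer_mod_group n)"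
    then have gh: "g \<in> {0..<int n}" "h \<in> {0..<int n}" "(g + h) mod int n \<in> {0..<int n}"
      using n by (auto simp: carrier_integer_mod_group)
    have "\<phi> ((g + h) mod int n) = compose E (\<phi> g) (\<phi> h)"
    proof (rule extensionalityI[OF ext[OF gh(3)] compose_extensional])
      show "\<phi> ((g + h) mod int n) a = compose E (\<phi> g) (\<phi> h) a" if "a \<in> E" for a
        using comp[OF gh(1,2) that] that by (simp add: compose_eq)
    qed
    then show "\<phi> (g \<otimes>\<^bsub>integer_mod_group n\<^esub> h) = \<phi> g \<otimes>\<^bsub>BijGroup E\<^esub> \<phi> h"
      using Bij gh by (simp add: BijGroup_def)
  qed
  then show ?thesis
    by (intro group_action.intro group_hom.intro group_hom_axioms.intro group_BijGroup group_integer_mod_group)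
qed

text \<open>A small multiple of u would be a nonzero lattice vector shorter than the discreteness
  bound. This turns a congruence modulo \<Lambda> that holds for all real multiples into an
  equation.\<close>

lemma lattice_contains_no_line:
  assumes "is_lattice \<Lambda> V" "\<And>t::real. t *\<^sub>R u \<in> \<Lambda>"
  shows "u = 0"
proof (rule ccontr)
  assume u: "u \<noteq> 0"
  obtain e where e: "e > 0" "\<And>l. l \<in> \<Lambda> \<Longrightarrow> norm l < e \<Longrightarrow> l = 0"
    using is_lattice_discrete[OF assms(1)] by blast
  have "norm ((e / (2 * norm u)) *\<^sub>R u) < e"
    using u e(1) by simp
  then have "(e / (2 * norm u)) *\<^sub>R u = 0"
    by (rule e(2)[OF assms(2)])
  then show False
    using u e(1) by simp
qed

text \<open>The action before the choice of an origin: c is an arbitrary translation part, from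
  which \<open>normal_form\<close> finds b and q.\<close>

locale affine_torus =
  fixes n :: nat and X :: "('m::finite) torus_quotient" and \<alpha> and c
  assumes n_pos: "n > 0" and torus: "complex_torus (t_space X) (t_lat X)"
    and action: "group_action (integer_mod_group n) (carrier (t_torus X)) (t_act X)"
    and clinear_\<alpha>: "clinear \<alpha>" and \<alpha>_space: "v \<in> t_space X \<Longrightarrow> \<alpha> v \<in> t_space X"
    and c_space: "c \<in> t_space X"
    and act_generator: "v \<in> t_space X \<Longrightarrow> t_act X (1 mod int n) (t_class X v) = t_class X (\<alpha> v + c)"
begin

abbreviation V where "V \<equiv> t_space X"
abbreviation \<Lambda> where "\<Lambda> \<equiv> t_lat X"

lemma csubspace_V: "vec.subspace V" and lattice_\<Lambda>: "is_lattice \<Lambda> V"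
  using torus by (auto simp: complex_torus_def)

lemma zmodule_\<Lambda>: "zmodule \<Lambda>"
  using lattice_\<Lambda> by (rule is_lattice_zmodule)

lemma \<Lambda>_subset: "\<Lambda> \<subseteq> V"
  using lattice_\<Lambda> by (rule is_lattice_subset)

lemma zmodule_V: "zmodule V"
  by (intro zmodule_subspace csubspace_imp_subspace csubspace_V)

lemma class_eq_iff: "t_class X u = t_class X v \<longleftrightarrow> u - v \<in> \<Lambda>"
  by (rule vclass_eq_iff[OF zmodule_\<Lambda>])

lemma linear_\<alpha>: "linear \<alpha>"
  using clinear_\<alpha> by (rule clinear_imp_linear)

lemma \<alpha>_lattice: "l \<in> \<Lambda> \<Longrightarrow> \<alpha> l \<in> \<Lambda>"
proof -
  assume l: "l \<in> \<Lambda>"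
  then have "t_class X l = t_class X 0"
    by (simp add: class_eq_iff)
  then have "t_class X (\<alpha> l + c) = t_class X (\<alpha> 0 + c)"
    using act_generator[of l] act_generator[of 0] l \<Lambda>_subset csubspaceD(1)[OF csubspace_V] by auto
  then show "\<alpha> l \<in> \<Lambda>"
    by (simp add: class_eq_iff clinearD[OF clinear_\<alpha>])
qed

lemma affine_space: "v \<in> V \<Longrightarrow> ((\<lambda>v. \<alpha> v + c) ^^ k) v \<in> V"
  by (induction k) (auto simp: \<alpha>_space c_space csubspaceD[OF csubspace_V])

lemma \<alpha>_funpow_space: "v \<in> V \<Longrightarrow> (\<alpha> ^^ k) v \<in> V"
  by (induction k) (auto simp: \<alpha>_space)

lemma class_carrier: "v \<in> V \<Longrightarrow> t_class X v \<in> carrier (t_torus X)"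
  by (simp add: carrier_vquot)

lemma act_power:
  assumes "v \<in> V"
  shows "t_act X (int k mod int n) (t_class X v) = t_class X (((\<lambda>v. \<alpha> v + c) ^^ k) v)"
proof (induction k)
  case 0
  have "t_act X \<one>\<^bsub>integer_mod_group n\<^esub> (t_class X v) = t_class X v"
    using group_action.id_eq_one[OF action] class_carrier[OF assms] by (metis restrict_apply')
  then show ?case
    by simp
next
  case (Suc k)
  have mem: "j mod int n \<in> carrier (integer_mod_group n)" for j
    using n_pos by (simp add: carrier_integer_mod_group)
  have "int (Suc k) mod int n = (1 mod int n) \<otimes>\<^bsub>integer_mod_group n\<^esub> (int k mod int n)"
    by (simp add: mod_simps)
  then have "t_act X (int (Suc k) mod int n) (t_class X v)
      = t_act X (1 mod int n) (t_act X (int k mod int n) (t_class X v))"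
    using group_action.composition_rule[OF action class_carrier[OF assms] mem mem] by metis
  then show ?case
    using Suc act_generator[OF affine_space[OF assms]] by simp
qed

lemma affine_funpow_diff:
  "((\<lambda>v. \<alpha> v + c) ^^ k) (u + v) = ((\<lambda>v. \<alpha> v + c) ^^ k) u + (\<alpha> ^^ k) v"
  by (induction k) (simp_all add: clinearD[OF clinear_\<alpha>])

text \<open>\<gamma>^n moves every point by a lattice vector. Comparing the points t v and 0 cancels
  the translation part and leaves t (\<alpha>^n v - v), for all real t.\<close>

lemma \<alpha>_power_n:
  assumes v: "v \<in> V"
  shows "(\<alpha> ^^ n) v = v"
proof -
  let ?\<gamma> = "\<lambda>v. \<alpha> v + c"
  have *: "(?\<gamma> ^^ n) u - u \<in> \<Lambda>" if "u \<in> V" for u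
    using act_power[OF that, of n] act_power[OF that, of 0] by (simp add: class_eq_iff)
  have "t *\<^sub>R ((\<alpha> ^^ n) v - v) \<in> \<Lambda>" for t
  proof -
    have tv: "t *\<^sub>R v \<in> V"
      using v csubspaceD[OF csubspace_V] by (simp add: scaleR_vec_complex)
    have "t *\<^sub>R ((\<alpha> ^^ n) v - v) = ((?\<gamma> ^^ n) (0 + t *\<^sub>R v) - t *\<^sub>R v) - ((?\<gamma> ^^ n) 0 - 0)"
      unfolding affine_funpow_diff by (simp add: linear_scale[OF linear_funpow[OF linear_\<alpha>]] scaleR_diff_right)
    then show ?thesis
      using *[OF tv] *[OF csubspaceD(1)[OF csubspace_V]] zmoduleD(2)[OF zmodule_\<Lambda>] by simp
  qed
  then have "(\<alpha> ^^ n) v - v = 0"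
    by (rule lattice_contains_no_line[OF lattice_\<Lambda>])
  then show ?thesis
    by simp
qed

text \<open>\<gamma> generates the group, so its natural powers exhaust the orbit; exponents that
  are not reduced modulo n add without case distinctions.\<close>

lemma t_proj_eq_iff:
  assumes "u \<in> V" "v \<in> V"
  shows "t_proj n X u = t_proj n X v \<longleftrightarrow> (\<exists>k. u - ((\<lambda>v. \<alpha> v + c) ^^ k) v \<in> \<Lambda>)"
proof -
  interpret group_action "integer_mod_group n" "carrier (t_torus X)" "t_act X"
    by (rule action)
  note car = class_carrier[OF assms(1)] class_carrier[OF assms(2)]
  have orbit: "orbit (integer_mod_group n) (t_act X) (t_class X v)
      = range (\<lambda>k. t_class X (((\<lambda>v. \<alpha> v + c) ^^ k) v))"
  proof (intro subset_antisym subsetI)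
    fix a assume "a \<in> orbit (integer_mod_group n) (t_act X) (t_class X v)"
    then obtain g where g: "g \<in> {0..<int n}" "a = t_act X g (t_class X v)"
      using n_pos by (auto simp: orbit_def carrier_integer_mod_group)
    then have "g = int (nat g) mod int n"
      by simp
    then have "a = t_class X (((\<lambda>v. \<alpha> v + c) ^^ nat g) v)"
      using g(2) act_power[OF assms(2), of "nat g"] by simp
    then show "a \<in> range (\<lambda>k. t_class X (((\<lambda>v. \<alpha> v + c) ^^ k) v))"
      by simp
  next
    fix a assume "a \<in> range (\<lambda>k. t_class X (((\<lambda>v. \<alpha> v + c) ^^ k) v))"
    then obtain k where "a = t_act X (int k mod int n) (t_class X v)"
      using act_power[OF assms(2)] by auto
    moreover have "int k mod int n \<in> carrier (integer_mod_group n)"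
      using n_pos by (simp add: carrier_integer_mod_group)
    ultimately show "a \<in> orbit (integer_mod_group n) (t_act X) (t_class X v)"
      unfolding orbit_def by blast
  qed
  have "t_proj n X u = t_proj n X v \<longleftrightarrow> t_class X u \<in> orbit (integer_mod_group n) (t_act X) (t_class X v)"
  proof
    assume "t_proj n X u = t_proj n X v"
    then show "t_class X u \<in> orbit (integer_mod_group n) (t_act X) (t_class X v)"
      using orbit_refl[OF car(1)] by (simp add: t_proj_def)
  next
    assume u: "t_class X u \<in> orbit (integer_mod_group n) (t_act X) (t_class X v)"
    have sub: "orbit (integer_mod_group n) (t_act X) a \<subseteq> orbit (integer_mod_group n) (t_act X) b"
      if "a \<in> orbit (integer_mod_group n) (t_act X) b" "a \<in> carrier (t_torus X)" "b \<in> carrier (t_torus X)" for a b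
    proof
      fix y assume y: "y \<in> orbit (integer_mod_group n) (t_act X) a"
      then have "y \<in> carrier (t_torus X)"
        using that(2) element_image unfolding orbit_def by blast
      then show "y \<in> orbit (integer_mod_group n) (t_act X) b"
        using orbit_trans that y by blast
    qed
    show "t_proj n X u = t_proj n X v"
      unfolding t_proj_def using sub[OF u car] sub[OF orbit_sym[OF car(2,1) u] car(2,1)] by blast
  qed
  also have "\<dots> \<longleftrightarrow> (\<exists>k. u - ((\<lambda>v. \<alpha> v + c) ^^ k) v \<in> \<Lambda>)"
    unfolding orbit by (auto simp: class_eq_iff image_iff)
  finally show ?thesis .
qed

text \<open>b is the mean of the vectors \<alpha>^i c with i < n. For q, the telescoping identity (1
  - \<alpha>) (c + ... + \<alpha>^(i-1) c) = c - \<alpha>^i c is averaged over i < n, which gives q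
  - \<alpha> q = c - b.\<close>

lemma normal_form:
  obtains b q where "b \<in> V" "\<alpha> b = b" "q \<in> V" "c = q - \<alpha> q + b"
proof -
  define b where "b = (1 / of_nat n) *\<^sub>R (\<Sum>i<n. (\<alpha> ^^ i) c)"
  define q where "q = (1 / of_nat n) *\<^sub>R (\<Sum>i<n. \<Sum>j<i. (\<alpha> ^^ j) c)"
  note sub = csubspace_imp_subspace[OF csubspace_V]
  have "b \<in> V" "q \<in> V"
    unfolding b_def q_def
    by (intro subspace_scale[OF sub] subspace_sum[OF sub] \<alpha>_funpow_space c_space)+
  moreover have "\<alpha> b = b"
  proof -
    have "\<alpha> (\<Sum>i<n. (\<alpha> ^^ i) c) = (\<Sum>i<n. (\<alpha> ^^ Suc i) c)"
      by (simp add: linear_sum[OF linear_\<alpha>])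
    also have "\<dots> = (\<Sum>i<n. (\<alpha> ^^ i) c)"
      using sum.lessThan_Suc_shift[of "\<lambda>i. (\<alpha> ^^ i) c" n] sum.lessThan_Suc[of "\<lambda>i. (\<alpha> ^^ i) c" n]
        \<alpha>_power_n[OF c_space] by simp
    finally show ?thesis
      by (simp add: b_def linear_scale[OF linear_\<alpha>])
  qed
  moreover have "c = q - \<alpha> q + b"
  proof -
    have tele: "(\<Sum>j<i. (\<alpha> ^^ j) c) - \<alpha> (\<Sum>j<i. (\<alpha> ^^ j) c) = c - (\<alpha> ^^ i) c" for i
    proof (induction i)
      case (Suc i)
      have "(\<Sum>j<Suc i. (\<alpha> ^^ j) c) - \<alpha> (\<Sum>j<Suc i. (\<alpha> ^^ j) c)
          = ((\<Sum>j<i. (\<alpha> ^^ j) c) - \<alpha> (\<Sum>j<i. (\<alpha> ^^ j) c)) + ((\<alpha> ^^ i) c - (\<alpha> ^^ Suc i) c)"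
        by (simp add: linear_add[OF linear_\<alpha>])
      then show ?case
        by (simp only: Suc) simp
    qed (simp add: linear_0[OF linear_\<alpha>])
    have "q - \<alpha> q = (1 / of_nat n) *\<^sub>R (\<Sum>i<n. (\<Sum>j<i. (\<alpha> ^^ j) c) - \<alpha> (\<Sum>j<i. (\<alpha> ^^ j) c))"
      by (simp add: q_def linear_scale[OF linear_\<alpha>] linear_sum[OF linear_\<alpha>] scaleR_diff_right sum_subtractf)
    also have "\<dots> = (1 / of_nat n) *\<^sub>R (of_nat n *\<^sub>R c - (\<Sum>i<n. (\<alpha> ^^ i) c))"
      unfolding tele by (simp add: sum_subtractf scaleR_conv_of_real sum_constant_scaleR)
    also have "\<dots> = c - b"
      using n_pos by (simp add: b_def scaleR_diff_right)
    finally show ?thesis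
      by simp
  qed
  ultimately show ?thesis
    using that by blast
qed

end

lemma free_torus_quotient_affine:
  assumes "n > 0" "free_torus_quotient n X"
  obtains \<alpha> c where "affine_torus n X \<alpha> c"
proof -
  have "1 mod int n \<in> carrier (integer_mod_group n)"
    using assms(1) by (simp add: carrier_integer_mod_group)
  then obtain \<alpha> c where "clinear \<alpha>" "\<alpha> ` t_space X \<subseteq> t_space X" "c \<in> t_space X"
      "\<And>v. v \<in> t_space X \<Longrightarrow> t_act X (1 mod int n) (t_class X v) = t_class X (\<alpha> v + c)"
    using torus_map_affine[of "t_space X" "t_lat X" "t_act X (1 mod int n)"] assms(2)
    unfolding free_torus_quotient_def by blast
  then have "affine_torus n X \<alpha> c"
    using assms by (intro affine_torus.intro) (auto simp: free_torus_quotient_def)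
  then show ?thesis
    by (rule that)
qed

section \<open>From manifolds to data\<close>

context affine_torus
begin

definition \<Lambda>_part where "\<Lambda>_part d = {v \<in> \<Lambda>. poly_act (cyclotomic d) \<alpha> v = 0}"

lemma proj_poly_\<Lambda>:
  assumes "d \<in> divisors n" "l \<in> \<Lambda>"
  shows "poly_act (proj_poly n d) \<alpha> l \<in> \<Lambda>_part d"
proof -
  have "l \<in> V"
    using assms(2) \<Lambda>_subset by auto
  then show ?thesis
    unfolding \<Lambda>_part_def
    using zmodule_poly_act[OF zmodule_\<Lambda> _ assms(2)] \<alpha>_lattice
      cyclotomic_proj_poly_act[OF linear_\<alpha> n_pos assms(1) \<alpha>_power_n] by blast
qed

text \<open>For the harder inclusion: \<open>proj_poly n d\<close> maps \<Lambda> into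
  \<open>\<Lambda>_part d\<close>, hence V, the span of \<Lambda>, into the span of that part, and
  it multiplies a vector killed by Phi_d by n.\<close>

lemma span_\<Lambda>_part:
  assumes d: "d \<in> divisors n"
  shows "span (\<Lambda>_part d) = {v \<in> V. poly_act (cyclotomic d) \<alpha> v = 0}"
proof (intro subset_antisym subsetI)
  fix v assume v: "v \<in> span (\<Lambda>_part d)"
  have "\<Lambda>_part d \<subseteq> V"
    using \<Lambda>_subset by (auto simp: \<Lambda>_part_def)
  then have "v \<in> V"
    using v span_minimal[OF _ csubspace_imp_subspace[OF csubspace_V]] by blast
  moreover have "poly_act (cyclotomic d) \<alpha> v = 0"
    by (rule linear_eq_0_on_span[OF linear_poly_act[OF linear_\<alpha>] _ v]) (simp add: \<Lambda>_part_def)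
  ultimately show "v \<in> {v \<in> V. poly_act (cyclotomic d) \<alpha> v = 0}"
    by simp
next
  fix v assume v: "v \<in> {v \<in> V. poly_act (cyclotomic d) \<alpha> v = 0}"
  have "poly_act (proj_poly n d) \<alpha> ` span \<Lambda> = span (poly_act (proj_poly n d) \<alpha> ` \<Lambda>)"
    by (rule linear_span_image[symmetric, OF linear_poly_act[OF linear_\<alpha>]])
  also have "\<dots> \<subseteq> span (\<Lambda>_part d)"
    using proj_poly_\<Lambda>[OF d] by (intro span_mono) auto
  finally have "poly_act (proj_poly n d) \<alpha> v \<in> span (\<Lambda>_part d)"
    using v is_lattice_span[OF lattice_\<Lambda>] by auto
  then have "of_nat n *\<^sub>R v \<in> span (\<Lambda>_part d)"
    using v proj_poly_act_same[OF linear_\<alpha> n_pos d, of v] by auto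
  then have "(1 / of_nat n) *\<^sub>R (of_nat n *\<^sub>R v) \<in> span (\<Lambda>_part d)"
    by (rule span_scale)
  moreover have "(1 / of_nat n) *\<^sub>R (of_nat n *\<^sub>R v) = v"
    using n_pos by simp
  ultimately show "v \<in> span (\<Lambda>_part d)"
    by (simp only:)
qed

lemma sum_span_\<Lambda>_part: "sum_of (divisors n) (\<lambda>d. span (\<Lambda>_part d)) = V"
proof (intro subset_antisym subsetI)
  fix v assume "v \<in> sum_of (divisors n) (\<lambda>d. span (\<Lambda>_part d))"
  then obtain u where "v = (\<Sum>d\<in>divisors n. u d)" "\<And>d. d \<in> divisors n \<Longrightarrow> u d \<in> span (\<Lambda>_part d)"
    unfolding sum_of_def by blast
  then show "v \<in> V"
    using span_\<Lambda>_part by (auto intro!: subspace_sum csubspace_imp_subspace csubspace_V)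
next
  fix v assume v: "v \<in> V"
  let ?u = "\<lambda>d. (1 / of_nat n) *\<^sub>R poly_act (proj_poly n d) \<alpha> v"
  have "(\<Sum>d\<in>divisors n. ?u d) = v"
    using sum_proj_poly_act[OF linear_\<alpha> n_pos \<alpha>_power_n[OF v]] n_pos by (simp flip: scaleR_sum_right)
  moreover have "?u d \<in> span (\<Lambda>_part d)" if d: "d \<in> divisors n" for d
  proof -
    have "poly_act (proj_poly n d) \<alpha> v \<in> V"
      using zmodule_poly_act[OF zmodule_V _ v] \<alpha>_space by blast
    then show ?thesis
      using cyclotomic_proj_poly_act[OF linear_\<alpha> n_pos d \<alpha>_power_n[OF v]]
      by (intro span_scale) (simp add: span_\<Lambda>_part[OF d])
  qed
  ultimately show "v \<in> sum_of (divisors n) (\<lambda>d. span (\<Lambda>_part d))"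
    using sum_ofI[of v ?u] by metis
qed

text \<open>The type \<open>real^('m + 'm)\<close> has the real dimension of
  \<open>complex^'m\<close>, so a copy of V fits into it. All data are carried over by \<sigma>, the
  inverse of \<tau>.\<close>

lemma datum_exists: "\<exists>D :: ('m + 'm) bdf_datum. datum_of n X D"
proof -
  have "DIM(real^('m + 'm)) = DIM(complex^'m)"
    by simp
  then obtain \<tau> :: "real^('m + 'm) \<Rightarrow> complex^'m" and \<sigma> where iso: "linear \<tau>" "linear \<sigma>"
      "\<And>w. \<sigma> (\<tau> w) = w" "\<And>v. \<tau> (\<sigma> v) = v"
    using isomorphisms_UNIV_UNIV by metis
  obtain b q where b: "b \<in> V" "\<alpha> b = b" "q \<in> V" "c = q - \<alpha> q + b"
    using normal_form by blast
  define L where "L d = \<sigma> ` \<Lambda>_part d" for d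
  define x where "x = \<sigma> \<circ> \<alpha> \<circ> \<tau>"
  define D where "D = \<lparr>d_lat = L, d_x = x,
      d_sub = {cls n L w | w. w \<in> real_sum n L \<and> \<tau> w \<in> \<Lambda>}, d_beta = cls n L (\<sigma> b),
      d_hodge = (\<lambda>d. {z \<in> cspan (L d). cext \<tau> (vcnj z) = 0})\<rparr>"
  have W: "real_sum n L = \<sigma> ` V"
  proof -
    have "real_sum n L = sum_of (divisors n) (\<lambda>d. \<sigma> ` span (\<Lambda>_part d))"
      by (simp add: real_sum_def L_def linear_span_image[OF iso(2)])
    also have "\<dots> = \<sigma> ` sum_of (divisors n) (\<lambda>d. span (\<Lambda>_part d))"
    proof (intro subset_antisym subsetI)
      fix w assume "w \<in> sum_of (divisors n) (\<lambda>d. \<sigma> ` span (\<Lambda>_part d))"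
      then obtain u where u: "w = (\<Sum>d\<in>divisors n. u d)" "\<And>d. d \<in> divisors n \<Longrightarrow> u d \<in> \<sigma> ` span (\<Lambda>_part d)"
        unfolding sum_of_def by blast
      have "w = \<sigma> (\<Sum>d\<in>divisors n. \<tau> (u d))"
        using u by (auto simp: linear_sum[OF iso(2)] iso(3))
      moreover have "(\<Sum>d\<in>divisors n. \<tau> (u d)) \<in> sum_of (divisors n) (\<lambda>d. span (\<Lambda>_part d))"
        by (rule sum_ofI[OF refl]) (use u(2) iso(4) in fastforce)
      ultimately show "w \<in> \<sigma> ` sum_of (divisors n) (\<lambda>d. span (\<Lambda>_part d))"
        by blast
    next
      fix w assume "w \<in> \<sigma> ` sum_of (divisors n) (\<lambda>d. span (\<Lambda>_part d))"
      then obtain u where u: "w = \<sigma> (\<Sum>d\<in>divisors n. u d)" "\<And>d. d \<in> divisors n \<Longrightarrow> u d \<in> span (\<Lambda>_part d)"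
        unfolding sum_of_def by blast
      then show "w \<in> sum_of (divisors n) (\<lambda>d. \<sigma> ` span (\<Lambda>_part d))"
        by (intro sum_ofI[of _ "\<lambda>d. \<sigma> (u d)"]) (auto simp: linear_sum[OF iso(2)])
    qed
    finally show ?thesis
      by (simp add: sum_span_\<Lambda>_part)
  qed
  have bij: "bij_betw \<tau> (real_sum n L) V"
    unfolding W by (rule bij_betwI[where g = \<sigma>]) (auto simp: iso)
  have \<tau>L: "\<tau> ` L d = {v \<in> \<Lambda>. poly_act (cyclotomic d) \<alpha> v = 0}" for d
    by (simp add: L_def \<Lambda>_part_def image_image iso)
  have LW: "L d \<subseteq> real_sum n L" for d
    unfolding W using \<Lambda>_subset by (auto simp: L_def \<Lambda>_part_def)
  \<comment> \<open>Moving the origin to q absorbs q - \<alpha> q and leaves the translation part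
    b.\<close>
  have act: "t_act X (1 mod int n) (t_class X (q + v)) = t_class X (q + (\<alpha> v + b))" if "v \<in> V" for v
    using act_generator[of "q + v"] b that csubspaceD[OF csubspace_V]
    by (simp add: clinearD[OF clinear_\<alpha>] algebra_simps)
  have "linear x"
    unfolding x_def by (intro linear_compose iso linear_\<alpha>)
  then have "datum_of n X D"
    unfolding datum_of_def using clinear_\<alpha> \<alpha>_space b act iso bij \<tau>L LW W
    by (intro exI[of _ \<alpha>] exI[of _ b] exI[of _ q] exI[of _ \<tau>])
      (auto simp: D_def x_def)
  then show ?thesis
    by blast
qed

end

text \<open>The unfolded \<open>datum_of\<close> together with the affine form of \<gamma>. Its
  translation part is q - \<alpha> q + b in the coordinates of V, and b once the origin is moved to
  q.\<close>

locale torus_datum =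
  fixes n :: nat and X :: "('m::finite) torus_quotient" and D :: "('k::finite) bdf_datum" and \<alpha> b q \<tau>
  assumes affine: "affine_torus n X \<alpha> (q - \<alpha> q + b)"
    and b: "b \<in> t_space X" "\<alpha> b = b" and q: "q \<in> t_space X"
    and linear_\<tau>: "linear \<tau>" and bij_\<tau>: "bij_betw \<tau> (real_sum n (d_lat D)) (t_space X)"
    and linear_x: "linear (d_x D)"
    and x_space: "w \<in> real_sum n (d_lat D) \<Longrightarrow> d_x D w \<in> real_sum n (d_lat D)"
    and \<tau>_x: "w \<in> real_sum n (d_lat D) \<Longrightarrow> \<tau> (d_x D w) = \<alpha> (\<tau> w)"
    and L_space: "d \<in> divisors n \<Longrightarrow> d_lat D d \<subseteq> real_sum n (d_lat D)"
    and \<tau>_L: "d \<in> divisors n \<Longrightarrow> \<tau> ` d_lat D d = {v \<in> t_lat X. poly_act (cyclotomic d) \<alpha> v = 0}"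
    and sub: "d_sub D = {cls n (d_lat D) w | w. w \<in> real_sum n (d_lat D) \<and> \<tau> w \<in> t_lat X}"
    and beta: "\<exists>w\<in>real_sum n (d_lat D). \<tau> w = b \<and> d_beta D = cls n (d_lat D) w"
    and hodge: "d \<in> divisors n \<Longrightarrow> d_hodge D d = {z \<in> cspan (d_lat D d). cext \<tau> (vcnj z) = 0}"
begin

sublocale affine_torus n X \<alpha> "q - \<alpha> q + b"
  by (rule affine)

abbreviation L where "L \<equiv> d_lat D"
abbreviation x where "x \<equiv> d_x D"
abbreviation W where "W \<equiv> real_sum n L"
abbreviation M where "M \<equiv> lat_sum n L"
abbreviation \<Lambda>' where "\<Lambda>' \<equiv> {w \<in> W. \<tau> w \<in> \<Lambda>}"

lemma \<tau>_space: "w \<in> W \<Longrightarrow> \<tau> w \<in> V"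
  using bij_\<tau> by (auto simp: bij_betw_def)

lemma \<tau>_inj: "u \<in> W \<Longrightarrow> v \<in> W \<Longrightarrow> \<tau> u = \<tau> v \<longleftrightarrow> u = v"
  using bij_\<tau> by (auto simp: bij_betw_def inj_on_def)

lemma \<tau>_surj: "v \<in> V \<Longrightarrow> \<exists>w\<in>W. \<tau> w = v"
  using bij_\<tau> by (metis bij_betw_def imageE)

lemma subspace_W: "subspace W"
  unfolding real_sum_def by (rule subspace_sum_of) (rule subspace_span)

lemma zmodule_W: "zmodule W"
  using subspace_W by (rule zmodule_subspace)

lemma x_image: "x ` W \<subseteq> W"
  using x_space by auto

lemma poly_act_space: "w \<in> W \<Longrightarrow> poly_act p x w \<in> W"
  by (rule zmodule_poly_act[OF zmodule_W x_image])

lemma \<tau>_poly_act: "w \<in> W \<Longrightarrow> \<tau> (poly_act p x w) = poly_act p \<alpha> (\<tau> w)"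
  by (rule poly_act_intertwine[OF linear_\<tau>, of W]) (auto simp: x_space \<tau>_x)

lemma poly_act_eq_0_iff: "w \<in> W \<Longrightarrow> poly_act p x w = 0 \<longleftrightarrow> poly_act p \<alpha> (\<tau> w) = 0"
  using \<tau>_inj[OF poly_act_space subspace_0[OF subspace_W], of w p] \<tau>_poly_act[of w p] linear_0[OF linear_\<tau>] by auto

lemma \<tau>_funpow: "w \<in> W \<Longrightarrow> (x ^^ k) w \<in> W \<and> \<tau> ((x ^^ k) w) = (\<alpha> ^^ k) (\<tau> w)"
  by (induction k) (auto simp: x_space \<tau>_x)

lemma x_power_n: "w \<in> W \<Longrightarrow> (x ^^ n) w = w"
  using \<tau>_inj[of "(x ^^ n) w" w] \<tau>_funpow[of w n] \<alpha>_power_n[OF \<tau>_space] by auto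

lemma L_eq: "d \<in> divisors n \<Longrightarrow> L d = {w \<in> W. \<tau> w \<in> \<Lambda> \<and> poly_act (cyclotomic d) x w = 0}"
proof (intro subset_antisym subsetI)
  fix w assume d: "d \<in> divisors n" and w: "w \<in> L d"
  then have "w \<in> W" "\<tau> w \<in> \<Lambda>" "poly_act (cyclotomic d) \<alpha> (\<tau> w) = 0"
    using L_space[OF d] \<tau>_L[OF d] by auto
  then show "w \<in> {w \<in> W. \<tau> w \<in> \<Lambda> \<and> poly_act (cyclotomic d) x w = 0}"
    by (simp add: poly_act_eq_0_iff)
next
  fix w assume d: "d \<in> divisors n" and w: "w \<in> {w \<in> W. \<tau> w \<in> \<Lambda> \<and> poly_act (cyclotomic d) x w = 0}"
  then have "\<tau> w \<in> \<tau> ` L d"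
    using poly_act_eq_0_iff[of w] by (auto simp: \<tau>_L[OF d])
  then obtain u where "u \<in> L d" "\<tau> w = \<tau> u"
    by auto
  moreover from this have "u \<in> W"
    using L_space[OF d] by auto
  ultimately show "w \<in> L d"
    using w \<tau>_inj by auto
qed

lemma lattice_\<Lambda>': "is_lattice \<Lambda>' W"
proof -
  obtain \<sigma> where \<sigma>: "linear \<sigma>" "\<And>w. w \<in> W \<Longrightarrow> \<sigma> (\<tau> w) = w"
    using linear_exists_left_inverse_on[OF linear_\<tau> subspace_W] bij_\<tau> by (auto simp: bij_betw_def)
  have "inj_on \<sigma> V"
    by (rule inj_onI) (metis \<sigma>(2) \<tau>_surj)
  then have "is_lattice (\<sigma> ` \<Lambda>) (\<sigma> ` V)"
    by (rule is_lattice_image[OF lattice_\<Lambda> \<sigma>(1)])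
  moreover have "\<sigma> ` V = W"
    using \<sigma>(2) \<tau>_surj \<tau>_space by (metis (no_types, lifting) bij_\<tau> bij_betw_imp_surj_on image_cong image_ident image_image)
  moreover have "\<sigma> ` \<Lambda> = \<Lambda>'"
  proof (intro subset_antisym subsetI)
    fix w assume "w \<in> \<sigma> ` \<Lambda>"
    then obtain l where l: "l \<in> \<Lambda>" "w = \<sigma> l"
      by auto
    then obtain u where "u \<in> W" "\<tau> u = l"
      using \<tau>_surj \<Lambda>_subset by blast
    then show "w \<in> \<Lambda>'"
      using l \<sigma>(2) by auto
  next
    fix w assume "w \<in> \<Lambda>'"
    then show "w \<in> \<sigma> ` \<Lambda>"
      using \<sigma>(2) by (metis (mono_tags, lifting) imageI mem_Collect_eq)
  qed
  ultimately show ?thesis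
    by simp
qed

lemma zmodule_\<Lambda>': "zmodule \<Lambda>'"
  using lattice_\<Lambda>' by (rule is_lattice_zmodule)

lemma x_\<Lambda>': "x ` \<Lambda>' \<subseteq> \<Lambda>'"
  using x_space \<tau>_x \<alpha>_lattice by auto

lemma zmodule_L:
  assumes "d \<in> divisors n"
  shows "zmodule (L d)"
  unfolding zmodule_def
proof (intro conjI ballI)
  note 0 = linear_poly_act[OF linear_x, of "cyclotomic d"]
  show "0 \<in> L d"
    using zmoduleD(1)[OF zmodule_\<Lambda>'] linear_0[OF 0] by (simp add: L_eq[OF assms])
  show "u - v \<in> L d" if "u \<in> L d" "v \<in> L d" for u v
    using that zmoduleD(2)[OF zmodule_\<Lambda>', of u v] linear_diff[OF 0] by (simp add: L_eq[OF assms])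
qed

lemma x_L: "d \<in> divisors n \<Longrightarrow> x ` L d \<subseteq> L d"
  using x_\<Lambda>' by (auto simp: L_eq poly_act_commute[OF linear_x] linear_0[OF linear_x])

lemma lattice_L: "d \<in> divisors n \<Longrightarrow> is_lattice (L d) (span (L d))"
  by (rule is_lattice_submodule[OF lattice_\<Lambda>' zmodule_L]) (auto simp: L_eq)

lemma span_L:
  assumes d: "d \<in> divisors n"
  shows "span (L d) = {w \<in> W. poly_act (cyclotomic d) x w = 0}"
proof (intro subset_antisym subsetI)
  fix w assume w: "w \<in> span (L d)"
  then have "w \<in> W"
    using span_minimal[OF L_space[OF d] subspace_W] by auto
  moreover have "poly_act (cyclotomic d) x w = 0"
    by (rule linear_eq_0_on_span[OF linear_poly_act[OF linear_x] _ w]) (simp add: L_eq[OF d])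
  ultimately show "w \<in> {w \<in> W. poly_act (cyclotomic d) x w = 0}"
    by simp
next
  fix w assume w: "w \<in> {w \<in> W. poly_act (cyclotomic d) x w = 0}"
  then have "\<tau> w \<in> span (\<Lambda>_part d)"
    using \<tau>_space poly_act_eq_0_iff[of w] by (auto simp: span_\<Lambda>_part[OF d])
  also have "\<Lambda>_part d = \<tau> ` L d"
    by (simp add: \<tau>_L[OF d] \<Lambda>_part_def)
  also have "span (\<tau> ` L d) = \<tau> ` span (L d)"
    by (rule linear_span_image[OF linear_\<tau>])
  finally obtain u where "u \<in> span (L d)" "\<tau> w = \<tau> u"
    by auto
  moreover from this have "u \<in> W"
    using span_minimal[OF L_space[OF d] subspace_W] by auto
  ultimately show "w \<in> span (L d)"
    using w \<tau>_inj by auto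
qed

lemma \<tau>_span_L:
  assumes d: "d \<in> divisors n"
  shows "\<tau> ` span (L d) = {v \<in> V. poly_act (cyclotomic d) \<alpha> v = 0}"
proof (intro subset_antisym subsetI)
  fix v assume v: "v \<in> {v \<in> V. poly_act (cyclotomic d) \<alpha> v = 0}"
  then obtain w where w: "w \<in> W" "\<tau> w = v"
    using \<tau>_surj by blast
  then have "w \<in> span (L d)"
    using v by (auto simp: span_L[OF d] poly_act_eq_0_iff)
  then show "v \<in> \<tau> ` span (L d)"
    using w(2) by blast
qed (auto simp: span_L[OF d] poly_act_eq_0_iff \<tau>_space)

lemma clinear_poly_act: "clinear (poly_act p \<alpha>)"
proof (rule clinearI)
  have "(\<alpha> ^^ i) (a *s v) = a *s (\<alpha> ^^ i) v" for i a v
    by (induction i) (simp_all add: clinearD[OF clinear_\<alpha>])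
  then show "poly_act p \<alpha> (a *s v) = a *s poly_act p \<alpha> v" for a v
    by (simp add: poly_act_def vec.scale_sum_right scaleR_vec_complex vector_smult_assoc mult.commute)
qed (rule linear_add[OF linear_poly_act[OF linear_\<alpha>]])

lemma csubspace_\<tau>_span_L:
  assumes d: "d \<in> divisors n"
  shows "vec.subspace (\<tau> ` span (L d))"
  unfolding \<tau>_span_L[OF d]
  by (rule vec.subspaceI) (auto simp: csubspaceD[OF csubspace_V] clinearD[OF clinear_poly_act])

text \<open>Through \<tau> the span of L d is the kernel of Phi_d(\<alpha>) in V, a complex
  subspace.\<close>

lemma even_rank_L:
  assumes d: "d \<in> divisors n"
  shows "even (lattice_rank (L d))"
proof -
  have "inj_on \<tau> (span (L d))"
    using \<tau>_inj by (auto simp: span_L[OF d] inj_on_def)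
  then have "dim (\<tau> ` span (L d)) = dim (span (L d))"
    by (intro dim_image_eq[OF linear_\<tau>]) (simp add: span_span)
  then show ?thesis
    using even_dim_csubspace[OF csubspace_\<tau>_span_L[OF d]] lattice_rank_eq_dim[OF lattice_L[OF d]] by simp
qed

lemma torsion_free_L:
  assumes d: "d \<in> divisors n"
  shows "fg_torsion_free_module d (L d) x"
  unfolding fg_torsion_free_module_def
proof (intro conjI allI impI)
  have dpos: "d > 0"
    using d n_pos divisors_pos by blast
  show "0 \<in> L d" "\<forall>u\<in>L d. \<forall>v\<in>L d. u - v \<in> L d"
    using zmodule_L[OF d] by (simp_all add: zmodule_def)
  show "x ` L d \<subseteq> L d"
    by (rule x_L[OF d])
  show "\<forall>v\<in>L d. poly_act (cyclotomic d) x v = 0"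
    by (simp add: L_eq[OF d])
  show "v = 0" if "v \<in> L d \<and> \<not> cyclotomic d dvd p \<and> poly_act p x v = 0" for p v
    using that cyclotomic_kernel_torsion_free[OF linear_x dpos, of v p] by (simp add: L_eq[OF d])
  \<comment> \<open>A basis over \<int> also generates over \<int>[x], with constant polynomials as
    coefficients.\<close>
  obtain B where B: "finite B" "L d = int_span B"
    using is_lattice_finite_basis[OF lattice_L[OF d]] by metis
  have BL: "B \<subseteq> L d"
    using int_span_superset[OF B(1)] B(2) by simp
  have "L d = {\<Sum>f\<in>B. poly_act (p f) x f | p. True}"
  proof (intro subset_antisym subsetI)
    fix v assume "v \<in> L d"
    then obtain c where "v = (\<Sum>f\<in>B. of_int (c f) *\<^sub>R f)"
      by (auto simp: B(2) int_span_def)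
    then have "v = (\<Sum>f\<in>B. poly_act [:c f:] x f)"
      by (simp add: poly_act_const)
    then show "v \<in> {\<Sum>f\<in>B. poly_act (p f) x f | p. True}"
      by (intro CollectI exI[of _ "\<lambda>f. [:c f:]"]) simp
  next
    fix v assume "v \<in> {\<Sum>f\<in>B. poly_act (p f) x f | p. True}"
    then obtain p where "v = (\<Sum>f\<in>B. poly_act (p f) x f)"
      by blast
    then show "v \<in> L d"
      using BL by (auto intro!: zmodule_sum zmodule_poly_act zmodule_L[OF d] x_L[OF d] dest: subsetD)
  qed
  then show "\<exists>F. finite F \<and> F \<subseteq> L d \<and> L d = {\<Sum>f\<in>F. poly_act (p f) x f | p. True}"
    using B(1) BL by blast
qed

lemma span_L_direct_sum: "is_direct_sum (divisors n) (\<lambda>d. span (L d)) W"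
  unfolding is_direct_sum_def real_sum_def
proof (intro conjI allI impI ballI refl)
  fix u d assume u: "(\<forall>i\<in>divisors n. u i \<in> span (L i)) \<and> (\<Sum>i\<in>divisors n. u i) = 0" and d: "d \<in> divisors n"
  show "u d = 0"
    by (rule cyclotomic_kernels_independent[OF linear_x n_pos _ _ d]) (use u span_L in auto)
qed

lemma affine_power: "((\<lambda>v. \<alpha> v + (q - \<alpha> q + b)) ^^ k) (q + v) = q + ((\<alpha> ^^ k) v + of_nat k *\<^sub>R b)"
proof -
  have "((\<lambda>v. \<alpha> v + (q - \<alpha> q + b)) ^^ k) q = q + of_nat k *\<^sub>R b"
    by (induction k) (simp_all add: clinearD[OF clinear_\<alpha>] linear_scale[OF linear_\<alpha>] b(2) scaleR_add_left algebra_simps)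
  then show ?thesis
    by (simp add: affine_funpow_diff)
qed

lemma act_power_origin:
  assumes "v \<in> V"
  shows "t_act X (int k mod int n) (t_class X (q + v)) = t_class X (q + ((\<alpha> ^^ k) v + of_nat k *\<^sub>R b))"
  using act_power[of "q + v" k] assms q csubspaceD[OF csubspace_V] by (simp add: affine_power)

lemma n_b: "of_nat n *\<^sub>R b \<in> \<Lambda>"
  using act_power_origin[of 0 n] act_power_origin[of 0 0] csubspaceD(1)[OF csubspace_V]
    linear_0[OF linear_funpow[OF linear_\<alpha>]]
  by (simp add: class_eq_iff)

lemma M_subset: "M \<subseteq> \<Lambda>'"
proof
  fix w assume "w \<in> M"
  then obtain u where "w = (\<Sum>d\<in>divisors n. u d)" "\<And>d. d \<in> divisors n \<Longrightarrow> u d \<in> L d"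
    unfolding lat_sum_def sum_of_def by blast
  then show "w \<in> \<Lambda>'"
    using zmodule_sum[OF zmodule_\<Lambda>', of "divisors n" u] by (simp add: L_eq)
qed

lemma zmodule_M: "zmodule M"
  unfolding lat_sum_def by (rule zmodule_sum_of) (rule zmodule_L)

lemma cls_eq_iff: "cls n L u = cls n L v \<longleftrightarrow> u - v \<in> M"
  unfolding cls_def by (rule vclass_eq_iff[OF zmodule_M])

text \<open>The class determines w only up to M, but M is contained in the preimage of
  \<Lambda>.\<close>

lemma cls_sub_iff:
  assumes w: "w \<in> W"
  shows "cls n L w \<in> d_sub D \<longleftrightarrow> w \<in> \<Lambda>'"
proof
  assume "cls n L w \<in> d_sub D"
  then obtain u where u: "u \<in> \<Lambda>'" "cls n L w = cls n L u"
    unfolding sub by blast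
  then have "w - u \<in> \<Lambda>'"
    using M_subset cls_eq_iff by blast
  then have "(w - u) + u \<in> \<Lambda>'"
    using u(1) by (rule zmoduleD(4)[OF zmodule_\<Lambda>'])
  then show "w \<in> \<Lambda>'"
    by simp
qed (auto simp: sub)

end

text \<open>Forwards, the shift of the origin by q is absorbed into the translation part; backwards,
  this certifies the datum of a constructed manifold.\<close>

lemma datum_of_iff_torus_datum:
  assumes "n > 0" "complex_torus (t_space X) (t_lat X)"
    "group_action (integer_mod_group n) (carrier (t_torus X)) (t_act X)"
  shows "datum_of n X D \<longleftrightarrow> (\<exists>\<alpha> b q \<tau>. torus_datum n X D \<alpha> b q \<tau>)"
proof
  have V: "vec.subspace (t_space X)"
    using assms(2) by (simp add: complex_torus_def)
  assume "datum_of n X D"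
  then obtain \<alpha> b q \<tau> where
    *: "clinear \<alpha>" "\<alpha> ` t_space X \<subseteq> t_space X" "b \<in> t_space X" "\<alpha> b = b" "q \<in> t_space X"
      "\<forall>v\<in>t_space X. t_act X (1 mod int n) (t_class X (q + v)) = t_class X (q + (\<alpha> v + b))"
      "linear \<tau>" "bij_betw \<tau> (real_sum n (d_lat D)) (t_space X)" "linear (d_x D)"
      "\<forall>w\<in>real_sum n (d_lat D). d_x D w \<in> real_sum n (d_lat D) \<and> \<tau> (d_x D w) = \<alpha> (\<tau> w)"
      "\<forall>d\<in>divisors n. d_lat D d \<subseteq> real_sum n (d_lat D) \<and>
        \<tau> ` d_lat D d = {v \<in> t_lat X. poly_act (cyclotomic d) \<alpha> v = 0}"
      "d_sub D = {cls n (d_lat D) w | w. w \<in> real_sum n (d_lat D) \<and> \<tau> w \<in> t_lat X}"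
      "\<exists>w\<in>real_sum n (d_lat D). \<tau> w = b \<and> d_beta D = cls n (d_lat D) w"
      "\<forall>d\<in>divisors n. d_hodge D d = {z \<in> cspan (d_lat D d). cext \<tau> (vcnj z) = 0}"
    unfolding datum_of_def by (elim exE conjE) (rule that, assumption+)
  have "affine_torus n X \<alpha> (q - \<alpha> q + b)"
  proof (rule affine_torus.intro[OF assms(1-3) *(1)])
    show "\<alpha> v \<in> t_space X" if "v \<in> t_space X" for v
      using that *(2) by auto
    then show "q - \<alpha> q + b \<in> t_space X"
      using *(3,5) by (intro csubspaceD(2,4)[OF V])
    show "t_act X (1 mod int n) (t_class X v) = t_class X (\<alpha> v + (q - \<alpha> q + b))" if v: "v \<in> t_space X" for v
    proof -
      have "q + (\<alpha> (v - q) + b) = \<alpha> v + (q - \<alpha> q + b)" "q + (v - q) = v"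
        by (simp_all add: clinearD(4)[OF *(1)])
      then show ?thesis
        using *(6)[rule_format, OF csubspaceD(4)[OF V v *(5)]] by (simp only:)
    qed
  qed
  then have "torus_datum n X D \<alpha> b q \<tau>"
  proof (rule torus_datum.intro)
    show "d_x D w \<in> real_sum n (d_lat D)" "\<tau> (d_x D w) = \<alpha> (\<tau> w)" if "w \<in> real_sum n (d_lat D)" for w
      using bspec[OF *(10) that] by blast+
    show "d_lat D d \<subseteq> real_sum n (d_lat D)"
      "\<tau> ` d_lat D d = {v \<in> t_lat X. poly_act (cyclotomic d) \<alpha> v = 0}" if "d \<in> divisors n" for d
      using bspec[OF *(11) that] by blast+
    show "d_hodge D d = {z \<in> cspan (d_lat D d). cext \<tau> (vcnj z) = 0}" if "d \<in> divisors n" for d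
      using bspec[OF *(14) that] .
  qed (rule *(3-5,7-9,12,13))+
  then show "\<exists>\<alpha> b q \<tau>. torus_datum n X D \<alpha> b q \<tau>"
    by blast
next
  assume "\<exists>\<alpha> b q \<tau>. torus_datum n X D \<alpha> b q \<tau>"
  then obtain \<alpha> b q \<tau> where "torus_datum n X D \<alpha> b q \<tau>"
    by blast
  then interpret torus_datum n X D \<alpha> b q \<tau> .
  show "datum_of n X D"
    unfolding datum_of_def
  proof (intro exI conjI ballI)
    show "\<alpha> ` t_space X \<subseteq> t_space X"
      using \<alpha>_space by auto
    show "t_act X (1 mod int n) (t_class X (q + v)) = t_class X (q + (\<alpha> v + b))" if "v \<in> t_space X" for v
      using act_power_origin[OF that, of 1] by simp
    show "d_x D w \<in> real_sum n (d_lat D)" "\<tau> (d_x D w) = \<alpha> (\<tau> w)" if "w \<in> real_sum n (d_lat D)" for w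
      using that by (rule x_space, rule \<tau>_x)
    show "d_lat D d \<subseteq> real_sum n (d_lat D)"
      "\<tau> ` d_lat D d = {v \<in> t_lat X. poly_act (cyclotomic d) \<alpha> v = 0}"
      "d_hodge D d = {z \<in> cspan (d_lat D d). cext \<tau> (vcnj z) = 0}" if "d \<in> divisors n" for d
      using that by (rule L_space, rule \<tau>_L, rule hodge)
  qed (rule clinear_\<alpha> b q linear_\<tau> bij_\<tau> linear_x sub beta)+
qed

section \<open>Consequences of freeness: validity of the datum and the conditions (A), (B) and
  (C)\<close>

locale free_torus_datum = torus_datum +
  assumes free: "free_torus_quotient n X"
begin

text \<open>The second assumption says that \<gamma>^k fixes the class of q + v.\<close>

lemma fixed_point_free:
  assumes v: "v \<in> V" and k: "(\<alpha> ^^ k) v + of_nat k *\<^sub>R b - v \<in> \<Lambda>"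
  shows "n dvd k"
proof -
  let ?a = "t_class X (q + v)"
  have "t_act X (int k mod int n) ?a = ?a"
    using k unfolding act_power_origin[OF v] by (simp add: class_eq_iff algebra_simps)
  moreover have "int k mod int n \<in> carrier (integer_mod_group n)"
    using n_pos by (simp add: carrier_integer_mod_group)
  ultimately have "int k mod int n \<in> stabilizer (integer_mod_group n) (t_act X) ?a"
    by (simp add: stabilizer_def)
  moreover have "?a \<in> carrier (t_torus X)"
    using v q csubspaceD[OF csubspace_V] by (simp add: carrier_vquot)
  ultimately have "int k mod int n = 0"
    using free unfolding free_torus_quotient_def by simp
  then show ?thesis
    by (metis dvd_eq_mod_eq_0 int_dvd_int_iff)
qed

lemma b_eq_0_imp: "b = 0 \<Longrightarrow> n = 1"
  using fixed_point_free[of 0 1] csubspaceD(1)[OF csubspace_V] zmoduleD(1)[OF zmodule_\<Lambda>]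
  by (simp add: clinearD[OF clinear_\<alpha>])

lemma datum_modules: "datum_modules n L x"
proof -
  have one: "1 \<in> divisors n"
    by (simp add: divisors_def)
  have act1: "poly_act (cyclotomic 1) x w = x w - w" for w
    by (simp add: cyclotomic_1 poly_act_pCons del: One_nat_def)
  \<comment> \<open>If the part of index 1 were zero, b would vanish, \<gamma> would fix the class
    of q, and freeness would force n = 1. But then x is the identity on W, so W has only the part of
    index 1 and V = {0}.\<close>
  have "L 1 \<noteq> {0}"
  proof
    assume L1: "L 1 = {0}"
    then have span: "{w \<in> W. x w - w = 0} = {0}"
      using span_L[OF one] unfolding act1 by simp
    obtain w where w: "w \<in> W" "\<tau> w = b"
      using beta by auto
    then have "\<tau> (x w) = \<tau> w"
      using b(2) by (simp add: \<tau>_x)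
    then have "x w = w"
      using w(1) x_space \<tau>_inj by blast
    then have "w \<in> {w \<in> W. x w - w = 0}"
      using w(1) by simp
    then have "b = 0"
      using w(2) linear_0[OF linear_\<tau>] unfolding span by simp
    then have "n = 1"
      by (rule b_eq_0_imp)
    then have "W = {0}"
      using x_power_n span by auto
    then have "V = {0}"
      using bij_\<tau> linear_0[OF linear_\<tau>] by (auto simp: bij_betw_def)
    then show False
      using torus by (simp add: complex_torus_def)
  qed
  moreover have "2 dvd n \<Longrightarrow> 2 \<in> divisors n"
    by (simp add: divisors_def)
  ultimately show ?thesis
    unfolding datum_modules_def
    using linear_x torsion_free_L lattice_L span_L_direct_sum even_rank_L one by blast
qed

sublocale dl: datum_lattices n L x
  by unfold_locales (rule n_pos, rule datum_modules)

lemma sub_conv_image: "d_sub D = cls n L ` \<Lambda>'"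
  by (auto simp: sub)

lemma finite_subgroup_sub: "finite_subgroup n L (d_sub D)"
proof -
  have "subgroup (d_sub D) (A_prime n L)"
    unfolding sub_conv_image cls_def A_prime_def
    by (rule subgroup_vquotI[OF dl.zmodule_W dl.zmodule_M dl.M_subset_W zmodule_\<Lambda>']) auto
  moreover have "finite (d_sub D)"
  proof (rule finite_subset[OF _ dl.finite_torsion])
    \<comment> \<open>n w is the sum of its images under the polynomials
      \<open>proj_poly n d\<close>, which lie in the groups L d. So every class in
      \<open>d_sub D\<close> is killed by n.\<close>
    have "of_nat n *\<^sub>R w \<in> M" if w: "w \<in> \<Lambda>'" for w
    proof -
      have "poly_act (proj_poly n d) x w \<in> L d" if d: "d \<in> divisors n" for d
        using zmodule_poly_act[OF zmodule_\<Lambda>' x_\<Lambda>' w]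
          cyclotomic_proj_poly_act[OF linear_x n_pos d x_power_n] w by (simp add: L_eq[OF d])
      moreover have "of_nat n *\<^sub>R w = (\<Sum>d\<in>divisors n. poly_act (proj_poly n d) x w)"
        using sum_proj_poly_act[OF linear_x n_pos x_power_n] w by simp
      ultimately show ?thesis
        unfolding lat_sum_def by (intro sum_ofI)
    qed
    then show "d_sub D \<subseteq> cls n L ` {w. of_nat n *\<^sub>R w \<in> M}"
      unfolding sub_conv_image by blast
  qed
  ultimately show ?thesis
    by (simp add: finite_subgroup_def)
qed

lemma beta_lift:
  obtains w where "w \<in> span (L 1)" "\<tau> w = b" "d_beta D = cls n L w"
proof -
  obtain w where w: "w \<in> W" "\<tau> w = b" "d_beta D = cls n L w"
    using beta by auto
  then have "\<tau> (x w) = \<tau> w"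
    using b(2) by (simp add: \<tau>_x)
  then have "x w = w"
    using w(1) x_space \<tau>_inj by blast
  then have "w \<in> span (L 1)"
    using w(1) by (simp add: span_L[OF dl.one_divisor] cyclotomic_1 poly_act_pCons del: One_nat_def)
  then show ?thesis
    using that w by blast
qed

text \<open>As \<alpha> fixes 0, k b in \<Lambda> means that \<gamma>^k fixes the class of q. The
  integer k is reduced modulo n to reach a natural exponent.\<close>

lemma multiple_b_iff: "of_int k *\<^sub>R b \<in> \<Lambda> \<longleftrightarrow> int n dvd k"
proof
  assume k: "of_int k *\<^sub>R b \<in> \<Lambda>"
  let ?m = "nat (k mod int n)"
  have "of_int (k - int n * (k div int n)) *\<^sub>R b = of_int k *\<^sub>R b - of_int (k div int n) *\<^sub>R (of_nat n *\<^sub>R b)"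
    by (simp add: scaleR_diff_left mult.commute)
  also have "\<dots> \<in> \<Lambda>"
    by (rule zmoduleD(2)[OF zmodule_\<Lambda> k zmodule_scale[OF zmodule_\<Lambda> n_b]])
  also have "k - int n * (k div int n) = int ?m"
    using n_pos by (simp add: minus_mult_div_eq_mod)
  finally have "of_nat ?m *\<^sub>R b \<in> \<Lambda>"
    unfolding of_int_of_nat_eq .
  then have "n dvd ?m"
    using fixed_point_free[of 0 ?m] csubspaceD(1)[OF csubspace_V]
      linear_0[OF linear_funpow[OF linear_\<alpha>]] by simp
  then have "int n dvd k mod int n"
    using n_pos by (metis int_dvd_int_iff nat_int pos_mod_sign of_nat_0_less_iff nat_0_le)
  then show "int n dvd k"
    by (simp add: dvd_mod_iff)
next
  assume "int n dvd k"
  then obtain j where "k = j * int n"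
    by (metis dvdE mult.commute)
  then show "of_int k *\<^sub>R b \<in> \<Lambda>"
    using zmodule_scale[OF zmodule_\<Lambda> n_b, of j] by simp
qed

lemma card_generate_beta: "card (generate (A_prime n L) {d_beta D}) = n"
proof -
  obtain w where w: "w \<in> span (L 1)" "\<tau> w = b" "d_beta D = cls n L w"
    by (rule beta_lift)
  have wW: "w \<in> W"
    using w(1) dl.span_L_subset[OF dl.one_divisor] by auto
  have "of_int k *\<^sub>R w \<in> M \<longleftrightarrow> int n dvd k" for k
  proof -
    have k: "of_int k *\<^sub>R w \<in> span (L 1)"
      using w(1) by (rule span_scale)
    then have "of_int k *\<^sub>R w \<in> M \<longleftrightarrow> of_int k *\<^sub>R w \<in> L 1"
      by (rule dl.M_Int_span[OF dl.one_divisor])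
    also have "\<dots> \<longleftrightarrow> of_int k *\<^sub>R b \<in> \<Lambda>"
      using k span_L[OF dl.one_divisor] L_eq[OF dl.one_divisor] w(2) by (auto simp: linear_scale[OF linear_\<tau>])
    finally show ?thesis
      by (simp add: multiple_b_iff)
  qed
  then show ?thesis
    using dl.card_generate_cls[OF wW] w(3) by simp
qed

lemma cext_\<tau>_vcnj: "cext \<tau> (vcnj z) = \<tau> (vRe z) - \<i> *s \<tau> (vIm z)"
  by (rule cext_vcnj[OF linear_\<tau>])

text \<open>Let J be multiplication by i on V, carried to span (L d) by \<tau>. The kernel condition
  says Re z = J (Im z), so H is the eigenspace of J for i in the complexification, and its conjugate
  the one for -i.\<close>

lemma hodge_datum:
  assumes d: "d \<in> divisors n"
  shows "hodge_decomposition (L d) x (d_hodge D d)"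
proof -
  let ?H = "d_hodge D d"
  have H: "z \<in> ?H \<longleftrightarrow> vRe z \<in> span (L d) \<and> vIm z \<in> span (L d) \<and> \<tau> (vRe z) = \<i> *s \<tau> (vIm z)" for z
    by (auto simp: hodge[OF d] mem_cspan_iff cext_\<tau>_vcnj)
  have i2: "\<i> *s (\<i> *s v) = - v" for v :: "complex^'m"
    by (simp add: vector_smult_assoc)
  have "vec.subspace ?H"
  proof (rule csubspaceI)
    show "subspace ?H"
    proof (rule subspaceI)
      show "0 \<in> ?H"
        by (simp add: H linear_0[OF linear_vRe] linear_0[OF linear_vIm] linear_0[OF linear_\<tau>] span_zero)
      show "u + v \<in> ?H" if "u \<in> ?H" "v \<in> ?H" for u v
        using that by (simp add: H linear_add[OF linear_vRe] linear_add[OF linear_vIm]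
            linear_add[OF linear_\<tau>] span_add vector_add_ldistrib)
      show "r *\<^sub>R u \<in> ?H" if "u \<in> ?H" for r u
        using that unfolding H linear_scale[OF linear_vRe] linear_scale[OF linear_vIm] linear_scale[OF linear_\<tau>]
        by (simp add: span_scale scaleR_vec_complex vector_smult_assoc mult.commute)
    qed
    show "\<i> *s v \<in> ?H" if "v \<in> ?H" for v
      using that by (simp add: H span_neg linear_neg[OF linear_\<tau>] i2)
  qed
  moreover have "cact x ` ?H \<subseteq> ?H"
  proof
    fix z assume "z \<in> cact x ` ?H"
    then obtain h where h: "h \<in> ?H" "z = cact x h"
      by auto
    have "vRe h \<in> W" "vIm h \<in> W"
      using h(1) dl.span_L_subset[OF d] by (auto simp: H)
    then show "z \<in> ?H"
      using h(1) dl.x_span[OF d] unfolding h(2)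
      by (auto simp: H vRe_cact[OF linear_x] vIm_cact[OF linear_x] \<tau>_x clinearD[OF clinear_\<alpha>])
  qed
  moreover have "z \<in> cspan (L d) \<longleftrightarrow> (\<exists>h\<in>?H. \<exists>h'\<in>?H. z = h + vcnj h')" for z
  proof
    assume "z \<in> cspan (L d)"
    then have z: "vRe z \<in> span (L d)" "vIm z \<in> span (L d)"
      by (auto simp: mem_cspan_iff)
    have J: "\<exists>y\<in>span (L d). \<tau> y = \<i> *s \<tau> w" if "w \<in> span (L d)" for w
      using csubspaceD(3)[OF csubspace_\<tau>_span_L[OF d], of "\<tau> w" \<i>] that by (metis imageE imageI)
    obtain y1 y2 where y: "y1 \<in> span (L d)" "\<tau> y1 = \<i> *s \<tau> (vRe z)" "y2 \<in> span (L d)" "\<tau> y2 = \<i> *s \<tau> (vIm z)"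
      using J[OF z(1)] J[OF z(2)] by blast
    \<comment> \<open>With J z = \<open>y1\<close> + i \<open>y2\<close>, the vector h is (z - i J
      z) / 2 and the conjugate of h' is (z + i J z) / 2.\<close>
    define h where "h = (1 / 2) *\<^sub>R (cvec (vRe z + y2) + \<i> *s cvec (vIm z - y1))"
    define h' where "h' = (1 / 2) *\<^sub>R (cvec (vRe z - y2) - \<i> *s cvec (vIm z + y1))"
    have parts: "vRe h = (1 / 2) *\<^sub>R (vRe z + y2)" "vIm h = (1 / 2) *\<^sub>R (vIm z - y1)"
      "vRe h' = (1 / 2) *\<^sub>R (vRe z - y2)" "vIm h' = - ((1 / 2) *\<^sub>R (vIm z + y1))"
      by (simp_all add: h_def h'_def linear_scale[OF linear_vRe] linear_scale[OF linear_vIm]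
          linear_add[OF linear_vRe] linear_add[OF linear_vIm] linear_diff[OF linear_vRe] linear_diff[OF linear_vIm])
        (simp add: vec_eq_iff algebra_simps)
    have "h \<in> ?H"
      unfolding H parts using z y
      by (simp add: span_scale span_add span_diff linear_scale[OF linear_\<tau>] linear_add[OF linear_\<tau>]
          linear_diff[OF linear_\<tau>] vec_eq_iff scaleR_conv_of_real[where 'a = complex] algebra_simps)
    moreover have "h' \<in> ?H"
      unfolding H parts using z y
      by (simp add: span_scale span_neg span_add span_diff linear_neg[OF linear_\<tau>] linear_scale[OF linear_\<tau>] linear_add[OF linear_\<tau>]
          linear_diff[OF linear_\<tau>] vec_eq_iff scaleR_conv_of_real[where 'a = complex] algebra_simps)
    moreover have "z = h + vcnj h'"
      by (rule vRe_vIm_eqI)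
        (simp_all add: linear_add[OF linear_vRe] linear_add[OF linear_vIm] parts scaleR_add_right
          scaleR_diff_right flip: scaleR_add_left)
    ultimately show "\<exists>h\<in>?H. \<exists>h'\<in>?H. z = h + vcnj h'"
      by blast
  next
    assume "\<exists>h\<in>?H. \<exists>h'\<in>?H. z = h + vcnj h'"
    then show "z \<in> cspan (L d)"
      by (auto simp: H mem_cspan_iff linear_add[OF linear_vRe] linear_add[OF linear_vIm] span_add span_diff)
  qed
  moreover have "h = 0 \<and> h' = 0" if h: "h \<in> ?H" "h' \<in> ?H" "h + vcnj h' = 0" for h h'
  proof -
    have W: "vRe h \<in> W" "vIm h \<in> W" "0 \<in> W"
      using h(1) dl.span_L_subset[OF d] subspace_0[OF subspace_W] by (auto simp: H)
    have "vRe h + vRe h' = 0" "vIm h - vIm h' = 0"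
      using arg_cong[OF h(3), of vRe] arg_cong[OF h(3), of vIm]
      by (simp_all add: linear_add[OF linear_vRe] linear_add[OF linear_vIm] linear_0[OF linear_vRe] linear_0[OF linear_vIm])
    then have e: "vRe h' = - vRe h" "vIm h' = vIm h"
      by (simp_all add: add_eq_0_iff)
    then have "\<tau> (vRe h) = \<i> *s \<tau> (vIm h)" "- \<tau> (vRe h) = \<i> *s \<tau> (vIm h)"
      using h(1,2) by (simp_all add: H linear_neg[OF linear_\<tau>])
    then have eqs: "\<tau> (vRe h) $ i = \<i> * \<tau> (vIm h) $ i" "- \<tau> (vRe h) $ i = \<i> * \<tau> (vIm h) $ i" for i
      by (metis vector_smult_component, metis vector_smult_component vector_uminus_component)
    have "2 * (\<i> * \<tau> (vIm h) $ i) = 0" for i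
      using eqs[of i] by (metis add.right_inverse mult_2)
    then have "\<tau> (vIm h) = 0"
      by (simp add: vec_eq_iff)
    moreover from this have "\<tau> (vRe h) = 0"
      using eqs(1) by (simp add: vec_eq_iff)
    ultimately have "\<tau> (vRe h) = \<tau> 0" "\<tau> (vIm h) = \<tau> 0"
      by (simp_all add: linear_0[OF linear_\<tau>])
    then have "vRe h = 0" "vIm h = 0"
      using W \<tau>_inj by blast+
    then show ?thesis
      using e vRe_vIm_eqI[of h 0] vRe_vIm_eqI[of h' 0]
      by (simp add: linear_0[OF linear_vRe] linear_0[OF linear_vIm])
  qed
  ultimately show ?thesis
    unfolding hodge_decomposition_iff by blast
qed

lemma valid: "valid_datum n D"
  unfolding valid_datum_def
proof (intro conjI ballI)
  show "d_beta D \<in> A_sub n L 1"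
    by (rule beta_lift) (auto simp: A_sub_def)
qed (rule datum_modules finite_subgroup_sub card_generate_beta hodge_datum; assumption?)+

lemma cond_A: "cond_A n L x (d_sub D)"
  unfolding cond_A_def using cls_sub_iff x_\<Lambda>' x_space by blast

lemma cond_B: "cond_B n L (d_sub D)"
proof -
  have "M \<in> d_sub D"
    using cls_sub_iff[OF subspace_0[OF subspace_W]] zmoduleD(1)[OF zmodule_\<Lambda>'] dl.cls_eq_M_iff[of 0]
      zmoduleD(1)[OF dl.zmodule_M] by simp
  moreover have "w \<in> L d" if "d \<in> divisors n" "w \<in> span (L d)" "cls n L w \<in> d_sub D" for d w
  proof -
    have "w \<in> W" "poly_act (cyclotomic d) x w = 0"
      using that(2) span_L[OF that(1)] by auto
    then show ?thesis
      using that(3) cls_sub_iff[of w] L_eq[OF that(1)] by simp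
  qed
  ultimately show ?thesis
    by (simp add: dl.cond_B_iff)
qed

text \<open>x^k - 1 maps span (L d) into itself and is injective there, since only 0 is fixed by
  x^k; so it is surjective for reasons of dimension.\<close>

lemma surj_minus_1:
  assumes d: "d \<in> divisors n" and k: "\<not> d dvd k" and u: "u \<in> span (L d)"
  obtains v where "v \<in> span (L d)" "(x ^^ k) v - v = u"
proof -
  let ?f = "\<lambda>v. (x ^^ k) v - v"
  have lin: "linear ?f"
    by (intro linear_compose_sub linear_funpow linear_x linear_ident)
  have dpos: "d > 0"
    using d n_pos divisors_pos by blast
  have sub: "?f ` span (L d) \<subseteq> span (L d)"
    using zmodule_funpow[OF dl.x_span[OF d]] by (auto intro: span_diff)
  have inj: "inj_on ?f (span (L d))"
  proof (rule inj_onI)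
    fix v w assume vw: "v \<in> span (L d)" "w \<in> span (L d)" "?f v = ?f w"
    have "(x ^^ k) (v - w) = v - w"
      using vw(3) by (simp add: linear_diff[OF linear_funpow[OF linear_x]] algebra_simps)
    moreover have "poly_act (cyclotomic d) x (v - w) = 0"
      by (rule dl.cyclotomic_L[OF d span_diff[OF vw(1,2)]])
    ultimately have "v - w = 0"
      using cyclotomic_kernel_fixed_point[OF linear_x dpos _ _ k] by blast
    then show "v = w"
      by simp
  qed
  have "dim (?f ` span (L d)) = dim (span (L d))"
    using inj by (intro dim_image_eq[OF lin]) (simp add: span_span)
  then have "?f ` span (L d) = span (L d)"
    using sub by (intro subspace_dim_equal linear_subspace_image[OF lin] subspace_span) auto
  then show ?thesis
    using that u by (metis (no_types, lifting) imageE)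
qed

text \<open>The fixed point argument for (C). Suppose \<open>(n / p) b\<close> is congruent to an element \<open>\<mu>\<close> without
  component in \<open>V(1)\<close>. The components of \<open>\<mu>\<close> in \<open>V(d)\<close> with \<open>d\<close> not dividing \<open>n / p\<close> can be moved
  away by a translation, and those with \<open>d\<close> dividing \<open>n / p = p\<^sup>a m\<close>, \<open>d\<close> not a power of \<open>p\<close>, are
  killed by \<open>(x\<^sup>n\<^sup>/\<^sup>p - 1) / (x\<^sup>q - 1)\<close> with \<open>q = p\<^sup>a\<close>, which multiplies \<open>b\<close> by \<open>m\<close>, a number
  prime to \<open>p\<close>.\<close>

lemma no_translation_class:
  assumes \<beta>: "\<beta> \<in> W" "\<tau> \<beta> = b" and \<mu>: "\<mu> \<in> W" "of_nat k *\<^sub>R \<beta> + \<mu> \<in> \<Lambda>'"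
    and comp: "\<And>d. d \<in> divisors n \<Longrightarrow> d dvd k \<Longrightarrow> dl.comp d \<mu> = 0"
  shows "n dvd k"
proof -
  have "\<exists>v\<in>span (L d). (x ^^ k) v - v = dl.comp d \<mu>" if d: "d \<in> divisors n" for d
  proof (cases "d dvd k")
    case True
    then show ?thesis
      using comp[OF d] linear_0[OF linear_funpow[OF linear_x]] span_zero by (intro bexI[of _ 0]) auto
  next
    case False
    show ?thesis
      using surj_minus_1[OF d False dl.W_cases(2)[OF \<mu>(1) d]] by blast
  qed
  then obtain v where v: "\<And>d. d \<in> divisors n \<Longrightarrow> v d \<in> span (L d)"
      "\<And>d. d \<in> divisors n \<Longrightarrow> (x ^^ k) (v d) - v d = dl.comp d \<mu>"
    by metis
  define w where "w = (\<Sum>d\<in>divisors n. v d)"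
  have wW: "w \<in> W"
    unfolding w_def using v(1) dl.span_L_subset by (auto intro!: subspace_sum subspace_W)
  have "(x ^^ k) w - w = (\<Sum>d\<in>divisors n. dl.comp d \<mu>)"
    using v(2) by (simp add: w_def linear_sum[OF linear_funpow[OF linear_x]] flip: sum_subtractf)
  then have "(x ^^ k) w - w = \<mu>"
    using dl.W_cases(1)[OF \<mu>(1)] by simp
  then have "\<tau> ((x ^^ k) w - w + of_nat k *\<^sub>R \<beta>) \<in> \<Lambda>"
    using \<mu>(2) by (simp add: add.commute)
  then have "(\<alpha> ^^ k) (\<tau> w) + of_nat k *\<^sub>R b - \<tau> w \<in> \<Lambda>"
    using \<tau>_funpow[OF wW] \<beta>(2)
    by (simp add: linear_add[OF linear_\<tau>] linear_diff[OF linear_\<tau>] linear_scale[OF linear_\<tau>] algebra_simps)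
  then show ?thesis
    using fixed_point_free[OF \<tau>_space[OF wW]] by blast
qed

text \<open>Here f is (x^N - 1) / (x^Q - 1), written as a geometric sum. It maps N \<beta> + \<mu>
  to m N \<beta> + f \<mu>, and f \<mu> has no component of an index dividing m N. So
  \<open>no_translation_class\<close> gives n dvd m N, that is p dvd m.\<close>

lemma prime_case:
  assumes crit: "no_critical_prime_powers n L" and \<beta>: "\<beta> \<in> W" "\<tau> \<beta> = b" "x \<beta> = \<beta>"
    and p: "prime p" "n = p * N" and \<mu>: "\<mu> \<in> W" "of_nat N *\<^sub>R \<beta> + \<mu> \<in> \<Lambda>'" "dl.comp 1 \<mu> = 0"
  shows False
proof -
  have N0: "N > 0"
    using p(2) n_pos by (cases N) auto
  define a where "a = multiplicity p N"
  obtain m where m: "N = p ^ a * m" "\<not> p dvd m"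
    using multiplicity_decompose'[of N p] N0 not_prime_1 p(1) unfolding a_def by (metis One_nat_def less_irrefl nat_dvd_1_iff_1)
  define Q where "Q = p ^ a"
  define f where "f w = (\<Sum>i<m. (x ^^ (i * Q)) w)" for w
  have lin: "linear f"
    unfolding f_def [abs_def] by (intro linear_compose_sum ballI linear_funpow linear_x)
  have f\<beta>: "f \<beta> = of_nat m *\<^sub>R \<beta>"
  proof -
    have "(x ^^ i) \<beta> = \<beta>" for i
      by (induction i) (simp_all add: \<beta>(3))
    then show ?thesis
      by (simp add: f_def sum_constant_scaleR del: sum_constant)
  qed
  have f\<Lambda>': "f w \<in> \<Lambda>'" if "w \<in> \<Lambda>'" for w
    unfolding f_def using that by (intro zmodule_sum[OF zmodule_\<Lambda>'] zmodule_funpow[OF x_\<Lambda>'])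
  have fW: "f w \<in> W" if "w \<in> W" for w
    unfolding f_def using that by (intro subspace_sum[OF subspace_W] zmodule_funpow[OF x_image])
  have fL: "f w \<in> span (L d)" if "d \<in> divisors n" "w \<in> span (L d)" for w d
    unfolding f_def using that by (intro span_sum zmodule_funpow[OF dl.x_span])
  have shift: "(x ^^ Q) (f w) = f w + ((x ^^ (m * Q)) w - w)" for w
  proof -
    have "(x ^^ Q) (f w) = (\<Sum>i<m. (x ^^ (Suc i * Q)) w)"
      by (simp add: f_def linear_sum[OF linear_funpow[OF linear_x]] funpow_add)
    also have "\<dots> = (\<Sum>i<Suc m. (x ^^ (i * Q)) w) - w"
      by (subst sum.lessThan_Suc_shift) simp
    finally show ?thesis
      by (simp add: f_def)
  qed
  have "of_nat (m * N) *\<^sub>R \<beta> + f \<mu> = f (of_nat N *\<^sub>R \<beta> + \<mu>)"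
    by (simp add: linear_add[OF lin] linear_scale[OF lin] f\<beta> mult.commute)
  then have mem: "of_nat (m * N) *\<^sub>R \<beta> + f \<mu> \<in> \<Lambda>'"
    using f\<Lambda>'[OF \<mu>(2)] by simp
  have "dl.comp d (f \<mu>) = 0" if d: "d \<in> divisors n" "d dvd m * N" for d
  proof -
    have c: "dl.comp e \<mu> \<in> span (L e)" if "e \<in> divisors n" for e
      using dl.W_cases(2)[OF \<mu>(1) that] .
    have "f \<mu> = (\<Sum>e\<in>divisors n. f (dl.comp e \<mu>))"
      using dl.W_cases(1)[OF \<mu>(1)] linear_sum[OF lin, of "\<lambda>e. dl.comp e \<mu>" "divisors n"] by simp
    then have fc: "dl.comp d (f \<mu>) = f (dl.comp d \<mu>)"
      using dl.comp_sum[OF d(1), of "\<lambda>e. f (dl.comp e \<mu>)"] fL c by simp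
    have dpos: "d > 0"
      using d(1) n_pos divisors_pos by blast
    have "coprime p m"
      using m(2) p(1) by (simp add: prime_imp_coprime)
    \<comment> \<open>The index d divides both n = p N and m N, hence N; so x^N fixes the component
      of index d.\<close>
    then have "gcd (p * N) (m * N) = N"
      by (metis coprime_imp_gcd_eq_1 gcd_mult_distrib_nat mult.commute mult_1_right)
    then have dN: "d dvd N"
      using d p(2) by (metis (mono_tags, lifting) divisors_def gcd_greatest mem_Collect_eq)
    show ?thesis
    \<comment> \<open>If d divides Q = p^a, it is 1 or a power p^j for which p^(j+1) divides n, so
      that L d = {0}. Otherwise x^Q fixes f u, because (x^Q - 1) f = x^N - 1, and in this part x^Q
      fixes only 0.\<close>
    proof (cases "d dvd Q")
      case True
      then obtain j where j: "d = p ^ j" "j \<le> a"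
        using divides_primepow_nat[OF p(1)] by (auto simp: Q_def)
      show ?thesis
      proof (cases "j = 0")
        case True
        then show ?thesis
          using fc j(1) \<mu>(3) linear_0[OF lin] by simp
      next
        case False
        have "p ^ Suc j dvd p ^ Suc a"
          using j(2) by (intro le_imp_power_dvd) simp
        also have "p ^ Suc a dvd n"
          by (simp add: p(2) m(1) mult.assoc)
        finally have "L d = {0}"
          using crit False p(1) j(1) by (auto simp: no_critical_prime_powers_def)
        then have "dl.comp d \<mu> = 0"
          using c[OF d(1)] by simp
        then show ?thesis
          using fc linear_0[OF lin] by simp
      qed
    next
      case False
      let ?u = "dl.comp d \<mu>"
      have "(x ^^ N) ?u = ?u"
        using cyclotomic_kernel_periodic[OF linear_x N0 _ dl.cyclotomic_L[OF d(1) c[OF d(1)]]] dN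
        by (simp add: divisors_def)
      then have "(x ^^ Q) (f ?u) = f ?u"
        using shift[of ?u] m(1) by (simp add: Q_def mult.commute)
      then have "f ?u = 0"
        by (rule cyclotomic_kernel_fixed_point[OF linear_x dpos dl.cyclotomic_L[OF d(1) fL[OF d(1) c[OF d(1)]]] _ False])
      then show ?thesis
        using fc by simp
    qed
  qed
  then have "n dvd m * N"
    by (rule no_translation_class[OF \<beta>(1,2) fW[OF \<mu>(1)] mem])
  then show False
    using m(2) N0 p(2) by simp
qed

text \<open>A nontrivial common element is the class of k \<beta> with n not dividing k, and k
  \<beta> is modulo M the component of index 1 of some lattice vector w. A suitable multiple
  replaces k by n / p for a prime p, the situation of \<open>prime_case\<close>.\<close>

lemma cond_C:
  assumes crit: "no_critical_prime_powers n L"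
  shows "cond_C n L (d_sub D) (d_beta D)"
proof -
  obtain \<beta> where \<beta>: "\<beta> \<in> span (L 1)" "\<tau> \<beta> = b" "d_beta D = cls n L \<beta>"
    by (rule beta_lift)
  have \<beta>W: "\<beta> \<in> W"
    using \<beta>(1) dl.span_L_subset[OF dl.one_divisor] by auto
  have x\<beta>: "x \<beta> = \<beta>"
    using dl.cyclotomic_L[OF dl.one_divisor \<beta>(1)] by (simp add: cyclotomic_1 poly_act_pCons del: One_nat_def)
  have n\<beta>: "of_int (c * int n) *\<^sub>R \<beta> \<in> \<Lambda>'" for c
    using \<beta>W multiple_b_iff[of "c * int n"] subspace_scale[OF subspace_W \<beta>W]
    by (simp add: linear_scale[OF linear_\<tau>] \<beta>(2))
  have key: "int n dvd k" if w: "w \<in> \<Lambda>'" and k: "dl.comp 1 w - of_int k *\<^sub>R \<beta> \<in> M" for w k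
  proof (rule ccontr)
    assume nk: "\<not> int n dvd k"
    let ?w = "w - (dl.comp 1 w - of_int k *\<^sub>R \<beta>)"
    \<comment> \<open>w without its component of index 1, so that k \<beta> + \<mu> agrees with w
      modulo M.\<close>
    define \<mu> where "\<mu> = w - dl.comp 1 w"
    have W1: "dl.comp 1 w \<in> span (L 1)"
      using w dl.W_cases(2) dl.one_divisor by simp
    have \<mu>W: "\<mu> \<in> W"
      unfolding \<mu>_def using w W1 dl.span_L_subset[OF dl.one_divisor] by (auto intro: subspace_diff[OF subspace_W])
    have \<mu>1: "dl.comp 1 \<mu> = 0"
      using dl.comp_component[OF dl.one_divisor dl.one_divisor W1] linear_diff[OF dl.linear_comp] by (simp add: \<mu>_def)
    have mem: "of_int k *\<^sub>R \<beta> + \<mu> \<in> \<Lambda>'"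
      using zmoduleD(2)[OF zmodule_\<Lambda>' w subsetD[OF M_subset k]] by (simp add: \<mu>_def algebra_simps)
    \<comment> \<open>g is a proper divisor of n, so n / g has a prime factor p, and N = n / p is a
      multiple of g.\<close>
    define g where "g = gcd k (int n)"
    have g: "g > 0" "g dvd int n" "g \<noteq> int n"
      using n_pos nk by (auto simp: g_def) (metis gcd_dvd1)
    obtain h where h: "int n = g * h"
      using g(2) by (rule dvdE)
    have "h > 1"
      using h g n_pos by (smt (verit) mult_cancel_left1 mult_less_0_iff mult_zero_right of_nat_0_less_iff zero_less_mult_iff)
    then have "nat h \<noteq> 1"
      by linarith
    then obtain p where p: "prime p" "p dvd nat h"
      using prime_factor_nat by blast
    then obtain s where s: "nat h = p * s"
      by (auto elim: dvdE)
    then have hs: "h = int p * int s"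
      using \<open>h > 1\<close> by (metis int_nat_eq less_imp_le less_trans of_nat_mult zero_less_one)
    define N where "N = nat g * s"
    have "int n = int (p * N)"
      using h hs g(1) by (simp add: N_def)
    then have nN: "n = p * N"
      by (simp only: of_nat_eq_iff)
    obtain c e where ce: "c * k + e * int n = g"
      using bezout_int[of k "int n"] unfolding g_def by blast
    \<comment> \<open>Multiplied by s, the relation c k + e n = g expresses N = g s through k and n,
      and n \<beta> is a lattice vector.\<close>
    let ?t = "int s * c"
    have "of_int ?t *\<^sub>R (of_int k *\<^sub>R \<beta> + \<mu>) + of_int (int s * e * int n) *\<^sub>R \<beta> \<in> \<Lambda>'"
      by (rule zmoduleD(4)[OF zmodule_\<Lambda>' zmodule_scale[OF zmodule_\<Lambda>' mem] n\<beta>])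
    also have "of_int ?t *\<^sub>R (of_int k *\<^sub>R \<beta> + \<mu>) + of_int (int s * e * int n) *\<^sub>R \<beta>
        = of_int (int s * (c * k + e * int n)) *\<^sub>R \<beta> + of_int ?t *\<^sub>R \<mu>"
      by (simp add: algebra_simps)
    also have "int s * (c * k + e * int n) = int N"
      using g(1) unfolding ce by (simp add: N_def)
    finally have "of_nat N *\<^sub>R \<beta> + of_int ?t *\<^sub>R \<mu> \<in> \<Lambda>'"
      by simp
    moreover have "of_int ?t *\<^sub>R \<mu> \<in> W"
      by (rule subspace_scale[OF subspace_W \<mu>W])
    moreover have "dl.comp 1 (of_int ?t *\<^sub>R \<mu>) = 0"
      unfolding linear_scale[OF dl.linear_comp] \<mu>1 by simp
    ultimately show False
      using prime_case[OF crit \<beta>W \<beta>(2) x\<beta> p(1) nN] by blast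
  qed
  have "a = M" if a: "a \<in> projection_A1 n L (d_sub D)" "a \<in> generate (A_prime n L) {d_beta D}" for a
  proof -
    obtain w where w: "w \<in> W" "cls n L w \<in> d_sub D" "a = cls n L (dl.comp 1 w)"
      using a(1) by (auto simp: dl.projection_A1_eq)
    obtain k :: int where k: "a = cls n L (of_int k *\<^sub>R \<beta>)"
      using a(2) dl.generate_cls[OF \<beta>W] \<beta>(3) by auto
    have "dl.comp 1 w - of_int k *\<^sub>R \<beta> \<in> M"
      using w(3) k by (metis dl.cls_eq_iff)
    then have "int n dvd k"
      using key[of w k] w cls_sub_iff by blast
    then have "of_int k *\<^sub>R \<beta> \<in> M"
      using dl.card_generate_cls[OF \<beta>W] card_generate_beta \<beta>(3) by simp
    then show ?thesis
      using k dl.cls_eq_M_iff by simp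
  qed
  moreover have "M \<in> projection_A1 n L (d_sub D)"
  proof -
    have "0 \<in> {w \<in> W. cls n L w \<in> d_sub D}"
      using cls_sub_iff zmoduleD(1)[OF zmodule_\<Lambda>'] by auto
    moreover have "cls n L (dl.comp 1 0) = M"
      using dl.cls_eq_M_iff zmoduleD(1)[OF dl.zmodule_M] linear_0[OF dl.linear_comp] by simp
    ultimately show ?thesis
      unfolding dl.projection_A1_eq by (metis (no_types, lifting) imageI)
  qed
  moreover have "M \<in> generate (A_prime n L) {d_beta D}"
    using generate.one[of "A_prime n L" "{d_beta D}"] by (simp add: dl.one_A_prime)
  ultimately show ?thesis
    unfolding cond_C_def dl.one_A_prime by blast
qed

end

section \<open>From data to manifolds\<close>

text \<open>That \<gamma>^m maps cosets onto cosets, and not only into them, rests on \<alpha>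
  permuting \<Lambda>; inverses are natural powers because \<alpha>^n = 1 on V.\<close>

lemma affine_cyclic_action:
  fixes V \<Lambda> :: "(complex^'k) set"
  assumes n: "n > 0" and torus: "complex_torus V \<Lambda>" and \<alpha>: "clinear \<alpha>"
    and \<alpha>V: "\<And>v. v \<in> V \<Longrightarrow> \<alpha> v \<in> V" and \<alpha>\<Lambda>: "\<And>l. l \<in> \<Lambda> \<Longrightarrow> \<alpha> l \<in> \<Lambda>"
    and \<alpha>n: "\<And>v. v \<in> V \<Longrightarrow> (\<alpha> ^^ n) v = v" and b: "b \<in> V" "\<alpha> b = b" "of_nat n *\<^sub>R b \<in> \<Lambda>"
  defines "act \<equiv> \<lambda>g. restrict (\<lambda>a. ((\<lambda>z. \<alpha> z + b) ^^ nat g) ` a) (carrier (vquot V \<Lambda>))"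
  shows "group_action (integer_mod_group n) (carrier (vquot V \<Lambda>)) act"
    and "\<And>g z. g \<ge> 0 \<Longrightarrow> z \<in> V \<Longrightarrow>
      act g (vclass V \<Lambda> z) = vclass V \<Lambda> ((\<alpha> ^^ nat g) z + of_nat (nat g) *\<^sub>R b)"
    and "\<And>g. g \<ge> 0 \<Longrightarrow> holomorphic_map V (vclass V \<Lambda>) V (vclass V \<Lambda>) (act g)"
proof -
  have V: "vec.subspace V" and lat: "is_lattice \<Lambda> V"
    using torus by (auto simp: complex_torus_def)
  have sV: "subspace V"
    using V by (rule csubspace_imp_subspace)
  have zL: "zmodule \<Lambda>" and LV: "\<Lambda> \<subseteq> V"
    using lat is_lattice_zmodule is_lattice_subset by blast+
  have lin: "linear (\<alpha> ^^ m)" and clin: "clinear (\<alpha> ^^ m)" for m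
  proof -
    show "clinear (\<alpha> ^^ m)"
      by (induction m) (auto intro!: clinearI simp: clinearD[OF \<alpha>] vec.linear_add vec.linear_scale)
    then show "linear (\<alpha> ^^ m)"
      by (rule clinear_imp_linear)
  qed
  have powV: "(\<alpha> ^^ m) v \<in> V" if "v \<in> V" for m v
    using that by (induction m) (auto simp: \<alpha>V)
  have powL: "(\<alpha> ^^ m) l \<in> \<Lambda>" if "l \<in> \<Lambda>" for m l
    using that by (induction m) (auto simp: \<alpha>\<Lambda>)
  have per: "(\<alpha> ^^ (m * n)) v = v" if "v \<in> V" for m v
    using periodic_mult[OF clinear_imp_linear[OF \<alpha>] \<alpha>n[OF that]] .
  have affine: "((\<lambda>z. \<alpha> z + b) ^^ m) z = (\<alpha> ^^ m) z + of_nat m *\<^sub>R b" for m z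
    by (induction m) (simp_all add: clinearD[OF \<alpha>] linear_scale[OF clinear_imp_linear[OF \<alpha>]] b(2) scaleR_add_left)
  have img: "((\<lambda>z. \<alpha> z + b) ^^ m) ` vclass V \<Lambda> z = vclass V \<Lambda> ((\<alpha> ^^ m) z + of_nat m *\<^sub>R b)" for m z
  proof (intro subset_antisym subsetI)
    fix y assume "y \<in> ((\<lambda>z. \<alpha> z + b) ^^ m) ` vclass V \<Lambda> z"
    then obtain l where "l \<in> \<Lambda>" "y = (\<alpha> ^^ m) l + ((\<alpha> ^^ m) z + of_nat m *\<^sub>R b)"
      by (auto simp: vclass_conv_image affine clinearD[OF clin])
    then show "y \<in> vclass V \<Lambda> ((\<alpha> ^^ m) z + of_nat m *\<^sub>R b)"
      using powL by (auto simp: vclass_conv_image)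
  next
    fix y assume "y \<in> vclass V \<Lambda> ((\<alpha> ^^ m) z + of_nat m *\<^sub>R b)"
    then obtain l where l: "l \<in> \<Lambda>" "y = l + ((\<alpha> ^^ m) z + of_nat m *\<^sub>R b)"
      by (auto simp: vclass_conv_image)
    \<comment> \<open>The exponent m n - m makes this the preimage of l under \<alpha>^m.\<close>
    define l' where "l' = (\<alpha> ^^ (m * n - m)) l"
    have "m \<le> m * n"
      using n by simp
    then have "(\<alpha> ^^ m) l' = (\<alpha> ^^ (m * n)) l"
      unfolding l'_def by (metis comp_apply funpow_add le_add_diff_inverse)
    also have "\<dots> = l"
      using l(1) LV per by auto
    finally have "y = ((\<lambda>z. \<alpha> z + b) ^^ m) (l' + z)"
      by (simp add: l(2) affine clinearD[OF clin])
    moreover have "l' \<in> \<Lambda>"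
      unfolding l'_def using l(1) by (rule powL)
    ultimately show "y \<in> ((\<lambda>z. \<alpha> z + b) ^^ m) ` vclass V \<Lambda> z"
      by (auto simp: vclass_conv_image)
  qed
  show act: "act g (vclass V \<Lambda> z) = vclass V \<Lambda> ((\<alpha> ^^ nat g) z + of_nat (nat g) *\<^sub>R b)" if "z \<in> V" for g z
    using that by (simp add: act_def img carrier_vquot)
  have affV: "(\<alpha> ^^ m) z + of_nat m *\<^sub>R b \<in> V" if "z \<in> V" for m z
    using that b(1) by (intro subspace_add[OF sV] powV subspace_scale[OF sV])
  show "holomorphic_map V (vclass V \<Lambda>) V (vclass V \<Lambda>) (act g)" for g
    by (rule holomorphic_map_affine[OF clin[of "nat g"]]) (auto simp: affV act)
  \<comment> \<open>Exponents matter only modulo n, since \<alpha>^n = 1 on V and n b is in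
    \<Lambda>; so adding residues corresponds to composing powers.\<close>
  have period: "vclass V \<Lambda> ((\<alpha> ^^ (m mod n)) z + of_nat (m mod n) *\<^sub>R b) = vclass V \<Lambda> ((\<alpha> ^^ m) z + of_nat m *\<^sub>R b)"
    if z: "z \<in> V" for m z
  proof -
    have "(\<alpha> ^^ m) z = (\<alpha> ^^ (m mod n)) ((\<alpha> ^^ (m div n * n)) z)"
      by (metis comp_apply funpow_add mod_div_mult_eq)
    then have 1: "(\<alpha> ^^ m) z = (\<alpha> ^^ (m mod n)) z"
      using per[OF z] by simp
    have "real m = real (m mod n) + real (m div n) * real n"
      by (metis mod_div_mult_eq of_nat_add of_nat_mult)
    then have "of_nat (m mod n) *\<^sub>R b - of_nat m *\<^sub>R b = - (of_nat (m div n) *\<^sub>R (of_nat n *\<^sub>R b))"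
      by (simp add: scaleR_add_left)
    also have "\<dots> \<in> \<Lambda>"
      by (intro zmoduleD(3)[OF zL] zmodule_scale_nat[OF zL b(3)])
    finally show ?thesis
      by (simp add: vclass_eq_iff[OF zL] 1)
  qed
  show "group_action (integer_mod_group n) (carrier (vquot V \<Lambda>)) act"
  proof (rule group_action_integer_mod_groupI[OF n])
    show "act g \<in> extensional (carrier (vquot V \<Lambda>))" for g
      by (simp add: act_def)
    show "act g a \<in> carrier (vquot V \<Lambda>)" if "a \<in> carrier (vquot V \<Lambda>)" for g a
      using that affV by (auto simp: carrier_vquot act)
    show "act 0 a = a" if "a \<in> carrier (vquot V \<Lambda>)" for a
      using that by (auto simp: carrier_vquot act)
    fix g h a assume gh: "g \<in> {0..<int n}" "h \<in> {0..<int n}" and "a \<in> carrier (vquot V \<Lambda>)"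
    then obtain z where z: "z \<in> V" "a = vclass V \<Lambda> z"
      by (auto simp: carrier_vquot)
    have "nat ((g + h) mod int n) = (nat g + nat h) mod n"
      using gh by (simp add: nat_mod_distrib nat_add_distrib)
    then have "act ((g + h) mod int n) a = vclass V \<Lambda> ((\<alpha> ^^ (nat g + nat h)) z + of_nat (nat g + nat h) *\<^sub>R b)"
      using period[OF z(1), of "nat g + nat h"] by (simp add: z act)
    also have "(\<alpha> ^^ (nat g + nat h)) z + of_nat (nat g + nat h) *\<^sub>R b
        = (\<alpha> ^^ nat g) ((\<alpha> ^^ nat h) z + of_nat (nat h) *\<^sub>R b) + of_nat (nat g) *\<^sub>R b"
    proof -
      have "(\<alpha> ^^ m) b = b" for m
        by (induction m) (simp_all add: b(2))
      then show ?thesis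
        by (simp add: funpow_add linear_add[OF lin] linear_scale[OF lin] scaleR_add_left)
    qed
    also have "vclass V \<Lambda> \<dots> = act g (act h a)"
      by (simp add: z act affV)
    finally show "act ((g + h) mod int n) a = act g (act h a)" .
  qed
qed

lemma dvd_no_smaller_iff:
  assumes "n > 0" "l dvd n"
  shows "(\<forall>g\<in>{0..<int n}. g \<noteq> 0 \<longrightarrow> \<not> l dvd nat g) \<longleftrightarrow> l = n"
proof
  assume *: "\<forall>g\<in>{0..<int n}. g \<noteq> 0 \<longrightarrow> \<not> l dvd nat g"
  show "l = n"
  proof (rule ccontr)
    assume "l \<noteq> n"
    moreover have "l \<le> n" "l > 0"
      using assms by (auto intro: dvd_imp_le Nat.gr0I)
    ultimately have "\<not> l dvd nat (int l)"
      using * by (intro *[rule_format]) auto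
    then show False
      by simp
  qed
next
  assume "l = n"
  show "\<forall>g\<in>{0..<int n}. g \<noteq> 0 \<longrightarrow> \<not> l dvd nat g"
  proof (intro ballI impI)
    fix g assume "g \<in> {0..<int n}" "g \<noteq> 0"
    then have "0 < nat g" "nat g < n"
      by auto
    then show "\<not> l dvd nat g"
      unfolding \<open>l = n\<close> by (rule nat_dvd_not_less)
  qed
qed

section \<open>The real isomorphism between V and the sum of the spans\<close>

context hodge_datum
begin

abbreviation V where "V \<equiv> m_space n D"

lemma csubspace_V: "vec.subspace V"
proof (rule csubspaceI)
  show "subspace V"
    unfolding m_space_def by (rule subspace_sum_of) (rule csubspace_imp_subspace[OF csubspace_H])
  fix v assume "v \<in> V"
  then obtain u where u: "v = (\<Sum>d\<in>divisors n. u d)" "\<And>d. d \<in> divisors n \<Longrightarrow> u d \<in> H d"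
    unfolding m_space_def sum_of_def by blast
  have "\<i> *s v = (\<Sum>d\<in>divisors n. \<i> *s u d)"
    by (simp add: u(1) vec.scale_sum_right)
  then show "\<i> *s v \<in> V"
    unfolding m_space_def by (rule sum_ofI) (use u(2) csubspaceD(3)[OF csubspace_H] in blast)
qed

lemma subspace_V: "subspace V"
  using csubspace_V by (rule csubspace_imp_subspace)

lemma H_V: "d \<in> divisors n \<Longrightarrow> H d \<subseteq> V"
  unfolding m_space_def using csubspaceD(1)[OF csubspace_H] finite_divisors by (auto intro: sum_of_component)

text \<open>The real vector whose image under \<open>cvec\<close> is z plus its conjugate, as in
  \<open>m_lat\<close>; on V it is the inverse of \<tau>.\<close>

definition \<rho> :: "complex^'k \<Rightarrow> real^'k" where "\<rho> z = 2 *\<^sub>R vRe z"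

lemma linear_\<rho>: "linear \<rho>"
  unfolding \<rho>_def [abs_def] by (intro linear_compose_scale_right linear_vRe)

lemma cvec_\<rho>: "cvec (\<rho> z) = z + vcnj z"
  by (simp add: \<rho>_def add_vcnj)

lemma \<rho>_H: "d \<in> divisors n \<Longrightarrow> h \<in> H d \<Longrightarrow> \<rho> h \<in> span (L d)"
  unfolding \<rho>_def using H_span span_scale by blast

lemma \<rho>_V:
  assumes "z \<in> V"
  shows "\<rho> z \<in> W"
proof -
  obtain u where u: "z = (\<Sum>d\<in>divisors n. u d)" "\<And>d. d \<in> divisors n \<Longrightarrow> u d \<in> H d"
    using assms unfolding m_space_def sum_of_def by blast
  have "\<rho> z = (\<Sum>d\<in>divisors n. \<rho> (u d))"
    by (simp add: u(1) linear_sum[OF linear_\<rho>])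
  then show ?thesis
    unfolding real_sum_def by (rule sum_ofI) (use u(2) \<rho>_H in blast)
qed

text \<open>Each component h of z lies in H d and has real part 0, so h plus its conjugate is 0, and
  the Hodge decomposition leaves only h = 0.\<close>

lemma \<rho>_eq_0D:
  assumes "z \<in> V" "\<rho> z = 0"
  shows "z = 0"
proof -
  obtain u where u: "z = (\<Sum>d\<in>divisors n. u d)" "\<And>d. d \<in> divisors n \<Longrightarrow> u d \<in> H d"
    using assms(1) unfolding m_space_def sum_of_def by blast
  have 0: "(\<Sum>d\<in>divisors n. \<rho> (u d)) = 0"
    using assms(2) by (simp add: u(1) linear_sum[OF linear_\<rho>])
  have "u d = 0" if d: "d \<in> divisors n" for d
  proof -
    have "\<rho> (u d) = 0"
      by (rule span_L_independent[OF _ 0 d]) (use u(2) \<rho>_H in blast)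
    then have "u d + vcnj (u d) = 0"
      unfolding cvec_\<rho>[symmetric] by (simp add: linear_0[OF linear_cvec])
    then show ?thesis
      using H_independent[OF d u(2)[OF d] u(2)[OF d]] by blast
  qed
  then show ?thesis
    by (simp add: u(1))
qed

text \<open>The Hodge decomposition of a real vector is stable under conjugation, so the two vectors
  h and h' of H d that describe it agree.\<close>

lemma \<rho>_surj_H:
  assumes d: "d \<in> divisors n" and w: "w \<in> span (L d)"
  obtains h where "h \<in> H d" "\<rho> h = w"
proof -
  have "cvec w \<in> cspan (L d)"
    using w by (simp add: mem_cspan_iff span_zero)
  then obtain h h' where h: "h \<in> H d" "h' \<in> H d" "cvec w = h + vcnj h'"
    using cspan_iff[OF d] by blast
  have "cvec w = vcnj h + h'"
    using arg_cong[OF h(3), of vcnj] by (simp add: linear_add[OF linear_vcnj])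
  then have "(h - h') + vcnj (h' - h) = 0"
    using h(3) by (simp add: linear_diff[OF linear_vcnj] algebra_simps)
  then have "h - h' = 0"
    using H_independent[OF d] csubspaceD(4)[OF csubspace_H[OF d]] h(1,2) by blast
  then have "cvec w = cvec (\<rho> h)"
    using h(3) by (simp add: cvec_\<rho>)
  then have "w = \<rho> h"
    by (metis vRe_cvec)
  then show ?thesis
    using that h(1) by blast
qed

lemma \<rho>_surj:
  assumes "w \<in> W"
  obtains z where "z \<in> V" "\<rho> z = w"
proof -
  have "\<exists>h\<in>H d. \<rho> h = comp d w" if "d \<in> divisors n" for d
    using \<rho>_surj_H[OF that W_cases(2)[OF assms that]] by blast
  then obtain h where h: "\<And>d. d \<in> divisors n \<Longrightarrow> h d \<in> H d" "\<And>d. d \<in> divisors n \<Longrightarrow> \<rho> (h d) = comp d w"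
    by metis
  have "\<rho> (\<Sum>d\<in>divisors n. h d) = (\<Sum>d\<in>divisors n. comp d w)"
    by (simp add: linear_sum[OF linear_\<rho>] h(2))
  moreover have "(\<Sum>d\<in>divisors n. h d) \<in> V"
    unfolding m_space_def by (rule sum_ofI[OF refl h(1)])
  ultimately show ?thesis
    using that W_cases(1)[OF assms] by simp
qed

text \<open>A linear left inverse of \<rho> on V, chosen on the whole space because
  \<open>linear\<close> and \<open>cext\<close> concern total maps.\<close>

definition \<tau> :: "real^'k \<Rightarrow> complex^'k" where
  "\<tau> = (SOME g. linear g \<and> (\<forall>z\<in>V. g (\<rho> z) = z))"

lemma linear_\<tau>: "linear \<tau>" and \<tau>_\<rho>: "z \<in> V \<Longrightarrow> \<tau> (\<rho> z) = z"
proof -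
  have "inj_on \<rho> V"
    using \<rho>_eq_0D linear_diff[OF linear_\<rho>] subspace_diff[OF subspace_V]
    by (intro inj_onI) (metis eq_iff_diff_eq_0)
  then have "\<exists>g. linear g \<and> (\<forall>z\<in>V. g (\<rho> z) = z)"
    using linear_exists_left_inverse_on[OF linear_\<rho> subspace_V] by blast
  then have "linear \<tau> \<and> (\<forall>z\<in>V. \<tau> (\<rho> z) = z)"
    unfolding \<tau>_def by (rule someI_ex)
  then show "linear \<tau>" "z \<in> V \<Longrightarrow> \<tau> (\<rho> z) = z"
    by auto
qed

lemma \<tau>_space: "w \<in> W \<Longrightarrow> \<tau> w \<in> V" and \<rho>_\<tau>: "w \<in> W \<Longrightarrow> \<rho> (\<tau> w) = w"
  using \<rho>_surj \<tau>_\<rho> by metis+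

lemma bij_\<tau>: "bij_betw \<tau> W V"
  by (rule bij_betwI[where g = \<rho>]) (auto simp: \<tau>_space \<rho>_\<tau> \<tau>_\<rho> \<rho>_V)

lemma \<alpha>_V: "z \<in> V \<Longrightarrow> \<alpha> z \<in> V"
proof -
  assume "z \<in> V"
  then obtain u where u: "z = (\<Sum>d\<in>divisors n. u d)" "\<And>d. d \<in> divisors n \<Longrightarrow> u d \<in> H d"
    unfolding m_space_def sum_of_def by blast
  have "\<alpha> z = (\<Sum>d\<in>divisors n. \<alpha> (u d))"
    by (simp add: u(1) clinearD[OF clinear_\<alpha>])
  then show "\<alpha> z \<in> V"
    unfolding m_space_def by (rule sum_ofI) (use u(2) cact_H in blast)
qed

lemma \<rho>_\<alpha>: "\<rho> (\<alpha> z) = x (\<rho> z)"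
  by (simp add: \<rho>_def vRe_cact[OF linear_x] linear_scale[OF linear_x])

lemma \<rho>_\<alpha>_funpow: "\<rho> ((\<alpha> ^^ k) z) = (x ^^ k) (\<rho> z)"
  by (induction k) (simp_all add: \<rho>_\<alpha>)

lemma \<alpha>_funpow_V: "z \<in> V \<Longrightarrow> (\<alpha> ^^ k) z \<in> V"
  by (induction k) (auto simp: \<alpha>_V)

lemma \<tau>_x: "w \<in> W \<Longrightarrow> \<tau> (x w) = \<alpha> (\<tau> w)"
  using \<tau>_\<rho>[OF \<alpha>_V[OF \<tau>_space]] by (simp add: \<rho>_\<alpha> \<rho>_\<tau>)

text \<open>\<rho> sends h to 2 Re h and i h to -2 Im h, which determines \<tau> on both parts of h.
  So \<open>cext \<tau>\<close> is the identity on H d and 0 on its conjugate: it is the projection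
  to V along the conjugate of V.\<close>

lemma hodge_eq:
  assumes d: "d \<in> divisors n"
  shows "H d = {z \<in> cspan (L d). cext \<tau> (vcnj z) = 0}"
proof -
  have *: "\<tau> (vRe h) = (1 / 2) *\<^sub>R h" "\<tau> (vIm h) = - ((1 / 2) *\<^sub>R (\<i> *s h))" if h: "h \<in> H d" for h
  proof -
    have ih: "\<i> *s h \<in> H d"
      using h by (rule csubspaceD(3)[OF csubspace_H[OF d]])
    have "2 *\<^sub>R \<tau> (vRe h) = h"
      using \<tau>_\<rho>[of h] h H_V[OF d] by (auto simp: \<rho>_def linear_scale[OF linear_\<tau>])
    then show "\<tau> (vRe h) = (1 / 2) *\<^sub>R h"
      by (metis (no_types) scaleR_half_double scaleR_2 scaleR_left.zero one_add_one scaleR_one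
          scaleR_scaleR nonzero_eq_divide_eq zero_neq_numeral)
    have "- (2 *\<^sub>R \<tau> (vIm h)) = \<i> *s h"
      using \<tau>_\<rho>[of "\<i> *s h"] ih H_V[OF d]
      by (auto simp: \<rho>_def linear_scale[OF linear_\<tau>] linear_neg[OF linear_\<tau>])
    then have "(1 / 2) *\<^sub>R (\<i> *s h) = (1 / 2) *\<^sub>R (- (2 *\<^sub>R \<tau> (vIm h)))"
      by simp
    then show "\<tau> (vIm h) = - ((1 / 2) *\<^sub>R (\<i> *s h))"
      by simp
  qed
  have h1: "cext \<tau> (vcnj h) = 0" if "h \<in> H d" for h
    unfolding cext_vcnj[OF linear_\<tau>] *[OF that] by (simp add: vec_eq_iff)
  have h2: "cext \<tau> h = h" if "h \<in> H d" for h
    unfolding cext_def *[OF that] by (simp add: vec_eq_iff flip: scaleR_add_left)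
  have val: "cext \<tau> (vcnj (h + vcnj h')) = h'" if "h \<in> H d" "h' \<in> H d" for h h'
    using h1[OF that(1)] h2[OF that(2)]
    by (simp add: linear_add[OF linear_vcnj] clinearD[OF clinear_cext[OF linear_\<tau>]])
  show ?thesis
  proof (intro subset_antisym subsetI)
    fix z assume "z \<in> H d"
    then show "z \<in> {z \<in> cspan (L d). cext \<tau> (vcnj z) = 0}"
      using h1 H_cspan[OF d] by simp
  next
    fix z assume z: "z \<in> {z \<in> cspan (L d). cext \<tau> (vcnj z) = 0}"
    then obtain h h' where h: "h \<in> H d" "h' \<in> H d" "z = h + vcnj h'"
      using cspan_iff[OF d] by blast
    then have "h' = 0"
      using z val by auto
    then show "z \<in> H d"
      using h by (simp add: linear_0[OF linear_vcnj])
  qed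
qed

lemma lifts_beta_iff: "lifts_beta n D b \<longleftrightarrow> b \<in> H 1 \<and> cls n L (\<rho> b) = d_beta D"
proof -
  have eq: "cvec w = b + vcnj b \<longleftrightarrow> w = \<rho> b" for w
    unfolding cvec_\<rho>[symmetric] by (metis vRe_cvec)
  show ?thesis
    unfolding lifts_beta_def eq using \<rho>_H[OF one_divisor, of b] by auto
qed

lemma lifts_beta_exists: "\<exists>b. lifts_beta n D b"
proof -
  obtain w where w: "w \<in> span (L 1)" "d_beta D = cls n L w"
    using valid by (auto simp: valid_datum_def A_sub_def)
  obtain b where "b \<in> H 1" "\<rho> b = w"
    using \<rho>_surj_H[OF one_divisor w(1)] by blast
  then show ?thesis
    using w(2) lifts_beta_iff by auto
qed

end

text \<open>(C) is assumed only where freeness is derived. Thus a manifold whose data violate (C) is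
  still recovered from them.\<close>

locale manifold_datum = hodge_datum n D
  for n :: nat and D :: "('k::finite) bdf_datum" and b +
  assumes A: "cond_A n (d_lat D) (d_x D) (d_sub D)" and B: "cond_B n (d_lat D) (d_sub D)"
    and b: "lifts_beta n D b"
begin

abbreviation X where "X \<equiv> manifold_of n D b"
abbreviation \<Lambda> where "\<Lambda> \<equiv> m_lat n D"

lemma subgroup_S: "subgroup (d_sub D) (A_prime n L)"
  using valid by (simp add: valid_datum_def finite_subgroup_def)

abbreviation S' where "S' \<equiv> {w \<in> W. cls n L w \<in> d_sub D}"

lemmas S'_facts = S_conv_image[OF subgroup_S A B] zmodule_S_lat[OF subgroup_S A B]
  M_subset_S_lat[OF subgroup_S A B] x_S_lat[OF subgroup_S A B] lattice_S_lat[OF subgroup_S A B]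

lemma lattice_iff: "z \<in> \<Lambda> \<longleftrightarrow> z \<in> V \<and> \<rho> z \<in> S'"
proof -
  have "cvec w = z + vcnj z \<longleftrightarrow> w = \<rho> z" for w
    unfolding cvec_\<rho>[symmetric] by (metis vRe_cvec)
  then show ?thesis
    using \<rho>_V by (auto simp: m_lat_def)
qed

lemma \<tau>_lattice_iff: "w \<in> W \<Longrightarrow> \<tau> w \<in> \<Lambda> \<longleftrightarrow> w \<in> S'"
  by (simp add: lattice_iff \<tau>_space \<rho>_\<tau>)

lemma complex_torus: "complex_torus V \<Lambda>"
proof -
  have "\<tau> ` S' = \<Lambda>"
  proof (intro subset_antisym subsetI)
    fix z assume "z \<in> \<Lambda>"
    then have "z = \<tau> (\<rho> z)" "\<rho> z \<in> S'"
      by (auto simp: lattice_iff \<tau>_\<rho>)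
    then show "z \<in> \<tau> ` S'"
      by blast
  qed (use \<tau>_lattice_iff in auto)
  moreover have "\<tau> ` W = V" "inj_on \<tau> W"
    using bij_\<tau> by (auto simp: bij_betw_def)
  ultimately have "is_lattice \<Lambda> V"
    using is_lattice_image[OF S'_facts(5) linear_\<tau>] by simp
  moreover have "V \<noteq> {0}"
  proof
    assume V0: "V = {0}"
    have "w = 0" if "w \<in> L 1" for w
    proof -
      have "w \<in> W"
        using that span_base span_L_subset[OF one_divisor] by blast
      then show ?thesis
        using V0 \<tau>_space[of w] \<rho>_\<tau>[of w] linear_0[OF linear_\<rho>] by auto
    qed
    then have "L 1 = {0}"
      using zmoduleD(1)[OF zmodule_L[OF one_divisor]] by auto
    then show False
      using modules by (simp add: datum_modules_def)
  qed
  ultimately show ?thesis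
    using csubspace_V by (simp add: complex_torus_def)
qed

lemma b_H: "b \<in> H 1" and b_cls: "cls n L (\<rho> b) = d_beta D"
  using b by (auto simp: lifts_beta_iff)

lemma b_V: "b \<in> V"
  using b_H H_V[OF one_divisor] by auto

lemma \<alpha>_b: "\<alpha> b = b"
  using cyclotomic_H[OF one_divisor b_H] by (simp add: cyclotomic_1 poly_act_pCons del: One_nat_def)

lemma multiple_b_iff: "of_int k *\<^sub>R \<rho> b \<in> M \<longleftrightarrow> int n dvd k"
  using card_generate_cls[OF \<rho>_V[OF b_V]] valid unfolding b_cls by (simp add: valid_datum_def)

lemma n_b: "of_nat n *\<^sub>R b \<in> \<Lambda>"
proof -
  have "\<rho> (of_nat n *\<^sub>R b) \<in> S'"
    using multiple_b_iff[of "int n"] S'_facts(3) by (auto simp: linear_scale[OF linear_\<rho>])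
  then show ?thesis
    using subspace_scale[OF subspace_V b_V] lattice_iff by blast
qed

lemma \<alpha>_\<Lambda>: "z \<in> \<Lambda> \<Longrightarrow> \<alpha> z \<in> \<Lambda>"
  using S'_facts(4) unfolding lattice_iff \<rho>_\<alpha> by (blast intro: \<alpha>_V)

lemma \<alpha>_power_n: "z \<in> V \<Longrightarrow> (\<alpha> ^^ n) z = z"
  using \<tau>_\<rho>[of z] \<tau>_\<rho>[OF \<alpha>_funpow_V, of z n] x_power_n[OF \<rho>_V] by (simp add: \<rho>_\<alpha>_funpow)

lemmas action_facts = affine_cyclic_action[OF n_pos complex_torus clinear_\<alpha> \<alpha>_V \<alpha>_\<Lambda> \<alpha>_power_n b_V \<alpha>_b n_b]

lemma X_simps: "t_space X = V" "t_lat X = \<Lambda>"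
  "t_act X = (\<lambda>g. restrict (\<lambda>a. ((\<lambda>z. \<alpha> z + b) ^^ nat g) ` a) (carrier (vquot V \<Lambda>)))"
  by (simp_all add: manifold_of_def)

lemma action: "group_action (integer_mod_group n) (carrier (t_torus X)) (t_act X)"
  unfolding X_simps by (rule action_facts(1))

lemma act: "g \<ge> 0 \<Longrightarrow> z \<in> V \<Longrightarrow>
    t_act X g (vclass V \<Lambda> z) = vclass V \<Lambda> ((\<alpha> ^^ nat g) z + of_nat (nat g) *\<^sub>R b)"
  unfolding X_simps by (rule action_facts(2))

lemma holomorphic: "g \<ge> 0 \<Longrightarrow> holomorphic_map (t_space X) (t_class X) (t_space X) (t_class X) (t_act X g)"
  unfolding X_simps by (rule action_facts(3))

lemma lattice_\<Lambda>: "is_lattice \<Lambda> V"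
  using complex_torus by (simp add: complex_torus_def)

lemma zmodule_\<Lambda>: "zmodule \<Lambda>"
  using lattice_\<Lambda> by (rule is_lattice_zmodule)

lemma class_eq_iff: "vclass V \<Lambda> u = vclass V \<Lambda> v \<longleftrightarrow> u - v \<in> \<Lambda>"
  by (rule vclass_eq_iff[OF zmodule_\<Lambda>])

lemma act_generator: "z \<in> V \<Longrightarrow> t_act X (1 mod int n) (vclass V \<Lambda> z) = vclass V \<Lambda> (\<alpha> z + b)"
proof (cases "n = 1")
  case True
  assume z: "z \<in> V"
  \<comment> \<open>For n = 1 the generator is the residue 0, which acts trivially; this agrees with
    the affine map as \<alpha> is the identity on V and b lies in \<Lambda>.\<close>
  have "\<alpha> z = z" "b \<in> \<Lambda>"
    using \<alpha>_power_n[OF z] n_b True by auto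
  then have "vclass V \<Lambda> z = vclass V \<Lambda> (\<alpha> z + b)"
    using zmoduleD(3)[OF zmodule_\<Lambda>] by (simp add: class_eq_iff)
  moreover have "1 mod int n = 0"
    using True by simp
  ultimately show ?thesis
    using act[of 0 z] z by simp
next
  case False
  assume z: "z \<in> V"
  have "1 mod int n = 1"
    using False n_pos by simp
  then show ?thesis
    using act[of 1 z] z by simp
qed

text \<open>The origin can be 0, since b already lies in the 1-eigenspace of \<alpha>.\<close>

lemma torus_datum: "torus_datum n X D \<alpha> b 0 \<tau>"
proof (rule torus_datum.intro)
  have b0: "0 - \<alpha> 0 + b = b"
    by (simp add: clinearD[OF clinear_\<alpha>])
  show "affine_torus n X \<alpha> (0 - \<alpha> 0 + b)"
    unfolding b0
    by (rule affine_torus.intro[OF n_pos _ action clinear_\<alpha>])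
      (simp_all add: X_simps(1,2) complex_torus \<alpha>_V b_V act_generator)
  show "b \<in> t_space X" "0 \<in> t_space X" "bij_betw \<tau> (real_sum n L) (t_space X)"
    using b_V csubspaceD(1)[OF csubspace_V] bij_\<tau> by (simp_all add: X_simps(1))
  show "L d \<subseteq> real_sum n L" if "d \<in> divisors n" for d
    using span_superset span_L_subset[OF that] by blast
  show "\<tau> ` L d = {v \<in> t_lat X. poly_act (cyclotomic d) \<alpha> v = 0}" if d: "d \<in> divisors n" for d
  proof (intro subset_antisym subsetI)
    fix v assume "v \<in> \<tau> ` L d"
    then obtain w where w: "w \<in> L d" "v = \<tau> w"
      by auto
    have wW: "w \<in> W" and ws: "w \<in> span (L d)"
      using w(1) span_base span_L_subset[OF d] by blast+
    have "w \<in> S'"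
      using w(1) L_subset_M[OF d] S'_facts(3) by blast
    moreover have "poly_act (cyclotomic d) \<alpha> (\<tau> w) = \<tau> (poly_act (cyclotomic d) x w)"
      by (rule poly_act_intertwine[OF linear_\<tau>, symmetric, of W]) (auto simp: x_W \<tau>_x wW)
    ultimately show "v \<in> {v \<in> t_lat X. poly_act (cyclotomic d) \<alpha> v = 0}"
      using wW \<tau>_lattice_iff cyclotomic_L[OF d ws] linear_0[OF linear_\<tau>] by (simp add: w(2) X_simps(2))
  next
    fix v assume "v \<in> {v \<in> t_lat X. poly_act (cyclotomic d) \<alpha> v = 0}"
    then have v: "v \<in> \<Lambda>" "poly_act (cyclotomic d) \<alpha> v = 0"
      by (auto simp: X_simps(2))
    have "v \<in> V" and S: "\<rho> v \<in> S'"
      using v(1) by (auto simp: lattice_iff)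
    have "poly_act (cyclotomic d) x (vRe v) = 0"
      using v(2) by (simp add: poly_act_cact_eq_0_iff[OF linear_x])
    then have "poly_act (cyclotomic d) x (\<rho> v) = 0"
      by (simp add: \<rho>_def linear_scale[OF linear_poly_act[OF linear_x]])
    then have "\<rho> v \<in> span (L d)"
      using S by (simp add: mem_span_L_iff[OF d])
    \<comment> \<open>By (B) the part of index d of the overlattice is not larger than L d.\<close>
    then have "\<rho> v \<in> L d"
      using B S d by (auto simp: cond_B_iff)
    then show "v \<in> \<tau> ` L d"
      using \<tau>_\<rho>[OF \<open>v \<in> V\<close>] by (metis imageI)
  qed
  show "d_sub D = {cls n L w | w. w \<in> W \<and> \<tau> w \<in> t_lat X}"
    using S'_facts(1) \<tau>_lattice_iff unfolding X_simps(2) by blast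
  show "\<exists>w\<in>W. \<tau> w = b \<and> d_beta D = cls n L w"
    using \<rho>_V[OF b_V] \<tau>_\<rho>[OF b_V] b_cls by (intro bexI[of _ "\<rho> b"]) auto
qed (rule \<alpha>_b linear_\<tau> linear_x x_W \<tau>_x hodge_eq; assumption?)+

lemma datum_of: "datum_of n X D"
proof -
  have "complex_torus (t_space X) (t_lat X)"
    unfolding X_simps by (rule complex_torus)
  then show ?thesis
    using datum_of_iff_torus_datum[OF n_pos _ action] torus_datum by blast
qed

text \<open>If \<gamma>^g fixes the class of z, then \<open>?y\<close> lies in the overlattice. As x
  is the identity on the part of index 1, the projection of \<open>?y\<close> to A_1 is g times
  \<open>d_beta D\<close>, which is trivial by (C); so n divides g.\<close>

lemma free:
  assumes C: "cond_C n L (d_sub D) (d_beta D)"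
  shows "free_torus_quotient n X"
proof -
  have "g = 0" if g: "g \<in> {0..<int n}" and z: "z \<in> V" and fixed: "t_act X g (vclass V \<Lambda> z) = vclass V \<Lambda> z" for g z
  proof -
    let ?y = "(x ^^ nat g) (\<rho> z) + of_nat (nat g) *\<^sub>R \<rho> b - \<rho> z"
    have "(\<alpha> ^^ nat g) z + of_nat (nat g) *\<^sub>R b - z \<in> \<Lambda>"
    proof -
      have "vclass V \<Lambda> ((\<alpha> ^^ nat g) z + of_nat (nat g) *\<^sub>R b) = vclass V \<Lambda> z"
        using fixed act[of g z] g z by simp
      then show ?thesis
        by (simp only: class_eq_iff)
    qed
    then have y: "?y \<in> S'"
      by (simp add: lattice_iff \<rho>_\<alpha>_funpow linear_diff[OF linear_\<rho>] linear_add[OF linear_\<rho>] linear_scale[OF linear_\<rho>])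
    have "comp 1 ((x ^^ m) w) = comp 1 w" if w: "w \<in> W" for w m
    proof -
      have "x (comp 1 w) = comp 1 w"
        using cyclotomic_L[OF one_divisor W_cases(2)[OF w one_divisor]]
        by (simp add: cyclotomic_1 poly_act_pCons del: One_nat_def)
      moreover have "comp 1 (x v) = x (comp 1 v)" for v
        by (simp add: comp_def poly_act_commute[OF linear_x] linear_scale[OF linear_x])
      ultimately show ?thesis
        by (induction m) (simp_all del: One_nat_def)
    qed
    then have "comp 1 ?y = of_nat (nat g) *\<^sub>R comp 1 (\<rho> b)"
      using \<rho>_V[OF z] by (simp add: linear_diff[OF linear_comp] linear_add[OF linear_comp] linear_scale[OF linear_comp] del: One_nat_def)
    also have "comp 1 (\<rho> b) = \<rho> b"
      using comp_component[OF one_divisor one_divisor \<rho>_H[OF one_divisor b_H]] by simp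
    finally have c: "comp 1 ?y = of_int g *\<^sub>R \<rho> b"
      using g by (simp del: One_nat_def)
    have "cls n L (comp 1 ?y) \<in> projection_A1 n L (d_sub D)"
      unfolding projection_A1_eq using y by blast
    moreover have "cls n L (comp 1 ?y) \<in> generate (A_prime n L) {d_beta D}"
      unfolding c b_cls[symmetric] generate_cls[OF \<rho>_V[OF b_V]] by blast
    ultimately have "cls n L (comp 1 ?y) = M"
      using C unfolding cond_C_def one_A_prime by blast
    then have "int n dvd g"
      unfolding c cls_eq_M_iff multiple_b_iff .
    then show "g = 0"
      using g zdvd_not_zless by force
  qed
  then have "stabilizer (integer_mod_group n) (t_act X) a = {0}" if "a \<in> carrier (t_torus X)" for a
    using that n_pos act[of 0] by (auto simp: stabilizer_def carrier_integer_mod_group X_simps(1,2) carrier_vquot)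
  then show ?thesis
    unfolding free_torus_quotient_def
    using complex_torus action holomorphic n_pos
    by (simp add: X_simps(1,2) carrier_integer_mod_group)
qed

text \<open>On a nonzero L d the power x^k is the identity exactly when d divides k, since otherwise
  it fixes only 0. So the least common multiple is the order of \<alpha> on V.\<close>

lemma \<alpha>_power_trivial_iff:
  "(\<forall>z\<in>V. (\<alpha> ^^ k) z = z) \<longleftrightarrow> Lcm {d \<in> divisors n. L d \<noteq> {0}} dvd k"
proof
  assume triv: "\<forall>z\<in>V. (\<alpha> ^^ k) z = z"
  have "d dvd k" if d: "d \<in> divisors n" "L d \<noteq> {0}" for d
  proof (rule ccontr)
    assume nd: "\<not> d dvd k"
    obtain w where w: "w \<in> L d" "w \<noteq> 0"
      using d zmoduleD(1)[OF zmodule_L[OF d(1)]] by blast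
    have ws: "w \<in> span (L d)" and wW: "w \<in> W"
      using w(1) span_base span_L_subset[OF d(1)] by blast+
    have "(x ^^ k) w = \<rho> ((\<alpha> ^^ k) (\<tau> w))"
      by (simp add: \<rho>_\<alpha>_funpow \<rho>_\<tau>[OF wW])
    then have "(x ^^ k) w = w"
      using triv \<tau>_space[OF wW] \<rho>_\<tau>[OF wW] by simp
    then have "w = 0"
      using cyclotomic_kernel_fixed_point[OF linear_x divisors_pos[OF n_pos d(1)] cyclotomic_L[OF d(1) ws] _ nd] by blast
    then show False
      using w(2) by simp
  qed
  then show "Lcm {d \<in> divisors n. L d \<noteq> {0}} dvd k"
    by (intro Lcm_least) auto
next
  assume Lcm: "Lcm {d \<in> divisors n. L d \<noteq> {0}} dvd k"
  have "(x ^^ k) (comp d w) = comp d w" if w: "w \<in> W" and d: "d \<in> divisors n" for d w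
  proof (cases "L d = {0}")
    case True
    then have "comp d w = 0"
      using W_cases(2)[OF w d] by simp
    then show ?thesis
      using linear_0[OF linear_funpow[OF linear_x]] by simp
  next
    case False
    then have "d dvd Lcm {d \<in> divisors n. L d \<noteq> {0}}"
      using d by (intro dvd_Lcm) auto
    then have "d dvd k"
      using Lcm by (rule dvd_trans)
    then obtain m where "k = m * d"
      by (metis dvdE mult.commute)
    moreover have "(x ^^ d) (comp d w) = comp d w"
      using cyclotomic_kernel_periodic[OF linear_x divisors_pos[OF n_pos d] _ cyclotomic_L[OF d W_cases(2)[OF w d]]]
      by (simp add: divisors_def)
    ultimately show ?thesis
      using periodic_mult[OF linear_x] by simp
  qed
  then have "(x ^^ k) (\<Sum>d\<in>divisors n. comp d w) = (\<Sum>d\<in>divisors n. comp d w)" if "w \<in> W" for w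
    using that by (simp add: linear_sum[OF linear_funpow[OF linear_x]])
  then have "(x ^^ k) w = w" if "w \<in> W" for w
    using that W_cases(1)[OF that] by metis
  then show "\<forall>z\<in>V. (\<alpha> ^^ k) z = z"
    using \<tau>_\<rho> \<alpha>_funpow_V \<rho>_V by (metis \<rho>_\<alpha>_funpow)
qed

text \<open>Comparing the action of g with a translation at t z and at 0 puts t (\<alpha>^g z - z)
  into \<Lambda> for all real t, so the linear part is trivial on V.\<close>

lemma translation_iff:
  assumes g: "g \<ge> 0"
  shows "(\<exists>t\<in>carrier (t_torus X). \<forall>a\<in>carrier (t_torus X). t_act X g a = a \<otimes>\<^bsub>t_torus X\<^esub> t)
    \<longleftrightarrow> (\<forall>z\<in>V. (\<alpha> ^^ nat g) z = z)"
proof -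
  have mult: "vclass V \<Lambda> u \<otimes>\<^bsub>vquot V \<Lambda>\<^esub> vclass V \<Lambda> v = vclass V \<Lambda> (u + v)" if "u \<in> V" "v \<in> V" for u v
    by (rule mult_vquot[OF zmodule_subspace[OF subspace_V] zmodule_\<Lambda> is_lattice_subset[OF lattice_\<Lambda>] that])
  show ?thesis
    unfolding X_simps(1,2)
  proof
    assume "\<exists>t\<in>carrier (vquot V \<Lambda>). \<forall>a\<in>carrier (vquot V \<Lambda>). t_act X g a = a \<otimes>\<^bsub>vquot V \<Lambda>\<^esub> t"
    then obtain u where u: "u \<in> V"
        "\<And>z. z \<in> V \<Longrightarrow> t_act X g (vclass V \<Lambda> z) = vclass V \<Lambda> z \<otimes>\<^bsub>vquot V \<Lambda>\<^esub> vclass V \<Lambda> u"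
      by (auto simp: carrier_vquot)
    have mem: "(\<alpha> ^^ nat g) z + of_nat (nat g) *\<^sub>R b - (z + u) \<in> \<Lambda>" if "z \<in> V" for z
    proof -
      have "vclass V \<Lambda> ((\<alpha> ^^ nat g) z + of_nat (nat g) *\<^sub>R b) = vclass V \<Lambda> (z + u)"
        using act[OF g that] mult[OF that u(1)] u(2)[OF that] by simp
      then show ?thesis
        by (simp only: class_eq_iff)
    qed
    have lin: "linear (\<alpha> ^^ nat g)"
      by (rule linear_funpow[OF clinear_imp_linear[OF clinear_\<alpha>]])
    have "t *\<^sub>R ((\<alpha> ^^ nat g) z - z) \<in> \<Lambda>" if z: "z \<in> V" for t z
    proof -
      have "t *\<^sub>R ((\<alpha> ^^ nat g) z - z) = ((\<alpha> ^^ nat g) (t *\<^sub>R z) + of_nat (nat g) *\<^sub>R b - (t *\<^sub>R z + u))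
          - ((\<alpha> ^^ nat g) 0 + of_nat (nat g) *\<^sub>R b - (0 + u))"
        by (simp add: linear_scale[OF lin] linear_0[OF lin] scaleR_diff_right)
      also have "\<dots> \<in> \<Lambda>"
        by (intro zmoduleD(2)[OF zmodule_\<Lambda>] mem subspace_scale[OF subspace_V] z subspace_0[OF subspace_V])
      finally show ?thesis .
    qed
    then have "(\<alpha> ^^ nat g) z - z = 0" if "z \<in> V" for z
      using lattice_contains_no_line[OF lattice_\<Lambda>] that by blast
    then show "\<forall>z\<in>V. (\<alpha> ^^ nat g) z = z"
      by simp
  next
    assume triv: "\<forall>z\<in>V. (\<alpha> ^^ nat g) z = z"
    let ?u = "of_nat (nat g) *\<^sub>R b"
    have u: "?u \<in> V"
      by (rule subspace_scale[OF subspace_V b_V])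
    show "\<exists>t\<in>carrier (vquot V \<Lambda>). \<forall>a\<in>carrier (vquot V \<Lambda>). t_act X g a = a \<otimes>\<^bsub>vquot V \<Lambda>\<^esub> t"
    proof (intro bexI[of _ "vclass V \<Lambda> ?u"] ballI)
      fix a assume "a \<in> carrier (vquot V \<Lambda>)"
      then obtain z where "z \<in> V" "a = vclass V \<Lambda> z"
        by (auto simp: carrier_vquot)
      then show "t_act X g a = a \<otimes>\<^bsub>vquot V \<Lambda>\<^esub> vclass V \<Lambda> ?u"
        using triv act[OF g, of z] mult[OF _ u, of z] by simp
    qed (use u in \<open>simp add: carrier_vquot\<close>)
  qed
qed

lemma no_translations_iff:
  "contains_no_translations n X \<longleftrightarrow> Lcm {d \<in> divisors n. L d \<noteq> {0}} = n" (is "_ \<longleftrightarrow> ?l = n")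
proof -
  have ln: "?l dvd n"
    by (rule Lcm_least) (auto simp: divisors_def)
  have "contains_no_translations n X \<longleftrightarrow> (\<forall>g\<in>{0..<int n}. g \<noteq> 0 \<longrightarrow> \<not> ?l dvd nat g)"
    using translation_iff \<alpha>_power_trivial_iff n_pos
    by (simp add: contains_no_translations_def carrier_integer_mod_group)
  also have "\<dots> \<longleftrightarrow> ?l = n"
    by (rule dvd_no_smaller_iff[OF n_pos ln])
  finally show ?thesis .
qed

end

section \<open>The data determine the manifold\<close>

text \<open>A is \<tau>' after the inverse of \<tau>. It commutes with i because the kernels of
  \<open>cext \<tau>\<close> and \<open>cext \<tau>'\<close> on each part are the same conjugate of
  \<open>d_hodge\<close>, and this kernel encodes multiplication by i.\<close>

lemma torus_datum_transfer:
  assumes X: "torus_datum n X D \<alpha> b q \<tau>" and Y: "torus_datum n Y D \<alpha>' b' q' \<tau>'"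
    and mod: "datum_modules n (d_lat D) (d_x D)"
  obtains A where "clinear A" "\<And>w. w \<in> real_sum n (d_lat D) \<Longrightarrow> A (\<tau> w) = \<tau>' w"
proof -
  interpret X: torus_datum n X D \<alpha> b q \<tau> by (rule X)
  interpret Y: torus_datum n Y D \<alpha>' b' q' \<tau>' by (rule Y)
  interpret dl: datum_lattices n "d_lat D" "d_x D"
    by unfold_locales (rule X.n_pos, rule mod)
  obtain \<sigma> where \<sigma>: "linear \<sigma>" "\<And>w. w \<in> X.W \<Longrightarrow> \<sigma> (\<tau> w) = w"
    using linear_exists_left_inverse_on[OF X.linear_\<tau> X.subspace_W] X.bij_\<tau> by (auto simp: bij_betw_def)
  have part: "\<tau>' y = \<i> *s \<tau>' w"
    if d: "d \<in> divisors n" and w: "w \<in> span (X.L d)" "y \<in> span (X.L d)" "\<tau> y = \<i> *s \<tau> w" for d w y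
  proof -
    \<comment> \<open>The relation \<tau> y = i \<tau> w says exactly that w - i y lies in
      \<open>d_hodge D d\<close>.\<close>
    define z where "z = cvec w - \<i> *s cvec y"
    have z: "vRe z = w" "vIm z = - y"
      by (simp_all add: z_def linear_diff[OF linear_vRe] linear_diff[OF linear_vIm])
    have "z \<in> cspan (X.L d)"
      using w by (simp add: mem_cspan_iff z span_neg)
    moreover have "cext \<tau> (vcnj z) = 0"
      unfolding cext_vcnj[OF X.linear_\<tau>] z linear_neg[OF X.linear_\<tau>] w(3)
      by (simp add: vector_smult_assoc)
    ultimately have "cext \<tau>' (vcnj z) = 0"
      using X.hodge[OF d] Y.hodge[OF d] by blast
    then have "\<tau>' w + \<i> *s \<tau>' y = 0"
      unfolding cext_vcnj[OF Y.linear_\<tau>] z linear_neg[OF Y.linear_\<tau>] by simp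
    then have "\<i> *s (\<tau>' w + \<i> *s \<tau>' y) = 0"
      by simp
    then show ?thesis
      by (simp add: vector_add_ldistrib vector_smult_assoc)
  qed
  have J: "(\<tau>' \<circ> \<sigma>) (\<i> *s v) = \<i> *s (\<tau>' \<circ> \<sigma>) v" if v: "v \<in> t_space X" for v
  proof -
    obtain w where w: "w \<in> X.W" "\<tau> w = v"
      using X.\<tau>_surj[OF v] by blast
    obtain y where y: "y \<in> X.W" "\<tau> y = \<i> *s v"
      using X.\<tau>_surj csubspaceD(3)[OF X.csubspace_V v] by blast
    \<comment> \<open>The projections are polynomials in \<alpha> and hence commute with i, so the
      relation between y and w passes to their components.\<close>
    have \<tau>c: "\<tau> (dl.comp d u) = (1 / of_nat n) *\<^sub>R poly_act (proj_poly n d) \<alpha> (\<tau> u)" if "u \<in> X.W" for d u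
      using X.\<tau>_poly_act[OF that] by (simp add: dl.comp_def linear_scale[OF X.linear_\<tau>])
    have "\<tau>' (dl.comp d y) = \<i> *s \<tau>' (dl.comp d w)" if d: "d \<in> divisors n" for d
    proof (rule part[OF d dl.W_cases(2)[OF w(1) d] dl.W_cases(2)[OF y(1) d]])
      show "\<tau> (dl.comp d y) = \<i> *s \<tau> (dl.comp d w)"
        by (simp add: \<tau>c[OF y(1)] \<tau>c[OF w(1)] y(2) w(2) clinearD[OF X.clinear_poly_act]
            scaleR_vec_complex vector_smult_assoc mult.commute)
    qed
    then have "(\<Sum>d\<in>divisors n. \<tau>' (dl.comp d y)) = \<i> *s (\<Sum>d\<in>divisors n. \<tau>' (dl.comp d w))"
      by (simp add: vec.scale_sum_right)
    then have "\<tau>' y = \<i> *s \<tau>' w"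
      using dl.W_cases(1)[OF y(1)] dl.W_cases(1)[OF w(1)] by (simp add: linear_sum[OF Y.linear_\<tau>, symmetric])
    then show ?thesis
      using \<sigma>(2)[OF w(1)] \<sigma>(2)[OF y(1)] w(2) y(2) by simp
  qed
  obtain A where A: "clinear A" "\<And>v. v \<in> t_space X \<Longrightarrow> A v = (\<tau>' \<circ> \<sigma>) v"
    using clinear_extend[OF X.csubspace_V linear_compose[OF \<sigma>(1) Y.linear_\<tau>] J] by blast
  have "A (\<tau> w) = \<tau>' w" if "w \<in> X.W" for w
    using A(2)[OF X.\<tau>_space[OF that]] \<sigma>(2)[OF that] by simp
  then show ?thesis
    using that A(1) by blast
qed

text \<open>The map sends q + \<tau> w to q' + \<tau>' w. The translation parts b and b' need not
  correspond, but both represent \<open>d_beta D\<close>; so they differ by a vector of M, and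
  orbits modulo the lattice correspond.\<close>

lemma torus_datum_biholomorphic:
  assumes X: "torus_datum n X D \<alpha> b q \<tau>" and Y: "torus_datum n Y D \<alpha>' b' q' \<tau>'"
    and mod: "datum_modules n (d_lat D) (d_x D)"
  shows "biholomorphic n X Y"
proof -
  interpret X: torus_datum n X D \<alpha> b q \<tau> by (rule X)
  interpret Y: torus_datum n Y D \<alpha>' b' q' \<tau>' by (rule Y)
  obtain A where A: "clinear A" "\<And>w. w \<in> X.W \<Longrightarrow> A (\<tau> w) = \<tau>' w"
    using torus_datum_transfer[OF X Y mod] by blast
  obtain A' where A': "clinear A'" "\<And>w. w \<in> X.W \<Longrightarrow> A' (\<tau>' w) = \<tau> w"
    using torus_datum_transfer[OF Y X mod] by blast
  have \<psi>: "A (q + \<tau> w) + (q' - A q) = q' + \<tau>' w" if "w \<in> X.W" for w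
    using A(2)[OF that] by (simp add: clinearD[OF A(1)])
  have \<psi>': "A' (q' + \<tau>' w) + (q - A' q') = q + \<tau> w" if "w \<in> X.W" for w
    using A'(2)[OF that] by (simp add: clinearD[OF A'(1)])
  have Xc: "\<exists>w\<in>X.W. v = q + \<tau> w" if "v \<in> t_space X" for v
    using X.\<tau>_surj[OF csubspaceD(4)[OF X.csubspace_V that X.q]] by (metis add.commute diff_add_cancel)
  have Yc: "\<exists>w\<in>X.W. v = q' + \<tau>' w" if "v \<in> t_space Y" for v
    using Y.\<tau>_surj[OF csubspaceD(4)[OF Y.csubspace_V that Y.q]] by (metis add.commute diff_add_cancel)
  have XV: "q + \<tau> w \<in> t_space X" and YV: "q' + \<tau>' w \<in> t_space Y" if "w \<in> X.W" for w
    using that X.\<tau>_space Y.\<tau>_space X.q Y.q csubspaceD(2)[OF X.csubspace_V] csubspaceD(2)[OF Y.csubspace_V] by blast+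
  obtain \<beta> where \<beta>: "\<beta> \<in> X.W" "\<tau> \<beta> = b" "d_beta D = cls n X.L \<beta>"
    using X.beta by blast
  obtain \<beta>' where \<beta>': "\<beta>' \<in> X.W" "\<tau>' \<beta>' = b'" "d_beta D = cls n X.L \<beta>'"
    using Y.beta by blast
  have "\<beta> - \<beta>' \<in> X.\<Lambda>'"
    using \<beta>(3) \<beta>'(3) X.M_subset X.cls_eq_iff by blast
  then have k\<beta>: "of_nat k *\<^sub>R (\<beta> - \<beta>') \<in> X.\<Lambda>'" for k
    by (rule zmodule_scale_nat[OF X.zmodule_\<Lambda>'])
  have \<Lambda>': "X.\<Lambda>' = Y.\<Lambda>'"
    using X.cls_sub_iff Y.cls_sub_iff by blast
  show ?thesis
  proof (rule biholomorphic_affine[OF A(1) A'(1), where a = "q' - A q" and a' = "q - A' q'"])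
    show "A v + (q' - A q) \<in> t_space Y" if "v \<in> t_space X" for v
      using Xc[OF that] \<psi> YV by metis
    show "A' v + (q - A' q') \<in> t_space X" if "v \<in> t_space Y" for v
      using Yc[OF that] \<psi>' XV by metis
    show "A' (A v + (q' - A q)) + (q - A' q') = v" if "v \<in> t_space X" for v
      using Xc[OF that] \<psi> \<psi>' by metis
    show "A (A' v + (q - A' q')) + (q' - A q) = v" if "v \<in> t_space Y" for v
      using Yc[OF that] \<psi> \<psi>' by metis
    fix u v assume "u \<in> t_space X" "v \<in> t_space X"
    then obtain y w where y: "y \<in> X.W" "u = q + \<tau> y" and w: "w \<in> X.W" "v = q + \<tau> w"
      using Xc by meson
    have powW: "(d_x D ^^ k) w \<in> X.W" for k
      using X.\<tau>_funpow[OF w(1)] by blast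
    have kW: "y - (d_x D ^^ k) w - of_nat k *\<^sub>R c \<in> X.W" if "c \<in> X.W" for k c
      using y(1) powW that by (intro subspace_diff[OF X.subspace_W] subspace_scale[OF X.subspace_W])
    have "t_proj n X u = t_proj n X v \<longleftrightarrow> (\<exists>k. (q + \<tau> y) - (q + ((\<alpha> ^^ k) (\<tau> w) + of_nat k *\<^sub>R b)) \<in> t_lat X)"
      unfolding y(2) w(2) X.t_proj_eq_iff[OF XV[OF y(1)] XV[OF w(1)]] X.affine_power ..
    also have "\<dots> \<longleftrightarrow> (\<exists>k. y - (d_x D ^^ k) w - of_nat k *\<^sub>R \<beta> \<in> X.\<Lambda>')"
    proof -
      have "(q + \<tau> y) - (q + ((\<alpha> ^^ k) (\<tau> w) + of_nat k *\<^sub>R b)) = \<tau> (y - (d_x D ^^ k) w - of_nat k *\<^sub>R \<beta>)" for k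
        using X.\<tau>_funpow[OF w(1), of k] \<beta>(2)
        by (simp add: linear_diff[OF X.linear_\<tau>] linear_scale[OF X.linear_\<tau>])
      then show ?thesis
        using kW[OF \<beta>(1)] by simp
    qed
    also have "\<dots> \<longleftrightarrow> (\<exists>k. y - (d_x D ^^ k) w - of_nat k *\<^sub>R \<beta>' \<in> X.\<Lambda>')"
    proof (rule ex_cong1)
      fix k
      let ?u = "y - (d_x D ^^ k) w - of_nat k *\<^sub>R \<beta>" and ?u' = "y - (d_x D ^^ k) w - of_nat k *\<^sub>R \<beta>'"
      have eq: "?u + of_nat k *\<^sub>R (\<beta> - \<beta>') = ?u'" "?u' - of_nat k *\<^sub>R (\<beta> - \<beta>') = ?u"
        by (simp_all add: scaleR_diff_right)
      show "?u \<in> X.\<Lambda>' \<longleftrightarrow> ?u' \<in> X.\<Lambda>'"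
        using zmoduleD(4)[OF X.zmodule_\<Lambda>' _ k\<beta>, of ?u k] zmoduleD(2)[OF X.zmodule_\<Lambda>' _ k\<beta>, of ?u' k]
        unfolding eq by blast
    qed
    also have "\<dots> \<longleftrightarrow> (\<exists>k. (q' + \<tau>' y) - (q' + ((\<alpha>' ^^ k) (\<tau>' w) + of_nat k *\<^sub>R b')) \<in> t_lat Y)"
    proof -
      have "(q' + \<tau>' y) - (q' + ((\<alpha>' ^^ k) (\<tau>' w) + of_nat k *\<^sub>R b')) = \<tau>' (y - (d_x D ^^ k) w - of_nat k *\<^sub>R \<beta>')" for k
        using Y.\<tau>_funpow[OF w(1), of k] \<beta>'(2)
        by (simp add: linear_diff[OF Y.linear_\<tau>] linear_scale[OF Y.linear_\<tau>])
      then show ?thesis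
        unfolding \<Lambda>' using kW[OF \<beta>'(1)] by simp
    qed
    also have "\<dots> \<longleftrightarrow> t_proj n Y (q' + \<tau>' y) = t_proj n Y (q' + \<tau>' w)"
      unfolding Y.t_proj_eq_iff[OF YV[OF y(1)] YV[OF w(1)]] Y.affine_power ..
    finally show "t_proj n Y (A u + (q' - A q)) = t_proj n Y (A v + (q' - A q)) \<longleftrightarrow> t_proj n X u = t_proj n X v"
      unfolding y(2) w(2) \<psi>[OF y(1)] \<psi>[OF w(1)] by blast
  qed
qed

lemma free_torus_datum_of:
  assumes "n > 0" "free_torus_quotient n X" "datum_of n X D"
  obtains \<alpha> b q \<tau> where "free_torus_datum n X D \<alpha> b q \<tau>"
proof -
  have "complex_torus (t_space X) (t_lat X)" "group_action (integer_mod_group n) (carrier (t_torus X)) (t_act X)"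
    using assms(2) by (simp_all add: free_torus_quotient_def)
  then obtain \<alpha> b q \<tau> where "torus_datum n X D \<alpha> b q \<tau>"
    using datum_of_iff_torus_datum[OF assms(1)] assms(3) by blast
  then show ?thesis
    by (intro that free_torus_datum.intro free_torus_datum_axioms.intro assms(2))
qed

lemma datum_of_valid:
  assumes "n > 0" "free_torus_quotient n X" "datum_of n X D"
  shows "valid_datum n D" "cond_A n (d_lat D) (d_x D) (d_sub D)" "cond_B n (d_lat D) (d_sub D)"
    "no_critical_prime_powers n (d_lat D) \<Longrightarrow> cond_C n (d_lat D) (d_sub D) (d_beta D)"
proof -
  obtain \<alpha> b q \<tau> where "free_torus_datum n X D \<alpha> b q \<tau>"
    using free_torus_datum_of[OF assms] by blast
  then interpret free_torus_datum n X D \<alpha> b q \<tau> .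
  show "valid_datum n D" "cond_A n (d_lat D) (d_x D) (d_sub D)" "cond_B n (d_lat D) (d_sub D)"
    "no_critical_prime_powers n (d_lat D) \<Longrightarrow> cond_C n (d_lat D) (d_sub D) (d_beta D)"
    by (rule valid cond_A cond_B cond_C; assumption?)+
qed

text \<open>If L d = {0} for all d > 1, the data define a free quotient by translations, which for n
  > 1 is no Bagnera-De Franchis manifold; the least common multiple detects this. As data of a
  manifold can violate (C), the manifold is recovered from its data without reference to
  (C).\<close>

theorem theorem5p1:
  fixes n :: nat
  assumes "n > 0"
  shows
    \<comment> \<open>a manifold has data with the required properties\<close>
    "(\<forall>X :: ('m::finite) torus_quotient. bagnera_de_franchis n X \<longrightarrow>
        (\<exists>D :: ('m + 'm) bdf_datum. datum_of n X D)) \<and>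
     (\<forall>(X :: 'm torus_quotient) (D :: ('k::finite) bdf_datum).
        bagnera_de_franchis n X \<and> datum_of n X D \<longrightarrow>
          valid_datum n D \<and>
          cond_A n (d_lat D) (d_x D) (d_sub D) \<and>
          cond_B n (d_lat D) (d_sub D) \<and>
          (no_critical_prime_powers n (d_lat D) \<longrightarrow> cond_C n (d_lat D) (d_sub D) (d_beta D))) \<and>
     \<comment> \<open>data define a manifold, whose data they are\<close>
     (\<forall>D :: 'k bdf_datum.
        valid_datum n D \<and>
        cond_A n (d_lat D) (d_x D) (d_sub D) \<and>
        cond_B n (d_lat D) (d_sub D) \<and>
        cond_C n (d_lat D) (d_sub D) (d_beta D) \<longrightarrow>
          (\<exists>b. lifts_beta n D b) \<and>
          (\<forall>b. lifts_beta n D b \<longrightarrow>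
             free_torus_quotient n (manifold_of n D b) \<and>
             (bagnera_de_franchis n (manifold_of n D b) \<longleftrightarrow>
                Lcm {d \<in> divisors n. d_lat D d \<noteq> {0}} = n) \<and>
             datum_of n (manifold_of n D b) D)) \<and>
     \<comment> \<open>the data determine the manifold, and the construction recovers it\<close>
     (\<forall>(X :: 'm torus_quotient) (Y :: ('l::finite) torus_quotient) (D :: 'k bdf_datum).
        bagnera_de_franchis n X \<and> bagnera_de_franchis n Y \<and> datum_of n X D \<and> datum_of n Y D \<longrightarrow>
          biholomorphic n X Y) \<and>
     (\<forall>(X :: 'm torus_quotient) (D :: 'k bdf_datum).
        bagnera_de_franchis n X \<and> datum_of n X D \<longrightarrow>
          (\<exists>b. lifts_beta n D b) \<and>
          (\<forall>b. lifts_beta n D b \<longrightarrow> biholomorphic n X (manifold_of n D b))) \<and>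
     \<comment> \<open>the decomposition of V(d) into eigenspaces\<close>
     (\<forall>D :: 'k bdf_datum. valid_datum n D \<longrightarrow>
        (\<forall>d\<in>divisors n. is_direct_sum {j. j < d \<and> coprime j d}
           (eigenspace (d_x D) (d_hodge D d) d) (d_hodge D d))) \<and>
     \<comment> \<open>the consequence of (A) and (B), and finiteness\<close>
     (\<forall>(L :: nat \<Rightarrow> (real^'k) set) x. datum_modules n L x \<longrightarrow>
        (\<forall>S. finite_subgroup n L S \<and> cond_A n L x S \<and> cond_B n L S \<longrightarrow>
           S \<subseteq> Phi_over_Q_sum n L x) \<and>
        finite {S. finite_subgroup n L S \<and> cond_A n L x S \<and> cond_B n L S})"
proof (intro conjI allI impI ballI)
  fix X :: "'m torus_quotient"
  assume "bagnera_de_franchis n X"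
  then obtain \<alpha> c where "affine_torus n X \<alpha> c"
    using free_torus_quotient_affine[OF assms] unfolding bagnera_de_franchis_def by blast
  then show "\<exists>D :: ('m + 'm) bdf_datum. datum_of n X D"
    by (rule affine_torus.datum_exists)
next
  fix X :: "'m torus_quotient" and D :: "'k bdf_datum"
  assume "bagnera_de_franchis n X \<and> datum_of n X D"
  then have X: "free_torus_quotient n X" "datum_of n X D"
    by (auto simp: bagnera_de_franchis_def)
  show "valid_datum n D" "cond_A n (d_lat D) (d_x D) (d_sub D)" "cond_B n (d_lat D) (d_sub D)"
    by (rule datum_of_valid[OF assms X])+
  show "cond_C n (d_lat D) (d_sub D) (d_beta D)" if "no_critical_prime_powers n (d_lat D)"
    using that by (rule datum_of_valid[OF assms X])
next
  fix D :: "'k bdf_datum"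
  assume D: "valid_datum n D \<and> cond_A n (d_lat D) (d_x D) (d_sub D) \<and> cond_B n (d_lat D) (d_sub D) \<and>
    cond_C n (d_lat D) (d_sub D) (d_beta D)"
  interpret hodge_datum n D
    by unfold_locales (use assms D in auto)
  show "\<exists>b. lifts_beta n D b"
    by (rule lifts_beta_exists)
  fix b assume b: "lifts_beta n D b"
  interpret manifold_datum n D b
    by unfold_locales (use D b in auto)
  show "free_torus_quotient n (manifold_of n D b)"
    using free D by blast
  then show "bagnera_de_franchis n (manifold_of n D b) \<longleftrightarrow> Lcm {d \<in> divisors n. d_lat D d \<noteq> {0}} = n"
    using no_translations_iff by (simp add: bagnera_de_franchis_def)
  show "datum_of n (manifold_of n D b) D"
    by (rule datum_of)
next
  fix X :: "'m torus_quotient" and Y :: "'l torus_quotient" and D :: "'k bdf_datum"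
  assume XY: "bagnera_de_franchis n X \<and> bagnera_de_franchis n Y \<and> datum_of n X D \<and> datum_of n Y D"
  then obtain \<alpha> b q \<tau> \<alpha>' b' q' \<tau>'
    where X: "free_torus_datum n X D \<alpha> b q \<tau>" and Y: "free_torus_datum n Y D \<alpha>' b' q' \<tau>'"
    using free_torus_datum_of[OF assms] unfolding bagnera_de_franchis_def by metis
  show "biholomorphic n X Y"
    by (rule torus_datum_biholomorphic[OF free_torus_datum.axioms(1)[OF X] free_torus_datum.axioms(1)[OF Y]
          free_torus_datum.datum_modules[OF X]])
next
  fix X :: "'m torus_quotient" and D :: "'k bdf_datum"
  assume "bagnera_de_franchis n X \<and> datum_of n X D"
  then have X: "free_torus_quotient n X" "datum_of n X D"
    by (auto simp: bagnera_de_franchis_def)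
  interpret hodge_datum n D
    by unfold_locales (use assms datum_of_valid[OF assms X] in auto)
  show "\<exists>b. lifts_beta n D b"
    by (rule lifts_beta_exists)
  fix b assume b: "lifts_beta n D b"
  interpret manifold_datum n D b
    by unfold_locales (use b datum_of_valid[OF assms X] in auto)
  obtain \<alpha> c q \<tau> where X': "free_torus_datum n X D \<alpha> c q \<tau>"
    using free_torus_datum_of[OF assms X] by blast
  show "biholomorphic n X (manifold_of n D b)"
    by (rule torus_datum_biholomorphic[OF free_torus_datum.axioms(1)[OF X'] torus_datum modules])
next
  fix D :: "'k bdf_datum" and d
  assume "valid_datum n D" and d: "d \<in> divisors n"
  then interpret hodge_datum n D
    by unfold_locales (use assms in auto)
  show "is_direct_sum {j. j < d \<and> coprime j d} (eigenspace (d_x D) (d_hodge D d) d) (d_hodge D d)"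
    by (rule eigenspace_decomposition[OF d])
next
  fix L :: "nat \<Rightarrow> (real^'k) set" and x and S
  assume "datum_modules n L x"
  then interpret datum_lattices n L x
    by unfold_locales (rule assms)
  assume "finite_subgroup n L S \<and> cond_A n L x S \<and> cond_B n L S"
  then show "S \<subseteq> Phi_over_Q_sum n L x"
    using subgroup_subset_Phi_over_Q_sum by (auto simp: finite_subgroup_def)
next
  fix L :: "nat \<Rightarrow> (real^'k) set" and x
  assume "datum_modules n L x"
  then interpret datum_lattices n L x
    by unfold_locales (rule assms)
  have "{S. finite_subgroup n L S \<and> cond_A n L x S \<and> cond_B n L S} \<subseteq> Pow (Phi_over_Q_sum n L x)"
    using subgroup_subset_Phi_over_Q_sum by (auto simp: finite_subgroup_def)
  then show "finite {S. finite_subgroup n L S \<and> cond_A n L x S \<and> cond_B n L S}"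
    by (rule finite_subset) (simp add: finite_Phi_over_Q_sum)
qed

end
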